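(* Let $\mathbb{V},\mathbb{W}_1,\mathbb{W}_2$ be finite dimensional real inner product spaces, let $n,k\geq 1$ be integers, and for $i=1,2$ and each multi-index $\alpha\in\mathbb{N}_0^n$ with $|\alpha|=k$ let $a^i_\alpha\in L^1_{\rm loc}(\mathbb{R}^n,\mathscr{L}(\mathbb{V},\mathbb{W}_i))$. Define $$A_i(x,D)\varphi:=\sum_{|\alpha|=k}a^i_\alpha(x)\,\partial^\alpha\varphi\qquad(i=1,2)$$ for $\varphi\in C^\infty_c(\mathbb{R}^n,\mathbb{V})$. Let $c\geq 0$ be a constant. Then $$\|A_2(x,D)\varphi\|_{L^1}\leq c\,\|A_1(x,D)\varphi\|_{L^1}$$ holds for all $\varphi\in C^\infty_c(\mathbb{R}^n,\mathbb{V})$ if and only if there exists $C\in L^\infty(\mathbb{R}^n,\mathscr{L}(\mathbb{W}_1,\mathbb{W}_2))$ with $\|C\|_{L^\infty}\leq c$ such that $$a^2_\alpha(x)=C(x)\,a^1_\alpha(x)$$ for almost all $x\in\mathbb{R}^n$ and each multi-index $\alpha$ of length $k$.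
   Context: $\mathscr{L}(X,Y)$ is the space of linear maps from $X$ to $Y$. $C^\infty_c(\mathbb{R}^n,\mathbb{V})$ is the space of smooth compactly supported maps $\mathbb{R}^n\to\mathbb{V}$. The $L^1$ norms are over $\mathbb{R}^n$ with Lebesgue measure, with the inner product norms on $\mathbb{W}_i$; $\|C\|_{L^\infty}$ is the essential supremum of the operator norm of $C(x)$. *)

theory Defs
  imports "HOL-Analysis.Analysis" "HOL-Probability.Essential_Supremum"
begin

text \<open>
  Finite dimensional real inner product spaces are types of class \<open>real_inner\<close> spanned by a finite
  set. (The class \<open>euclidean_space\<close> would exclude the zero space.) On such a space every linear map
  is bounded, so that the type of bounded linear maps, with its operator norm, is the
  space of all linear maps.
\<close>

definition finite_dimensional :: "'a::real_vector itself \<Rightarrow> bool" where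
  "finite_dimensional _ \<longleftrightarrow> (\<exists>B :: 'a set. finite B \<and> span B = UNIV)"

definition partial_deriv ::
    "'n::finite \<Rightarrow> (real ^ 'n \<Rightarrow> 'v::real_normed_vector) \<Rightarrow> real ^ 'n \<Rightarrow> 'v" where
  "partial_deriv i f x = vector_derivative (\<lambda>t. f (x + t *\<^sub>R axis i 1)) (at 0)"

text \<open>
  \<open>f\<close> is smooth iff all its iterated partial derivatives, including \<open>f\<close> itself, are (totally)
  differentiable everywhere. Differentiability also gives continuity and the existence of the next
  partial derivatives, so this says that \<open>f\<close> is of class \<open>C\<^sup>k\<close> for all \<open>k\<close>.
\<close>

definition smooth :: "(real ^ 'n::finite \<Rightarrow> 'v::real_normed_vector) \<Rightarrow> bool" where
  "smooth f \<longleftrightarrow> (\<forall>js. (foldr partial_deriv js f) differentiable_on UNIV)"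

definition test_functions :: "(real ^ 'n::finite \<Rightarrow> 'v::real_normed_vector) set" where
  "test_functions = {\<phi>. smooth \<phi> \<and> compact (closure (support_on UNIV \<phi>))}"

definition multi_indices :: "nat \<Rightarrow> ('n::finite \<Rightarrow> nat) set" where
  "multi_indices k = {\<alpha>. sum \<alpha> UNIV = k}"

lemma finite_multi_indices: "finite (multi_indices k :: ('n::finite \<Rightarrow> nat) set)"
proof (rule finite_subset)
  show "(multi_indices k :: ('n \<Rightarrow> nat) set) \<subseteq> PiE UNIV (\<lambda>_. {..k})"
  proof
    fix \<alpha> :: "'n \<Rightarrow> nat" assume "\<alpha> \<in> multi_indices k"
    then have "\<alpha> i \<le> k" for i
      using member_le_sum[of i UNIV \<alpha>] by (simp add: multi_indices_def)
    then show "\<alpha> \<in> PiE UNIV (\<lambda>_. {..k})" by auto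
  qed
  show "finite (PiE (UNIV :: 'n set) (\<lambda>_. {..k}))" by (rule finite_PiE) auto
qed

text \<open>
  The derivative for the multi-index \<open>\<alpha>\<close> differentiates \<open>\<alpha> i\<close> times in the direction \<open>i\<close>, for every
  \<open>i\<close>. The index type carries no order, so an arbitrary list containing each \<open>i\<close> exactly \<open>\<alpha> i\<close>
  times is chosen; for smooth functions the result does not depend on it, because partial
  derivatives commute. Such a list exists by \<open>ex_multi_index_list\<close>.
\<close>

definition multi_deriv ::
    "('n::finite \<Rightarrow> nat) \<Rightarrow> (real ^ 'n \<Rightarrow> 'v::real_normed_vector) \<Rightarrow> real ^ 'n \<Rightarrow> 'v" where
  "multi_deriv \<alpha> f = foldr partial_deriv (SOME js. \<forall>i. count_list js i = \<alpha> i) f"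

lemma ex_multi_index_list: "\<exists>js. \<forall>i. count_list js i = \<alpha> i" for \<alpha> :: "'n::finite \<Rightarrow> nat"
proof -
  have "\<exists>js. \<forall>i. count_list js i = (if i \<in> S then \<alpha> i else 0)" if "finite S" for S :: "'n set"
    using that
  proof (induction S)
    case empty
    show ?case by (rule exI[of _ "[]"]) simp
  next
    case (insert j S)
    then obtain js where js: "\<forall>i. count_list js i = (if i \<in> S then \<alpha> i else 0)"
      by blast
    have rep: "count_list (replicate m j) i = (if i = j then m else 0)" for m i
      by (induction m) auto
    show ?case
      using insert.hyps js
      by (intro exI[of _ "replicate (\<alpha> j) j @ js"]) (auto simp: rep)
  qed
  from this[of UNIV] show ?thesis by simp
qed

definition L1_loc :: "('a::euclidean_space \<Rightarrow> 'b::real_normed_vector) set" where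
  "L1_loc = {f \<in> borel_measurable lebesgue.
    \<forall>K. compact K \<longrightarrow> set_integrable lebesgue K (\<lambda>x. norm (f x))}"

definition L1_norm :: "('a::euclidean_space \<Rightarrow> 'b::real_normed_vector) \<Rightarrow> ennreal" where
  "L1_norm f = (\<integral>\<^sup>+ x. ennreal (norm (f x)) \<partial>lebesgue)"

definition Linf_norm :: "('a::euclidean_space \<Rightarrow> 'b::real_normed_vector) \<Rightarrow> ennreal" where
  "Linf_norm f = esssup lebesgue (\<lambda>x. ennreal (norm (f x)))"

definition Linf :: "('a::euclidean_space \<Rightarrow> 'b::real_normed_vector) set" where
  "Linf = {f \<in> borel_measurable lebesgue. Linf_norm f < \<infinity>}"

definition diff_op ::
    "nat \<Rightarrow> (('n::finite \<Rightarrow> nat) \<Rightarrow> real ^ 'n \<Rightarrow> 'v::real_normed_vector \<Rightarrow>\<^sub>L 'w::real_normed_vector)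
      \<Rightarrow> (real ^ 'n \<Rightarrow> 'v) \<Rightarrow> real ^ 'n \<Rightarrow> 'w" where
  "diff_op k a \<phi> x = (\<Sum>\<alpha>\<in>multi_indices k. blinfun_apply (a \<alpha> x) (multi_deriv \<alpha> \<phi> x))"

end

theory Submission
  imports Defs "HOL-Computational_Algebra.Polynomial"
begin

text \<open>
  Sufficiency is the pointwise bound \<open>norm (C x w) \<le> c * norm w\<close> under the integral sign. Necessity
  is a version of Ornstein's non-inequality with variable coefficients, and is proved in three
  steps.

  Localisation. Write \<open>A\<^sub>i x \<xi>\<close> for the value of the operator on a jet \<open>\<xi>\<close> at \<open>x\<close>
  (\<open>symbol_op\<close>). Testing the inequality with \<open>\<lambda>x. \<psi> ((x - s) / \<epsilon>)\<close>, multiplying by a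
  weight \<open>w s \<ge> 0\<close>, integrating over \<open>s\<close> and letting \<open>\<epsilon>\<close> tend to \<open>0\<close> freezes the
  coefficients: the function \<open>F \<xi> = (\<integral>x. w x * (c * norm (A\<^sub>1 x \<xi>) - norm (A\<^sub>2 x \<xi>)))\<close> of a single
  jet satisfies \<open>(\<integral>y. F (jet \<psi> y)) \<ge> 0\<close> for every test function \<open>\<psi>\<close> on the unit cube. Averaging
  over the translations takes the place of a theorem on Lebesgue points.

  Positivity. A Lipschitz, even, positively one-homogeneous \<open>F\<close> with this property is nonnegative
  (\<open>nonneg_everywhere\<close>). Its quasiconvex envelope
  \<open>f \<xi> = (INF \<psi>. \<integral>y. F (\<xi> + jet \<psi> y))\<close> is finite by hypothesis, lies below \<open>F\<close>, and is again
  Lipschitz, even and homogeneous. Gluing rescaled near-minimisers on a fine grid shows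
  \<open>f \<xi> \<le> (\<integral>y. f (\<xi> + jet \<psi> y))\<close>, and highly oscillating \<open>\<psi>\<close> then show that \<open>f\<close> is convex along
  every jet of the form \<open>a\<^sup>\<alpha> *\<^sub>R v\<close> (\<open>envelope_convex_rank_one\<close>). These jets span
  (\<open>monomials_separate\<close>). A homogeneous Lipschitz function that is convex in each coordinate has a
  linear minorant \<open>l\<close>: blow it up successively in the coordinate directions
  (\<open>linear_minorant\<close>). As \<open>f\<close> is even, \<open>f \<ge> \<bar>l\<bar> \<ge> 0\<close>, and \<open>F \<ge> f\<close>.

  Factorisation. Letting \<open>w\<close> and \<open>\<xi>\<close> vary gives, for almost every \<open>x\<close>, the inequality
  \<open>norm (A\<^sub>2 x \<xi>) \<le> c * norm (A\<^sub>1 x \<xi>)\<close> for all \<open>\<xi>\<close> (\<open>AE_all_symbol_le\<close>). Hence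
  \<open>A\<^sub>1 x \<xi> \<mapsto> A\<^sub>2 x \<xi>\<close> is a well-defined map with norm at most \<open>c\<close> on the range of \<open>A\<^sub>1 x\<close>; it is
  extended by zero to the orthogonal complement, and a Gram-Schmidt process carried out
  simultaneously for all \<open>x\<close> makes the extension measurable in \<open>x\<close> (\<open>exists_multiplier\<close>).
\<close>

section \<open>Linear minorants of homogeneous, separately convex functions\<close>

text \<open>
  The function \<open>h\<close> is the blow-up of \<open>g\<close> at the unit vector \<open>e\<close> of the coordinate \<open>m\<close>, the
  decreasing limit of \<open>g (t + s e) - s * g e\<close> as \<open>s\<close> tends to infinity. Its existence rests on the
  fact that the slope of a convex function is at most its slope at infinity, which by homogeneity
  is \<open>g e\<close>. The limit is affine in the direction \<open>e\<close> and keeps all other properties of \<open>g\<close>,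
  including affinity in directions treated before.
\<close>

lemma linear_minorant_step:
  fixes g :: "('j \<Rightarrow> real) \<Rightarrow> real"
  assumes fin: "finite J" and m: "m \<in> J"
    and hom: "\<And>r t. r > 0 \<Longrightarrow> g (\<lambda>j. r * t j) = r * g t"
    and lip: "\<And>s t. \<bar>g s - g t\<bar> \<le> K * (\<Sum>j\<in>J. \<bar>s j - t j\<bar>)"
    and cvx: "\<And>j t. j \<in> J \<Longrightarrow> convex_on UNIV (\<lambda>r. g (t(j := r)))"
  obtains h where "\<And>t. h t \<le> g t"
    "\<And>r t. r > 0 \<Longrightarrow> h (\<lambda>j. r * t j) = r * h t"
    "\<And>s t. \<bar>h s - h t\<bar> \<le> K * (\<Sum>j\<in>J. \<bar>s j - t j\<bar>)"
    "\<And>j t. j \<in> J \<Longrightarrow> convex_on UNIV (\<lambda>r. h (t(j := r)))"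
    "\<And>r t. h (t(m := t m + r)) = h t + r * g ((\<lambda>_. 0)(m := 1))"
    "\<forall>i c. i \<noteq> m \<longrightarrow> (\<forall>r t. g (t(i := t i + r)) = g t + r * c) \<longrightarrow>
      (\<forall>r t. h (t(i := t i + r)) = h t + r * c)"
proof -
  define e :: "'j \<Rightarrow> real" where "e = (\<lambda>_. 0)(m := 1)"
  define u where "u t s = g (t(m := t m + s)) - s * g e" for t s
  define h where "h t = (INF s. u t s)" for t
  have lip_e: "\<bar>g (t(m := t m + s)) - s * g e\<bar> \<le> K * (\<Sum>j\<in>J. \<bar>t j\<bar>)" if "s > 0" for t s
  proof -
    have "\<bar>g (t(m := t m + s)) - g (\<lambda>j. s * e j)\<bar>
        \<le> K * (\<Sum>j\<in>J. \<bar>(t(m := t m + s)) j - s * e j\<bar>)" by (rule lip)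
    also have "(\<Sum>j\<in>J. \<bar>(t(m := t m + s)) j - s * e j\<bar>) = (\<Sum>j\<in>J. \<bar>t j\<bar>)"
      by (rule sum.cong) (auto simp: e_def)
    finally show ?thesis using hom[OF that, of e] by (simp add: fun_upd_def)
  qed
  have slope: "g (x(m := x m + r)) \<le> g x + r * g e" if r: "r \<ge> 0" for x r
  proof -
    define M where "M = K * (\<Sum>j\<in>J. \<bar>x j\<bar>) - g x"
    \<comment> \<open>convexity between \<open>x\<close> and the distant point \<open>x + T e\<close>, whose value is \<open>T * g e\<close> up to a bounded error\<close>
    have bound: "g (x(m := x m + r)) \<le> g x + r * g e + r * M / T" if T: "T > r" for T
    proof -
      have T0: "T > 0" using T r by linarith
      have "g (x(m := (1 - r / T) *\<^sub>R x m + (r / T) *\<^sub>R (x m + T)))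
          \<le> (1 - r / T) * g (x(m := x m)) + (r / T) * g (x(m := x m + T))"
        by (rule convex_onD[OF cvx[OF m]]) (use r T in auto)
      moreover have "(1 - r / T) *\<^sub>R x m + (r / T) *\<^sub>R (x m + T) = x m + r"
        using T0 by (simp add: field_simps)
      ultimately have "g (x(m := x m + r)) \<le> (1 - r / T) * g x + (r / T) * g (x(m := x m + T))"
        by simp
      also have "(r / T) * g (x(m := x m + T)) \<le> (r / T) * (T * g e + K * (\<Sum>j\<in>J. \<bar>x j\<bar>))"
        using lip_e[OF T0, of x] r T0 by (intro mult_left_mono) auto
      also have "(1 - r / T) * g x + (r / T) * (T * g e + K * (\<Sum>j\<in>J. \<bar>x j\<bar>)) = g x + r * g e + r * M / T"
        using T0 by (simp add: M_def field_simps)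
      finally show ?thesis by simp
    qed
    have "((\<lambda>T. g x + r * g e + r * M / T) \<longlongrightarrow> g x + r * g e + 0) at_top"
      by (intro tendsto_intros tendsto_divide_0[OF tendsto_const]
          filterlim_at_top_imp_at_infinity filterlim_ident)
    moreover have "\<forall>\<^sub>F T in at_top. g (x(m := x m + r)) \<le> g x + r * g e + r * M / T"
      using eventually_gt_at_top[of r] by eventually_elim (rule bound)
    ultimately show ?thesis
      using tendsto_lowerbound[of _ _ at_top "g (x(m := x m + r))"] by fastforce
  qed
  have u_mono: "u t s' \<le> u t s" if "s \<le> s'" for t s s'
    using slope[of "s' - s" "t(m := t m + s)"] that by (simp add: u_def algebra_simps)
  have u_lower: "- (K * (\<Sum>j\<in>J. \<bar>t j\<bar>)) \<le> u t s" for t s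
    using lip_e[of "max 1 s" t] u_mono[of s "max 1 s" t] unfolding u_def by linarith
  then have bdd: "bdd_below (range (u t))" for t
    by (intro bdd_belowI) auto
  have h_le: "h t \<le> u t s" for t s
    unfolding h_def by (rule cINF_lower[OF bdd]) simp
  have h_ge: "(\<And>s. b \<le> u t s) \<Longrightarrow> b \<le> h t" for b t
    unfolding h_def by (rule cINF_greatest) auto
  have h_approx: "\<exists>s. u t s < h t + \<epsilon>" if "\<epsilon> > 0" for t \<epsilon>
    using h_ge[of "h t + \<epsilon>" t] that by (meson not_le less_add_same_cancel1)
  show thesis
  proof
    show "h t \<le> g t" for t
      using h_le[of t 0] by (simp add: u_def)
    have hom_le: "h (\<lambda>j. r * t j) \<le> r * h t" if r: "r > 0" for r t
    proof -
      have "h (\<lambda>j. r * t j) / r \<le> u t s" for s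
      proof -
        have eq: "(\<lambda>j. r * t j)(m := r * t m + r * s) = (\<lambda>j. r * (t(m := t m + s)) j)"
          by (auto simp: algebra_simps)
        have "u (\<lambda>j. r * t j) (r * s) = r * u t s"
          using hom[OF r, of "t(m := t m + s)"] unfolding u_def eq by (simp add: algebra_simps)
        then show ?thesis using h_le[of "\<lambda>j. r * t j" "r * s"] r by (simp add: field_simps)
      qed
      then have "h (\<lambda>j. r * t j) / r \<le> h t" by (rule h_ge)
      then show ?thesis using r by (simp add: field_simps)
    qed
    show "h (\<lambda>j. r * t j) = r * h t" if r: "r > 0" for r t
    proof (rule antisym[OF hom_le[OF r]])
      have "h (\<lambda>j. (1 / r) * (r * t j)) \<le> (1 / r) * h (\<lambda>j. r * t j)"
        by (rule hom_le) (use r in simp)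
      then show "r * h t \<le> h (\<lambda>j. r * t j)" using r by (simp add: field_simps)
    qed
    have lip_le: "h s - h t \<le> K * (\<Sum>j\<in>J. \<bar>s j - t j\<bar>)" for s t
    proof -
      have "h s - K * (\<Sum>j\<in>J. \<bar>s j - t j\<bar>) \<le> u t r" for r
      proof -
        have "\<bar>g (s(m := s m + r)) - g (t(m := t m + r))\<bar>
            \<le> K * (\<Sum>j\<in>J. \<bar>(s(m := s m + r)) j - (t(m := t m + r)) j\<bar>)" by (rule lip)
        also have "(\<Sum>j\<in>J. \<bar>(s(m := s m + r)) j - (t(m := t m + r)) j\<bar>) = (\<Sum>j\<in>J. \<bar>s j - t j\<bar>)"
          by (rule sum.cong) auto
        finally show ?thesis using h_le[of s r] by (simp add: u_def fun_upd_def)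
      qed
      then have "h s - K * (\<Sum>j\<in>J. \<bar>s j - t j\<bar>) \<le> h t" by (rule h_ge)
      then show ?thesis by simp
    qed
    show "\<bar>h s - h t\<bar> \<le> K * (\<Sum>j\<in>J. \<bar>s j - t j\<bar>)" for s t
      using lip_le[of s t] lip_le[of t s] by (simp add: abs_minus_commute abs_le_iff)
    show "convex_on UNIV (\<lambda>r. h (t(j := r)))" if j: "j \<in> J" for j t
    proof (rule convex_onI)
      fix l x y :: real assume l: "0 < l" "l < 1"
      have u_cvx: "u (t(j := (1 - l) *\<^sub>R x + l *\<^sub>R y)) s
          \<le> (1 - l) * u (t(j := x)) s + l * u (t(j := y)) s" for s
      proof (cases "j = m")
        case True
        have "g (t(m := (1 - l) *\<^sub>R (x + s) + l *\<^sub>R (y + s)))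
            \<le> (1 - l) * g (t(m := x + s)) + l * g (t(m := y + s))"
          using convex_onD[OF cvx[OF m, of t], of l "x + s" "y + s"] l by simp
        then show ?thesis using True by (simp add: u_def algebra_simps)
      next
        case False
        have "g ((t(m := t m + s))(j := (1 - l) *\<^sub>R x + l *\<^sub>R y))
            \<le> (1 - l) * g ((t(m := t m + s))(j := x)) + l * g ((t(m := t m + s))(j := y))"
          using convex_onD[OF cvx[OF j, of "t(m := t m + s)"], of l x y] l by simp
        then show ?thesis using False by (simp add: u_def algebra_simps fun_upd_twist)
      qed
      show "h (t(j := (1 - l) *\<^sub>R x + l *\<^sub>R y)) \<le> (1 - l) * h (t(j := x)) + l * h (t(j := y))"
      proof (rule field_le_epsilon)
        fix \<epsilon> :: real assume \<epsilon>: "\<epsilon> > 0"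
        \<comment> \<open>since \<open>u\<close> decreases in \<open>s\<close>, one value of \<open>s\<close> is almost optimal at both end points\<close>
        obtain s1 s2 where s: "u (t(j := x)) s1 < h (t(j := x)) + \<epsilon>" "u (t(j := y)) s2 < h (t(j := y)) + \<epsilon>"
          using h_approx[OF \<epsilon>] by meson
        define s where "s = max s1 s2"
        have sx: "u (t(j := x)) s \<le> h (t(j := x)) + \<epsilon>" and sy: "u (t(j := y)) s \<le> h (t(j := y)) + \<epsilon>"
          using s u_mono[of s1 s "t(j := x)"] u_mono[of s2 s "t(j := y)"] by (auto simp: s_def)
        have "h (t(j := (1 - l) *\<^sub>R x + l *\<^sub>R y)) \<le> (1 - l) * u (t(j := x)) s + l * u (t(j := y)) s"
          using h_le u_cvx order_trans by blast
        also have "\<dots> \<le> (1 - l) * (h (t(j := x)) + \<epsilon>) + l * (h (t(j := y)) + \<epsilon>)"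
          using sx sy l by (intro add_mono mult_left_mono) auto
        finally show "h (t(j := (1 - l) *\<^sub>R x + l *\<^sub>R y)) \<le> (1 - l) * h (t(j := x)) + l * h (t(j := y)) + \<epsilon>"
          by (simp add: algebra_simps)
      qed
    qed simp
    have lin_le: "h (t(m := t m + r)) \<le> h t + r * g e" for r t
    proof -
      have "h (t(m := t m + r)) - r * g e \<le> u t s" for s
        using h_le[of "t(m := t m + r)" "s - r"] by (simp add: u_def algebra_simps)
      from h_ge[OF this] show ?thesis by simp
    qed
    have "h (t(m := t m + r)) = h t + r * g e" for r t
      using lin_le[of t r] lin_le[of "t(m := t m + r)" "- r"] by simp
    then show "h (t(m := t m + r)) = h t + r * g ((\<lambda>_. 0)(m := 1))" for r t
      unfolding e_def .
    show "\<forall>i c. i \<noteq> m \<longrightarrow> (\<forall>r t. g (t(i := t i + r)) = g t + r * c) \<longrightarrow>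
      (\<forall>r t. h (t(i := t i + r)) = h t + r * c)"
    proof (intro allI impI)
      fix i c r t
      assume i: "i \<noteq> m" and lin: "\<forall>r t. g (t(i := t i + r)) = g t + r * c"
      have le: "h (t(i := t i + r)) \<le> h t + r * c" for r t
      proof -
        have "h (t(i := t i + r)) - r * c \<le> u t s" for s
          using h_le[of "t(i := t i + r)" s] lin[rule_format, of "t(m := t m + s)" r] i
          by (simp add: u_def algebra_simps fun_upd_twist)
        from h_ge[OF this] show ?thesis by simp
      qed
      show "h (t(i := t i + r)) = h t + r * c"
        using le[of t r] le[of "t(i := t i + r)" "- r"] by simp
    qed
  qed
qed

text \<open>
  After a blow-up in every coordinate the function is affine in each of them, and homogeneity
  removes the constant.
\<close>

lemma linear_minorant:
  fixes g :: "('j \<Rightarrow> real) \<Rightarrow> real"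
  assumes fin: "finite J"
    and hom: "\<And>r t. r > 0 \<Longrightarrow> g (\<lambda>j. r * t j) = r * g t"
    and lip: "\<And>s t. \<bar>g s - g t\<bar> \<le> K * (\<Sum>j\<in>J. \<bar>s j - t j\<bar>)"
    and cvx: "\<And>j t. j \<in> J \<Longrightarrow> convex_on UNIV (\<lambda>r. g (t(j := r)))"
  obtains c where "\<And>t. (\<Sum>j\<in>J. c j * t j) \<le> g t"
proof -
  define Q where "Q I h c \<longleftrightarrow> (\<forall>t. h t \<le> g t) \<and> (\<forall>r t. r > 0 \<longrightarrow> h (\<lambda>j. r * t j) = r * h t)
      \<and> (\<forall>s t. \<bar>h s - h t\<bar> \<le> K * (\<Sum>j\<in>J. \<bar>s j - t j\<bar>))
      \<and> (\<forall>j t. j \<in> J \<longrightarrow> convex_on UNIV (\<lambda>r. h (t(j := r))))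
      \<and> (\<forall>i\<in>I. \<forall>r t. h (t(i := t i + r)) = h t + r * c i)" for I h c
  have "\<exists>h c. Q I h c"
    if "I \<subseteq> J" "finite I" for I
    using that(2,1)
  proof (induction I)
    case empty
    have "Q {} g (\<lambda>_. 0)" unfolding Q_def by (intro conjI allI impI ballI order_refl) (fact hom lip cvx | simp)+
    then show ?case by blast
  next
    case (insert m I)
    then obtain h c where Q: "Q I h c" by auto
    have h: "\<And>t. h t \<le> g t" "\<And>r t. r > 0 \<Longrightarrow> h (\<lambda>j. r * t j) = r * h t"
      "\<And>s t. \<bar>h s - h t\<bar> \<le> K * (\<Sum>j\<in>J. \<bar>s j - t j\<bar>)"
      "\<And>j t. j \<in> J \<Longrightarrow> convex_on UNIV (\<lambda>r. h (t(j := r)))"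
      "\<And>i r t. i \<in> I \<Longrightarrow> h (t(i := t i + r)) = h t + r * c i"
      using Q unfolding Q_def by (simp_all del: fun_upd_apply)
    have m: "m \<in> J" using insert by auto
    obtain h' where h': "\<And>t. h' t \<le> h t" "\<And>r t. r > 0 \<Longrightarrow> h' (\<lambda>j. r * t j) = r * h' t"
      "\<And>s t. \<bar>h' s - h' t\<bar> \<le> K * (\<Sum>j\<in>J. \<bar>s j - t j\<bar>)"
      "\<And>j t. j \<in> J \<Longrightarrow> convex_on UNIV (\<lambda>r. h' (t(j := r)))"
      "\<And>r t. h' (t(m := t m + r)) = h' t + r * h ((\<lambda>_. 0)(m := 1))"
      "\<forall>i c. i \<noteq> m \<longrightarrow> (\<forall>r t. h (t(i := t i + r)) = h t + r * c) \<longrightarrow>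
        (\<forall>r t. h' (t(i := t i + r)) = h' t + r * c)"
      by (rule linear_minorant_step[OF fin m h(2-4)]) (assumption | rule that)+
    have "Q (insert m I) h' (c(m := h ((\<lambda>_. 0)(m := 1))))"
      unfolding Q_def
    proof (intro conjI allI ballI impI)
      show "h' t \<le> g t" for t using h(1) h'(1) order_trans by blast
      show "h' (t(i := t i + r)) = h' t + r * (c(m := h ((\<lambda>_. 0)(m := 1)))) i"
        if "i \<in> insert m I" for i r t
      proof (cases "i = m")
        case True
        then show ?thesis using h'(5)[of t r] by simp
      next
        case False
        then have "i \<in> I" using that by simp
        then show ?thesis using h'(6)[rule_format, OF False, of "c i" t r] h(5) False by simp
      qed
    qed (fact h'(2-4))+
    then show ?case by blast
  qed
  from this[OF order_refl fin] obtain h c where Q: "Q J h c" by auto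
  have h: "\<And>t. h t \<le> g t" "\<And>r t. r > 0 \<Longrightarrow> h (\<lambda>j. r * t j) = r * h t"
      "\<And>s t. \<bar>h s - h t\<bar> \<le> K * (\<Sum>j\<in>J. \<bar>s j - t j\<bar>)"
      "\<And>i r t. i \<in> J \<Longrightarrow> h (t(i := t i + r)) = h t + r * c i"
    using Q unfolding Q_def by (simp_all del: fun_upd_apply)
  have "h t = h (\<lambda>j. if j \<in> S then 0 else t j) + (\<Sum>j\<in>S. c j * t j)"
    if "finite S" "S \<subseteq> J" for S t
    using that
  proof (induction S)
    case empty
    show ?case by simp
  next
    case (insert i S)
    define t' where "t' = (\<lambda>j. if j \<in> insert i S then 0 else t j)"
    have eq: "(\<lambda>j. if j \<in> S then 0 else t j) = t'(i := t' i + t i)"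
      using insert by (auto simp: t'_def)
    have "h (\<lambda>j. if j \<in> S then 0 else t j) = h t' + t i * c i"
      unfolding eq using insert by (intro h(4)) auto
    then show ?case using insert by (simp add: t'_def algebra_simps)
  qed
  moreover have "h (\<lambda>j. if j \<in> J then 0 else t j) = 0" for t
  proof -
    have "h (\<lambda>_. 0) = 0" using h(2)[of 2 "\<lambda>_. 0"] by simp
    then show ?thesis using h(3)[of "\<lambda>j. if j \<in> J then 0 else t j" "\<lambda>_. 0"] by simp
  qed
  ultimately have "(\<Sum>j\<in>J. c j * t j) \<le> g t" for t
    using h(1)[of t] fin by (metis add_0 order_refl)
  then show thesis by (rule that)
qed

text \<open>
  A linear minorant applied at \<open>t\<close> and at \<open>- t\<close> has opposite signs.
\<close>

lemma nonneg_of_even_convex: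
  fixes g :: "('j \<Rightarrow> real) \<Rightarrow> real"
  assumes "finite J"
    and "\<And>r t. r > 0 \<Longrightarrow> g (\<lambda>j. r * t j) = r * g t"
    and even: "\<And>t. g (\<lambda>j. - t j) = g t"
    and "\<And>s t. \<bar>g s - g t\<bar> \<le> K * (\<Sum>j\<in>J. \<bar>s j - t j\<bar>)"
    and "\<And>j t. j \<in> J \<Longrightarrow> convex_on UNIV (\<lambda>r. g (t(j := r)))"
  shows "g t \<ge> 0"
proof -
  obtain c where c: "\<And>t. (\<Sum>j\<in>J. c j * t j) \<le> g t"
    using linear_minorant[of J g K] assms by metis
  show ?thesis using c[of t] c[of "\<lambda>j. - t j"] even[of t] by (simp add: sum_negf)
qed

text \<open>
  If \<open>h\<close> exceeds one of its chords, then \<open>h\<close> minus the chord has a positive maximum inside the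
  interval. At the leftmost maximum point every midpoint inequality fails, because the left
  neighbour has a strictly smaller value. One midpoint inequality at each scale is therefore
  enough.
\<close>

lemma convex_on_of_local_midpoint:
  fixes h :: "real \<Rightarrow> real"
  assumes cont: "continuous_on UNIV h"
    and mid: "\<And>x \<rho>. \<rho> > 0 \<Longrightarrow> \<exists>b\<in>{0<..1}. h x \<le> (h (x + \<rho> * b) + h (x - \<rho> * b)) / 2"
  shows "convex_on UNIV h"
proof (rule convex_onI)
  fix l x y :: real assume l: "0 < l" "l < 1"
  have main: "h ((1 - l) * x + l * y) \<le> (1 - l) * h x + l * h y"
    if l: "0 < l" "l < 1" and xy: "x < y" for l x y
  proof (rule ccontr)
    assume neg: "\<not> ?thesis"
    define s where "s = (h y - h x) / (y - x)"
    define g where "g z = h z - (h x + s * (z - x))" for z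
    have sy: "s * (y - x) = h y - h x" using xy by (simp add: s_def)
    have gx: "g x = 0" and gy: "g y = 0" using sy by (auto simp: g_def)
    define z where "z = (1 - l) * x + l * y"
    have zx: "z - x = l * (y - x)" by (simp add: z_def algebra_simps)
    have "s * (z - x) = l * (h y - h x)" unfolding zx using sy by (simp add: mult.left_commute)
    then have gz: "g z > 0" using neg by (simp add: g_def z_def algebra_simps)
    have z: "x \<le> z" "z \<le> y"
    proof -
      show "x \<le> z" using zx l xy by (smt (verit) mult_nonneg_nonneg)
      have "y - z = (1 - l) * (y - x)" by (simp add: z_def algebra_simps)
      then show "z \<le> y" using l xy by (smt (verit) mult_nonneg_nonneg)
    qed
    have gcont: "continuous_on A g" for A
      unfolding g_def by (intro continuous_intros continuous_on_subset[OF cont]) auto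
    obtain p where p: "p \<in> {x..y}" "\<And>q. q \<in> {x..y} \<Longrightarrow> g q \<le> g p"
      using continuous_attains_sup[OF _ _ gcont, of "{x..y}"] z by fastforce
    define M where "M = g p"
    have M: "M > 0" using p(2)[of z] z gz by (simp add: M_def)
    define A where "A = {x..y} \<inter> {q. g q = M}"
    have "compact A"
      unfolding A_def by (intro compact_Int_closed compact_Icc closed_Collect_eq gcont continuous_on_const)
    moreover have "p \<in> A" using p by (simp add: A_def M_def)
    ultimately obtain x0 where x0: "x0 \<in> A" "\<And>q. q \<in> A \<Longrightarrow> x0 \<le> q"
      using continuous_attains_inf[of A "\<lambda>q. q"] by fastforce
    have gx0: "g x0 = M" "x \<le> x0" "x0 \<le> y" using x0(1) by (auto simp: A_def)
    then have strict: "x < x0" "x0 < y" using gx gy M by (metis less_le order_less_irrefl)+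
    define \<rho> where "\<rho> = min (x0 - x) (y - x0)"
    have \<rho>: "\<rho> > 0" using strict by (simp add: \<rho>_def)
    obtain b where b: "0 < b" "b \<le> 1" "h x0 \<le> (h (x0 + \<rho> * b) + h (x0 - \<rho> * b)) / 2"
      using mid[OF \<rho>, of x0] by auto
    have \<rho>b: "\<rho> * b \<le> \<rho>" "0 < \<rho> * b" using b \<rho> by auto
    have right: "g (x0 + \<rho> * b) \<le> M"
      unfolding M_def by (rule p(2)) (use \<rho>b \<rho>_def strict in auto)
    have inI: "x0 - \<rho> * b \<in> {x..y}" using \<rho>b \<rho>_def strict by auto
    then have "g (x0 - \<rho> * b) \<le> M" unfolding M_def by (rule p(2))
    moreover have "g (x0 - \<rho> * b) \<noteq> M"
      using x0(2)[of "x0 - \<rho> * b"] inI \<rho>b by (auto simp: A_def)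
    ultimately have left: "g (x0 - \<rho> * b) < M" by simp
    have "g x0 \<le> (g (x0 + \<rho> * b) + g (x0 - \<rho> * b)) / 2"
      using b(3) by (simp add: g_def field_simps)
    then show False using left right gx0(1) by simp
  qed
  show "h ((1 - l) *\<^sub>R x + l *\<^sub>R y) \<le> (1 - l) * h x + l * h y"
  proof (cases x y rule: linorder_cases)
    case less
    then show ?thesis using main[OF l less] by simp
  next
    case equal
    then show ?thesis by (simp add: algebra_simps)
  next
    case greater
    then show ?thesis using main[of "1 - l" y x] l by (simp add: algebra_simps)
  qed
qed simp

section \<open>Powers of vectors separate multi-indices\<close>

text \<open>
  The \<open>c j\<close> are the coefficients of degree \<open>m\<close> of the Lagrange polynomials for the nodes
  \<open>0, ..., k\<close>: comparing coefficients in the interpolation formula for the monomial of degree \<open>l\<close> gives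
  the claim.
\<close>

lemma coeff_from_values:
  assumes m: "m \<le> k"
  obtains c :: "nat \<Rightarrow> real" where "\<And>l. l \<le> k \<Longrightarrow> (\<Sum>j\<le>k. c j * real j ^ l) = (if l = m then 1 else 0)"
proof -
  define N :: "nat \<Rightarrow> real poly" where "N j = (\<Prod>i\<in>{..k} - {j}. [:- real i, 1:])" for j
  define Lp where "Lp j = smult (1 / poly (N j) (real j)) (N j)" for j
  have N0: "poly (N j) (real j) \<noteq> 0" for j
    by (simp add: N_def poly_prod)
  have eval: "poly (Lp j) (real i) = (if i = j then 1 else 0)" if "i \<le> k" for i j
  proof (cases "i = j")
    case True
    then show ?thesis using N0[of j] by (simp add: Lp_def)
  next
    case False
    then have "poly (N j) (real i) = 0" using that by (auto simp: N_def poly_prod)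
    then show ?thesis using False by (simp add: Lp_def)
  qed
  have deg: "degree (Lp j) \<le> k" if "j \<le> k" for j
  proof -
    have "degree (Lp j) \<le> degree (N j)" by (simp add: Lp_def)
    also have "\<dots> \<le> sum (degree \<circ> (\<lambda>i. [:- real i, 1:])) ({..k} - {j})"
      unfolding N_def by (rule degree_prod_sum_le) simp
    also have "\<dots> = k" using that by simp
    finally show ?thesis .
  qed
  show thesis
  proof
    fix l assume l: "l \<le> k"
    have "monom 1 l = (\<Sum>j\<le>k. smult (real j ^ l) (Lp j))"
    proof (rule poly_eqI_degree[where A = "real ` {..k}"])
      show "poly (monom 1 l) x = poly (\<Sum>j\<le>k. smult (real j ^ l) (Lp j)) x" if "x \<in> real ` {..k}" for x
        using that by (auto simp: poly_monom poly_sum eval if_distrib sum.delta cong: if_cong)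
      have card: "card (real ` {..k}) = Suc k"
        by (simp add: card_image inj_on_def)
      show "card (real ` {..k}) > degree (monom (1::real) l)"
        unfolding card using l by (simp add: degree_monom_eq)
      have "degree (\<Sum>j\<le>k. smult (real j ^ l) (Lp j)) \<le> k"
        by (rule degree_sum_le) (use deg in \<open>auto intro: order_trans[OF degree_smult_le]\<close>)
      then show "card (real ` {..k}) > degree (\<Sum>j\<le>k. smult (real j ^ l) (Lp j))"
        unfolding card by simp
    qed
    then have "coeff (monom (1::real) l) m = coeff (\<Sum>j\<le>k. smult (real j ^ l) (Lp j)) m" by simp
    then show "(\<Sum>j\<le>k. coeff (Lp j) m * real j ^ l) = (if l = m then 1 else 0)"
      by (simp add: coeff_sum mult.commute)
  qed
qed

lemma multi_index_le: "\<alpha> \<in> multi_indices k \<Longrightarrow> \<alpha> i \<le> k" for \<alpha> :: "'n::finite \<Rightarrow> nat"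
  using member_le_sum[of i UNIV \<alpha>] by (simp add: multi_indices_def)

text \<open>
  A linear combination of evaluations at the points of the grid \<open>{0..k}\<close> isolates the monomial
  \<open>\<alpha>\<close>: take the product over all coordinates of the functionals of \<open>coeff_from_values\<close>. In other
  words, the vectors formed by the values of all monomials of degree \<open>k\<close> at one point span the
  whole space as the point varies.
\<close>

lemma monomials_separate:
  assumes \<alpha>: "\<alpha> \<in> multi_indices k"
  obtains c :: "('n::finite \<Rightarrow> nat) \<Rightarrow> real" where
    "\<And>\<beta>. \<beta> \<in> multi_indices k \<Longrightarrow>
      (\<Sum>f\<in>PiE UNIV (\<lambda>_. {..k}). c f * (\<Prod>i\<in>UNIV. real (f i) ^ \<beta> i)) = (if \<beta> = \<alpha> then 1 else 0)"
proof -
  have "\<exists>c. \<forall>l\<le>k. (\<Sum>j\<le>k. c j * real j ^ l) = (if l = \<alpha> i then 1 else 0)" for i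
    using coeff_from_values[OF multi_index_le[OF \<alpha>, of i]] by metis
  then obtain c where c: "\<And>i l. l \<le> k \<Longrightarrow> (\<Sum>j\<le>k. c i j * real j ^ l) = (if l = \<alpha> i then 1 else 0)"
    by metis
  show thesis
  proof
    fix \<beta> :: "'n \<Rightarrow> nat" assume \<beta>: "\<beta> \<in> multi_indices k"
    have "(\<Sum>f\<in>PiE UNIV (\<lambda>_. {..k}). (\<Prod>i\<in>UNIV. c i (f i)) * (\<Prod>i\<in>UNIV. real (f i) ^ \<beta> i))
        = (\<Prod>i\<in>UNIV. \<Sum>j\<le>k. c i j * real j ^ \<beta> i)"
      by (subst prod_sum_PiE) (auto simp: prod.distrib)
    also have "\<dots> = (\<Prod>i\<in>UNIV. if \<beta> i = \<alpha> i then 1 else 0)"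
      using multi_index_le[OF \<beta>] by (intro prod.cong) (auto simp: c)
    also have "\<dots> = (if \<beta> = \<alpha> then 1 else 0)"
      by (auto simp: fun_eq_iff)
    finally show "(\<Sum>f\<in>PiE UNIV (\<lambda>_. {..k}). (\<Prod>i\<in>UNIV. c i (f i)) * (\<Prod>i\<in>UNIV. real (f i) ^ \<beta> i))
      = (if \<beta> = \<alpha> then 1 else 0)" .
  qed
qed

section \<open>Smooth functions and iterated partial derivatives\<close>

lemma partial_deriv_eq:
  fixes f :: "real ^ 'n::finite \<Rightarrow> 'v::real_normed_vector"
  assumes "(f has_derivative f') (at x)"
  shows "partial_deriv i f x = f' (axis i 1)"
proof -
  have line: "((\<lambda>t::real. x + t *\<^sub>R axis i (1::real)) has_vector_derivative axis i 1) (at 0)"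
    by (auto intro!: derivative_eq_intros simp: has_vector_derivative_def)
  have "(f has_derivative f') (at (x + 0 *\<^sub>R axis i 1))" using assms by simp
  from vector_derivative_diff_chain_within[OF line has_derivative_at_withinI[OF this]]
  have "((\<lambda>t. f (x + t *\<^sub>R axis i 1)) has_vector_derivative f' (axis i 1)) (at 0)"
    by (simp add: o_def)
  then show ?thesis unfolding partial_deriv_def by (rule vector_derivative_at)
qed

lemma partial_deriv_add:
  assumes "f differentiable at x" "g differentiable at x"
  shows "partial_deriv i (\<lambda>x. f x + g x) x = partial_deriv i f x + partial_deriv i g x"
proof -
  obtain f' g' where d: "(f has_derivative f') (at x)" "(g has_derivative g') (at x)"
    using assms unfolding differentiable_def by blast
  show ?thesis
    using partial_deriv_eq[OF has_derivative_add[OF d]] d[THEN partial_deriv_eq] by simp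
qed

lemma partial_deriv_scaleR_const:
  assumes "f differentiable at x"
  shows "partial_deriv i (\<lambda>x. c *\<^sub>R f x) x = c *\<^sub>R partial_deriv i f x"
proof -
  obtain f' where d: "(f has_derivative f') (at x)"
    using assms unfolding differentiable_def by blast
  show ?thesis
    using partial_deriv_eq[OF has_derivative_scaleR_right[OF d, of c]] partial_deriv_eq[OF d] by simp
qed

lemma partial_deriv_scaleR:
  assumes "f differentiable at x" "g differentiable at x"
  shows "partial_deriv i (\<lambda>x. f x *\<^sub>R g x) x = partial_deriv i f x *\<^sub>R g x + f x *\<^sub>R partial_deriv i g x"
proof -
  obtain f' g' where d: "(f has_derivative f') (at x)" "(g has_derivative g') (at x)"
    using assms unfolding differentiable_def by blast
  show ?thesis
    using partial_deriv_eq[OF has_derivative_scaleR[OF d]] d[THEN partial_deriv_eq]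
    by (simp add: add.commute)
qed

lemma partial_deriv_affine:
  assumes "f differentiable at (m *\<^sub>R x + c)"
  shows "partial_deriv i (\<lambda>x. f (m *\<^sub>R x + c)) x = m *\<^sub>R partial_deriv i f (m *\<^sub>R x + c)"
proof -
  obtain f' where d: "(f has_derivative f') (at (m *\<^sub>R x + c))"
    using assms unfolding differentiable_def by blast
  have "((\<lambda>x. m *\<^sub>R x + c) has_derivative (\<lambda>h. m *\<^sub>R h)) (at x)"
    by (auto intro!: derivative_eq_intros)
  from partial_deriv_eq[OF has_derivative_compose[OF this d]]
  show ?thesis using partial_deriv_eq[OF d] linear_scale[OF has_derivative_linear[OF d]] by simp
qed

lemma partial_deriv_compose_real:
  assumes "q differentiable at x" "(h has_real_derivative h') (at (q x))"
  shows "partial_deriv i (\<lambda>x. h (q x)) x = partial_deriv i q x *\<^sub>R h'"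
proof -
  obtain q' where d: "(q has_derivative q') (at x)"
    using assms unfolding differentiable_def by blast
  have "(h has_derivative (\<lambda>y. y * h')) (at (q x))"
    using assms(2) by (simp add: has_field_derivative_def mult_commute_abs)
  from partial_deriv_eq[OF has_derivative_compose[OF d this]]
  show ?thesis using partial_deriv_eq[OF d] by simp
qed

lemma partial_deriv_const [simp]: "partial_deriv i (\<lambda>_. c) = (\<lambda>_. 0)"
  by (rule ext) (rule partial_deriv_eq[of "\<lambda>_. c" "\<lambda>_. 0"], simp)

lemma foldr_partial_deriv_zero [simp]: "foldr partial_deriv js (\<lambda>_. 0) = (\<lambda>_. 0)"
  by (induction js) simp_all

lemma partial_deriv_zero_on_open:
  assumes "open U" "x \<in> U" "\<And>y. y \<in> U \<Longrightarrow> f y = 0"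
  shows "partial_deriv i f x = 0"
proof -
  have "(f has_derivative (\<lambda>_. 0)) (at x)"
    using has_derivative_const[of 0 "at x"] assms
    by (rule_tac has_derivative_transform_within_open[of "\<lambda>_. 0" _ _ _ U f]) auto
  from partial_deriv_eq[OF this] show ?thesis .
qed

lemma foldr_partial_deriv_zero_on_open:
  assumes "open U" "x \<in> U" "\<And>y. y \<in> U \<Longrightarrow> f y = 0"
  shows "foldr partial_deriv js f x = 0"
  using assms(2)
proof (induction js arbitrary: x)
  case Nil
  then show ?case using assms(3) by simp
next
  case (Cons j js)
  show ?case using partial_deriv_zero_on_open[OF assms(1) Cons.prems Cons.IH] by simp
qed

text \<open>
  A finite order version of \<open>smooth\<close>. Its recursion goes through the first partial derivatives,
  so that closure under products and compositions is proved by induction on the order, with the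
  functions left arbitrary.
\<close>

primrec diff_times :: "nat \<Rightarrow> (real ^ 'n::finite \<Rightarrow> 'v::real_normed_vector) \<Rightarrow> bool" where
  "diff_times 0 f \<longleftrightarrow> f differentiable_on UNIV"
| "diff_times (Suc n) f \<longleftrightarrow> f differentiable_on UNIV \<and> (\<forall>i. diff_times n (partial_deriv i f))"

lemma diff_times_differentiable: "diff_times n f \<Longrightarrow> f differentiable at x"
  by (cases n) (simp_all add: differentiable_on_def)

lemma diff_times_mono: "diff_times (Suc n) f \<Longrightarrow> diff_times n f"
  by (induction n arbitrary: f) auto

lemma diff_times_iff: "diff_times n f \<longleftrightarrow> (\<forall>js. length js \<le> n \<longrightarrow> foldr partial_deriv js f differentiable_on UNIV)"
proof (induction n arbitrary: f)
  case 0
  show ?case by simp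
next
  case (Suc n)
  have "(\<forall>js. length js \<le> Suc n \<longrightarrow> foldr partial_deriv js f differentiable_on UNIV) \<longleftrightarrow>
    f differentiable_on UNIV \<and>
      (\<forall>i js. length js \<le> n \<longrightarrow> foldr partial_deriv js (partial_deriv i f) differentiable_on UNIV)" (is "?L \<longleftrightarrow> ?R")
  proof
    assume L: ?L
    show ?R
    proof (intro conjI allI impI)
      show "f differentiable_on UNIV" using L[rule_format, of "[]"] by simp
      show "foldr partial_deriv js (partial_deriv i f) differentiable_on UNIV" if "length js \<le> n" for i js
        using L[rule_format, of "js @ [i]"] that by simp
    qed
  next
    assume R: ?R
    show ?L
    proof (intro allI impI)
      fix js :: "'a list" assume "length js \<le> Suc n"
      then show "foldr partial_deriv js f differentiable_on UNIV"
        using R by (cases js rule: rev_cases) auto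
    qed
  qed
  then show ?case using Suc by simp
qed

lemma smooth_iff_diff_times: "smooth f \<longleftrightarrow> (\<forall>n. diff_times n f)"
  unfolding smooth_def diff_times_iff by blast

lemma smooth_partial_deriv: "smooth f \<Longrightarrow> smooth (partial_deriv i f)"
  unfolding smooth_iff_diff_times using diff_times.simps(2) by blast

lemma smooth_foldr: "smooth f \<Longrightarrow> smooth (foldr partial_deriv js f)"
  by (induction js) (auto intro: smooth_partial_deriv)

lemma smooth_differentiable: "smooth f \<Longrightarrow> f differentiable at x"
  unfolding smooth_iff_diff_times using diff_times_differentiable by blast

lemma smooth_continuous_on: "smooth f \<Longrightarrow> continuous_on S f"
  by (simp add: smooth_differentiable continuous_at_imp_continuous_on differentiable_imp_continuous_within)

lemma diff_times_const: "diff_times n (\<lambda>_. c)"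
  by (induction n arbitrary: c) auto

lemma diff_times_add: "diff_times n f \<Longrightarrow> diff_times n g \<Longrightarrow> diff_times n (\<lambda>x. f x + g x)"
proof (induction n arbitrary: f g)
  case 0
  then show ?case by (auto intro: differentiable_on_add)
next
  case (Suc n)
  have "partial_deriv i (\<lambda>x. f x + g x) = (\<lambda>x. partial_deriv i f x + partial_deriv i g x)" for i
    using Suc.prems by (intro ext partial_deriv_add) (rule diff_times_differentiable, assumption)+
  then show ?case using Suc by (auto intro: differentiable_on_add)
qed

lemma diff_times_scaleR: "diff_times n f \<Longrightarrow> diff_times n g \<Longrightarrow> diff_times n (\<lambda>x. f x *\<^sub>R g x)"
proof (induction n arbitrary: f g)
  case 0
  then show ?case by (auto simp: differentiable_on_def intro: differentiable_scaleR)
next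
  case (Suc n)
  have eq: "partial_deriv i (\<lambda>x. f x *\<^sub>R g x) = (\<lambda>x. partial_deriv i f x *\<^sub>R g x + f x *\<^sub>R partial_deriv i g x)" for i
    using Suc.prems by (intro ext partial_deriv_scaleR) (rule diff_times_differentiable, assumption)+
  have "diff_times n (partial_deriv i (\<lambda>x. f x *\<^sub>R g x))" for i
    unfolding eq using Suc.prems by (intro diff_times_add Suc.IH) (auto intro: diff_times_mono)
  then show ?case using Suc by (auto simp: differentiable_on_def intro: differentiable_scaleR)
qed

lemma smooth_const: "smooth (\<lambda>_. c)"
  by (simp add: smooth_iff_diff_times diff_times_const)

lemma smooth_add: "smooth f \<Longrightarrow> smooth g \<Longrightarrow> smooth (\<lambda>x. f x + g x)"
  by (simp add: smooth_iff_diff_times diff_times_add)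

lemma smooth_scaleR: "smooth f \<Longrightarrow> smooth g \<Longrightarrow> smooth (\<lambda>x. f x *\<^sub>R g x)"
  by (simp add: smooth_iff_diff_times diff_times_scaleR)

lemma smooth_sum: "(\<And>z. z \<in> Z \<Longrightarrow> smooth (f z)) \<Longrightarrow> smooth (\<lambda>x. \<Sum>z\<in>Z. f z x)"
proof (induction Z rule: infinite_finite_induct)
  case (insert z Z)
  then show ?case using smooth_add[of "f z" "\<lambda>x. \<Sum>z\<in>Z. f z x"] by simp
qed (simp_all add: smooth_const)

lemma foldr_partial_deriv_add:
  fixes f g :: "real ^ 'b::finite \<Rightarrow> 'a::real_normed_vector"
  assumes "smooth f" "smooth g"
  shows "foldr partial_deriv js (\<lambda>x. f x + g x) = (\<lambda>x. foldr partial_deriv js f x + foldr partial_deriv js g x)"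
proof (induction js)
  case (Cons j js)
  have d: "foldr partial_deriv js h differentiable at x" if "smooth h" for h :: "real ^ 'b \<Rightarrow> 'a" and x
    using that by (intro smooth_differentiable smooth_foldr)
  show ?case
    unfolding foldr.simps o_apply Cons by (intro ext partial_deriv_add d assms)
qed simp

lemma foldr_partial_deriv_sum:
  assumes "\<And>z. z \<in> Z \<Longrightarrow> smooth (f z)"
  shows "foldr partial_deriv js (\<lambda>x. \<Sum>z\<in>Z. f z x) = (\<lambda>x. \<Sum>z\<in>Z. foldr partial_deriv js (f z) x)"
  using assms
  by (induction Z rule: infinite_finite_induct) (simp_all add: foldr_partial_deriv_add smooth_sum)

lemma foldr_partial_deriv_scaleR:
  assumes "smooth f"
  shows "foldr partial_deriv js (\<lambda>x. c *\<^sub>R f x) = (\<lambda>x. c *\<^sub>R foldr partial_deriv js f x)"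
proof (induction js)
  case (Cons j js)
  have "foldr partial_deriv js f differentiable at x" for x
    using assms by (intro smooth_differentiable smooth_foldr)
  then show ?case
    unfolding foldr.simps o_apply Cons by (intro ext partial_deriv_scaleR_const)
qed simp

lemma differentiable_affine_compose:
  assumes "f differentiable at (m *\<^sub>R x + c)"
  shows "(\<lambda>x. f (m *\<^sub>R x + c)) differentiable at x"
proof -
  obtain f' where d: "(f has_derivative f') (at (m *\<^sub>R x + c))"
    using assms unfolding differentiable_def by blast
  have "((\<lambda>x. m *\<^sub>R x + c) has_derivative (\<lambda>h. m *\<^sub>R h)) (at x)"
    by (auto intro!: derivative_eq_intros)
  from has_derivative_compose[OF this d] show ?thesis unfolding differentiable_def by blast
qed

lemma foldr_partial_deriv_affine:
  assumes "smooth f"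
  shows "foldr partial_deriv js (\<lambda>x. f (m *\<^sub>R x + c)) = (\<lambda>x. m ^ length js *\<^sub>R foldr partial_deriv js f (m *\<^sub>R x + c))"
proof (induction js)
  case (Cons j js)
  have d: "foldr partial_deriv js f differentiable at y" for y
    using assms by (intro smooth_differentiable smooth_foldr)
  show ?case
    unfolding foldr.simps o_apply Cons
      partial_deriv_scaleR_const[OF differentiable_affine_compose[OF d]] partial_deriv_affine[OF d]
    by (simp add: mult.commute)
qed simp

lemma smooth_affine:
  assumes "smooth f"
  shows "smooth (\<lambda>x. f (m *\<^sub>R x + c))"
  unfolding smooth_def foldr_partial_deriv_affine[OF assms] differentiable_on_def
proof (intro allI ballI)
  fix js x
  have "foldr partial_deriv js f differentiable at y" for y
    using assms by (intro smooth_differentiable smooth_foldr)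
  from differentiable_affine_compose[OF this]
  show "(\<lambda>x. m ^ length js *\<^sub>R foldr partial_deriv js f (m *\<^sub>R x + c)) differentiable at x"
    by (rule differentiable_scaleR[OF differentiable_const])
qed

lemma smooth_inner: "smooth (\<lambda>x. a \<bullet> x)"
proof -
  have d: "((\<lambda>x. a \<bullet> x) has_derivative (\<lambda>x. a \<bullet> x)) (at x)" for x
    by (auto intro!: derivative_eq_intros)
  have "partial_deriv i (\<lambda>x. a \<bullet> x) = (\<lambda>_. a $ i)" for i
    by (rule ext, subst partial_deriv_eq[OF d]) (simp add: inner_axis)
  moreover have "(\<lambda>x. a \<bullet> x) differentiable_on UNIV"
    unfolding differentiable_on_def differentiable_def using d by blast
  ultimately have "diff_times n (\<lambda>x. a \<bullet> x)" for n
    by (cases n) (simp_all add: diff_times_const)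
  then show ?thesis by (simp add: smooth_iff_diff_times)
qed

lemma partial_deriv_cos:
  "partial_deriv i (\<lambda>x. cos (r * (a \<bullet> x) + \<theta>)) = (\<lambda>x. r * a $ i * cos (r * (a \<bullet> x) + \<theta> + pi / 2))"
proof
  fix x
  have "((\<lambda>x. cos (r * (a \<bullet> x) + \<theta>)) has_derivative (\<lambda>h. - sin (r * (a \<bullet> x) + \<theta>) * (r * (a \<bullet> h)))) (at x)"
    by (auto intro!: derivative_eq_intros)
  from partial_deriv_eq[OF this]
  show "partial_deriv i (\<lambda>x. cos (r * (a \<bullet> x) + \<theta>)) x = r * a $ i * cos (r * (a \<bullet> x) + \<theta> + pi / 2)"
    by (simp add: cos_add inner_axis)
qed

lemma smooth_cos: "smooth (\<lambda>x. cos (r * (a \<bullet> x) + \<theta>))"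
proof -
  have d: "(\<lambda>x. cos (r * (a \<bullet> x) + \<theta>)) differentiable_on UNIV" for \<theta>
    unfolding differentiable_on_def
  proof
    fix x
    have "((\<lambda>x. cos (r * (a \<bullet> x) + \<theta>)) has_derivative (\<lambda>h. - sin (r * (a \<bullet> x) + \<theta>) * (r * (a \<bullet> h)))) (at x)"
      by (auto intro!: derivative_eq_intros)
    then show "(\<lambda>x. cos (r * (a \<bullet> x) + \<theta>)) differentiable at x" unfolding differentiable_def by blast
  qed
  have "diff_times n (\<lambda>x. cos (r * (a \<bullet> x) + \<theta>))" for n
  proof (induction n arbitrary: \<theta>)
    case (Suc n)
    have "diff_times n (\<lambda>x. (r * a $ i) *\<^sub>R cos (r * (a \<bullet> x) + \<theta> + pi / 2))" for i
      using Suc.IH[of "\<theta> + pi / 2"] by (intro diff_times_scaleR diff_times_const) (simp add: add.assoc)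
    then show ?case using d by (simp add: partial_deriv_cos)
  qed (use d in simp)
  then show ?thesis by (simp add: smooth_iff_diff_times)
qed

section \<open>Bump functions and oscillations\<close>

text \<open>
  The family over all \<open>m\<close> is, up to linear combinations, closed under differentiation; this is what
  makes smoothness at \<open>0\<close> an induction.
\<close>

definition flat :: "nat \<Rightarrow> real \<Rightarrow> real" where
  "flat m t = (if t > 0 then exp (- 1 / t) / t ^ m else 0)"

text \<open>
  Compare \<open>exp (1 / t)\<close> with a single term of its power series.
\<close>

lemma flat_le_square: "\<bar>flat m t\<bar> \<le> fact (m + 2) * t\<^sup>2"
proof (cases "t > 0")
  case True
  define y where "y = 1 / t"
  have y: "y > 0" using True by (simp add: y_def)
  have "y ^ (m + 2) / fact (m + 2) \<le> exp y"
  proof -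
    have "y ^ (m + 2) / fact (m + 2) = (\<Sum>n\<in>{m + 2}. y ^ n /\<^sub>R fact n)" by (simp add: field_simps)
    also have "\<dots> \<le> (\<Sum>n. y ^ n /\<^sub>R fact n)"
      by (rule sum_le_suminf) (use y summable_exp_generic[of y] in auto)
    also have "\<dots> = exp y" by (simp add: exp_def)
    finally show ?thesis .
  qed
  then have "y ^ (m + 2) \<le> exp y * fact (m + 2)"
    by (subst (asm) pos_divide_le_eq[OF fact_gt_zero])
  from mult_left_mono[OF this, of "exp (- y)"]
  have "exp (- y) * y ^ (m + 2) \<le> exp (- y) * exp y * fact (m + 2)"
    by (simp only: mult.assoc exp_ge_zero)
  then have "exp (- y) * y ^ (m + 2) \<le> fact (m + 2)"
    by (simp only: mult_exp_exp, simp)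
  then have "exp (- y) * y ^ (m + 2) * t\<^sup>2 \<le> fact (m + 2) * t\<^sup>2"
    by (rule mult_right_mono) simp
  moreover have "exp (- y) * y ^ (m + 2) * t\<^sup>2 = flat m t"
    using True by (simp add: flat_def y_def power_add power_divide field_simps power2_eq_square)
  moreover have "flat m t \<ge> 0" using True by (simp add: flat_def)
  ultimately show ?thesis by simp
qed (simp add: flat_def)

lemma flat_has_derivative:
  "(flat m has_real_derivative flat (m + 2) t - real m * flat (m + 1) t) (at t)"
proof -
  consider "t > 0" | "t < 0" | "t = 0" by linarith
  then show ?thesis
  proof cases
    case 1
    have "((\<lambda>t. exp (- 1 / t) / t ^ m) has_real_derivative
        (exp (- 1 / t) / t\<^sup>2 * t ^ m - exp (- 1 / t) * (real m * t ^ (m - 1))) / (t ^ m * t ^ m)) (at t)"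
      using 1 by (auto intro!: derivative_eq_intros simp: power2_eq_square)
    moreover have "real m * t ^ (m - 1) = real m * t ^ m / t"
      using 1 by (cases m) auto
    moreover have "(exp (- 1 / t) / t\<^sup>2 * t ^ m - exp (- 1 / t) * (real m * t ^ m / t)) / (t ^ m * t ^ m)
        = flat (m + 2) t - real m * flat (m + 1) t"
      using 1 by (simp add: flat_def field_simps power2_eq_square)
    ultimately have "((\<lambda>t. exp (- 1 / t) / t ^ m) has_real_derivative
        flat (m + 2) t - real m * flat (m + 1) t) (at t)" by simp
    then show ?thesis
      by (rule has_field_derivative_transform_within_open[where S = "{0<..}"])
        (use 1 in \<open>auto simp: flat_def\<close>)
  next
    case 2
    have "((\<lambda>_. 0) has_real_derivative flat (m + 2) t - real m * flat (m + 1) t) (at t)"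
      using 2 by (simp add: flat_def)
    then show ?thesis
      by (rule has_field_derivative_transform_within_open[where S = "{..<0}"])
        (use 2 in \<open>auto simp: flat_def\<close>)
  next
    case 3
    have "(\<lambda>h. flat m h / h) \<midarrow>0\<rightarrow> 0"
    proof (rule Lim_null_comparison)
      have "\<bar>flat m h / h\<bar> \<le> fact (m + 2) * \<bar>h\<bar>" if "h \<noteq> 0" for h
        using flat_le_square[of m h] that
        by (simp add: abs_divide divide_le_eq power2_eq_square abs_mult_self_eq mult.assoc flip: abs_mult)
      then show "\<forall>\<^sub>F h in at 0. norm (flat m h / h) \<le> fact (m + 2) * \<bar>h\<bar>"
        by (auto simp: eventually_at_filter)
      show "(\<lambda>h. fact (m + 2) * \<bar>h\<bar>) \<midarrow>0\<rightarrow> (0::real)"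
        by (auto intro!: tendsto_eq_intros)
    qed
    then show ?thesis using 3 by (simp add: DERIV_def flat_def)
  qed
qed

lemma smooth_flat_compose:
  assumes q: "smooth q"
  shows "smooth (\<lambda>x. flat m (q x))"
proof -
  have d: "(\<lambda>x. flat m (q x)) differentiable at x" for m x
  proof -
    obtain q' where "(q has_derivative q') (at x)"
      using smooth_differentiable[OF q] unfolding differentiable_def by blast
    from has_derivative_compose[OF this, of "flat m"]
    show ?thesis using flat_has_derivative[of m "q x"]
      unfolding has_field_derivative_def differentiable_def by blast
  qed
  have "diff_times n (\<lambda>x. flat m (q x))" for n m
  proof (induction n arbitrary: m)
    case (Suc n)
    have "partial_deriv i (\<lambda>x. flat m (q x))
        = (\<lambda>x. partial_deriv i q x *\<^sub>R (flat (m + 2) (q x) + (- real m) *\<^sub>R flat (m + 1) (q x)))" for i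
      by (intro ext, subst partial_deriv_compose_real[OF smooth_differentiable[OF q] flat_has_derivative]) simp
    moreover have "diff_times n (partial_deriv i q)" for i
      using smooth_partial_deriv[OF q] by (simp add: smooth_iff_diff_times)
    ultimately have "diff_times n (partial_deriv i (\<lambda>x. flat m (q x)))" for i
      using Suc.IH by (simp only:) (intro diff_times_scaleR diff_times_add diff_times_const)
    then show ?case using d by (simp add: differentiable_on_def)
  qed (use d in \<open>simp add: differentiable_on_def\<close>)
  then show ?thesis by (simp add: smooth_iff_diff_times)
qed

text \<open>
  All derivatives are required to vanish outside the open cube, boundary included, so that scaled
  copies can be glued along the faces of a grid.
\<close>

definition cube_tests :: "(real ^ 'n::finite \<Rightarrow> 'v::real_normed_vector) set" where
  "cube_tests = {\<phi>. smooth \<phi> \<and> (\<forall>js x. x \<notin> box 0 1 \<longrightarrow> foldr partial_deriv js \<phi> x = 0)}"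

lemma cube_tests_smooth: "\<phi> \<in> cube_tests \<Longrightarrow> smooth \<phi>"
  by (simp add: cube_tests_def)

lemma cube_testsI_open:
  assumes "smooth \<phi>" "open U" "- box 0 1 \<subseteq> U" "\<And>x. x \<in> U \<Longrightarrow> \<phi> x = 0"
  shows "\<phi> \<in> cube_tests"
  using assms foldr_partial_deriv_zero_on_open[of U _ \<phi>] by (auto simp: cube_tests_def)

text \<open>
  The bump is supported in the ball of radius \<open>1 / 4\<close> about the centre of the cube. It vanishes on
  an open neighbourhood of the complement of the cube, which forces all its derivatives to vanish
  there.
\<close>

lemma bump_exists:
  obtains \<beta> :: "real ^ 'n::finite \<Rightarrow> real" and U where
    "smooth \<beta>" "\<And>x. 0 \<le> \<beta> x" "\<And>x. \<beta> x \<le> 1" "open U" "- box 0 1 \<subseteq> U"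
    "\<And>x. x \<in> U \<Longrightarrow> \<beta> x = 0" "\<beta> (\<chi> i. 1 / 2) > 0"
proof -
  define q :: "real ^ 'n \<Rightarrow> real" where
    "q x = 1 / 16 + (- 1) *\<^sub>R (\<Sum>i\<in>UNIV. (axis i 1 \<bullet> x + - (1 / 2)) *\<^sub>R (axis i 1 \<bullet> x + - (1 / 2)))" for x
  have q: "smooth q"
    unfolding q_def by (intro smooth_add smooth_scaleR smooth_sum smooth_inner smooth_const)
  have q_eq: "q x = 1 / 16 - (\<Sum>i\<in>UNIV. (x $ i - 1 / 2)\<^sup>2)" for x
    by (simp add: q_def inner_axis' power2_eq_square)
  show thesis
  proof (rule that[of "\<lambda>x. flat 0 (q x)" "{x. q x < 0}"])
    show "smooth (\<lambda>x. flat 0 (q x))" by (rule smooth_flat_compose[OF q])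
    show "0 \<le> flat 0 (q x)" "flat 0 (q x) \<le> 1" for x by (auto simp: flat_def)
    show "open {x. q x < 0}"
      using smooth_continuous_on[OF q] by (intro open_Collect_less continuous_on_const)
    show "- box 0 1 \<subseteq> {x. q x < 0}"
    proof
      fix x :: "real ^ 'n" assume "x \<in> - box 0 1"
      then have "\<not> (\<forall>i. 0 < x $ i \<and> x $ i < 1)" by (simp add: mem_box_cart)
      then obtain i where i: "x $ i \<le> 0 \<or> x $ i \<ge> 1" by (metis not_le)
      then have "\<bar>1 / 2\<bar> \<le> \<bar>x $ i - 1 / 2\<bar>" by auto
      then have "(1 / 2)\<^sup>2 \<le> (x $ i - 1 / 2)\<^sup>2" by (simp only: abs_le_square_iff)
      also have "\<dots> \<le> (\<Sum>i\<in>UNIV. (x $ i - 1 / 2)\<^sup>2)" by (rule member_le_sum) auto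
      finally show "x \<in> {x. q x < 0}" by (simp add: q_eq power2_eq_square)
    qed
    show "flat 0 (q x) = 0" if "x \<in> {x. q x < 0}" for x using that by (simp add: flat_def)
    show "flat 0 (q (\<chi> i. 1 / 2)) > 0" by (simp add: flat_def q_eq)
  qed
qed

text \<open>
  Each differentiation in direction \<open>j\<close> falls either on the cosine, which produces a factor
  \<open>r * a $ j\<close> and a phase shift by a quarter period, or on the amplitude. The index \<open>i\<close> counts the
  former. The amplitudes \<open>P i\<close> do not depend on the frequency \<open>r\<close>, so that for large \<open>r\<close> the top term
  dominates.
\<close>

lemma foldr_partial_deriv_oscillation:
  fixes p :: "real ^ 'n::finite \<Rightarrow> 'v::real_normed_vector" and a :: "real ^ 'n"
  assumes p: "smooth p"
  shows "\<exists>P. (\<forall>i. smooth (P i)) \<and> P (length js) = (\<lambda>x. prod_list (map (($) a) js) *\<^sub>R p x) \<and>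
    (\<forall>r. foldr partial_deriv js (\<lambda>x. cos (r * (a \<bullet> x) + \<theta>) *\<^sub>R p x) =
      (\<lambda>x. \<Sum>i\<le>length js. (r ^ i * cos (r * (a \<bullet> x) + (\<theta> + real i * (pi / 2)))) *\<^sub>R P i x))"
proof (induction js)
  case Nil
  show ?case using p by (intro exI[of _ "\<lambda>_. p"]) simp
next
  case (Cons j js)
  define l where "l = length js"
  obtain P where P: "\<And>i. smooth (P i)" "P l = (\<lambda>x. prod_list (map (($) a) js) *\<^sub>R p x)"
    "\<And>r. foldr partial_deriv js (\<lambda>x. cos (r * (a \<bullet> x) + \<theta>) *\<^sub>R p x) =
      (\<lambda>x. \<Sum>i\<le>l. (r ^ i * cos (r * (a \<bullet> x) + (\<theta> + real i * (pi / 2)))) *\<^sub>R P i x)"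
    using Cons.IH unfolding l_def by blast
  define A where "A i = (if i \<le> l then partial_deriv j (P i) else (\<lambda>_. 0))" for i
  define B where "B i = (case i of 0 \<Rightarrow> (\<lambda>_. 0) | Suc i \<Rightarrow> (\<lambda>x. a $ j *\<^sub>R P i x))" for i
  define P' where "P' i = (\<lambda>x. A i x + B i x)" for i
  show ?case
  proof (intro exI[of _ P'] conjI allI)
    have "smooth (A i)" for i
      using smooth_partial_deriv[OF P(1)] by (simp add: A_def smooth_const)
    moreover have "smooth (B i)" for i
      using P(1) by (cases i) (simp_all add: B_def smooth_const smooth_scaleR)
    ultimately show "smooth (P' i)" for i unfolding P'_def by (rule smooth_add)
    show "P' (length (j # js)) = (\<lambda>x. prod_list (map (($) a) (j # js)) *\<^sub>R p x)"
      using P(2) by (simp add: P'_def A_def B_def flip: l_def)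
  next
    fix r
    define w where "w i x = r ^ i * cos (r * (a \<bullet> x) + (\<theta> + real i * (pi / 2)))" for i x
    have w_smooth: "smooth (w i)" for i
      unfolding w_def using smooth_scaleR[OF smooth_const smooth_cos[of r a "\<theta> + real i * (pi / 2)"]] by simp
    have w': "partial_deriv j (w i) = (\<lambda>x. a $ j * w (Suc i) x)" for i
    proof
      fix x
      have "partial_deriv j (w i) x
          = r ^ i *\<^sub>R partial_deriv j (\<lambda>x. cos (r * (a \<bullet> x) + (\<theta> + real i * (pi / 2)))) x"
        unfolding w_def using partial_deriv_scaleR_const[OF smooth_differentiable[OF smooth_cos], of j "r ^ i"]
        by simp
      then show "partial_deriv j (w i) x = a $ j * w (Suc i) x"
        unfolding partial_deriv_cos w_def by (simp add: algebra_simps add_divide_distrib)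
    qed
    have "partial_deriv j (\<lambda>x. \<Sum>i\<le>l. w i x *\<^sub>R P i x)
        = (\<lambda>x. \<Sum>i\<le>l. partial_deriv j (\<lambda>x. w i x *\<^sub>R P i x) x)"
      using foldr_partial_deriv_sum[of "{..l}" "\<lambda>i x. w i x *\<^sub>R P i x" "[j]"] smooth_scaleR[OF w_smooth P(1)]
      by simp
    also have "\<dots> = (\<lambda>x. \<Sum>i\<le>l. (a $ j * w (Suc i) x) *\<^sub>R P i x + w i x *\<^sub>R partial_deriv j (P i) x)"
      by (simp add: partial_deriv_scaleR smooth_differentiable w_smooth P(1) w')
    also have "\<dots> = (\<lambda>x. (\<Sum>i\<le>Suc l. w i x *\<^sub>R A i x) + (\<Sum>i\<le>Suc l. w i x *\<^sub>R B i x))"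
    proof
      fix x
      have "(\<Sum>i\<le>Suc l. w i x *\<^sub>R A i x) = (\<Sum>i\<le>l. w i x *\<^sub>R partial_deriv j (P i) x)"
        by (simp add: A_def)
      moreover have "(\<Sum>i\<le>Suc l. w i x *\<^sub>R B i x) = (\<Sum>i\<le>l. (a $ j * w (Suc i) x) *\<^sub>R P i x)"
        by (simp add: sum.atMost_Suc_shift B_def mult.commute del: sum.atMost_Suc)
      ultimately show "(\<Sum>i\<le>l. (a $ j * w (Suc i) x) *\<^sub>R P i x + w i x *\<^sub>R partial_deriv j (P i) x)
        = (\<Sum>i\<le>Suc l. w i x *\<^sub>R A i x) + (\<Sum>i\<le>Suc l. w i x *\<^sub>R B i x)"
        by (simp add: sum.distrib)
    qed
    finally show "foldr partial_deriv (j # js) (\<lambda>x. cos (r * (a \<bullet> x) + \<theta>) *\<^sub>R p x) =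
      (\<lambda>x. \<Sum>i\<le>length (j # js). (r ^ i * cos (r * (a \<bullet> x) + (\<theta> + real i * (pi / 2)))) *\<^sub>R P' i x)"
      unfolding foldr.simps o_apply P(3) w_def[symmetric] P'_def
      by (simp add: scaleR_add_right sum.distrib flip: l_def)
  qed
qed

definition multi_list :: "('n::finite \<Rightarrow> nat) \<Rightarrow> 'n list" where
  "multi_list \<alpha> = (SOME js. \<forall>i. count_list js i = \<alpha> i)"

lemma multi_deriv_eq: "multi_deriv \<alpha> \<phi> = foldr partial_deriv (multi_list \<alpha>) \<phi>"
  by (simp add: multi_deriv_def multi_list_def)

lemma count_multi_list: "count_list (multi_list \<alpha>) i = \<alpha> i"
  using someI_ex[OF ex_multi_index_list[of \<alpha>]] by (simp add: multi_list_def)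

lemma length_multi_list: "\<alpha> \<in> multi_indices k \<Longrightarrow> length (multi_list \<alpha>) = k"
proof -
  have "(\<Sum>i\<in>UNIV. count_list js i) = length js" for js :: "'a list"
  proof (induction js)
    case (Cons j js)
    have "(\<Sum>i\<in>UNIV. count_list (j # js) i) = (\<Sum>i\<in>UNIV. (if i = j then 1 else 0) + count_list js i)"
      by (rule sum.cong) auto
    then show ?case using Cons by (simp add: sum.distrib)
  qed simp
  from this[of "multi_list \<alpha>"]
  show "\<alpha> \<in> multi_indices k \<Longrightarrow> length (multi_list \<alpha>) = k"
    by (simp add: count_multi_list multi_indices_def)
qed

lemma prod_multi_list: "prod_list (map (($) a) (multi_list \<alpha>)) = (\<Prod>i\<in>UNIV. a $ i ^ \<alpha> i)"
  for a :: "real ^ 'n::finite"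
proof -
  have "prod_list (map (($) a) js) = (\<Prod>i\<in>UNIV. a $ i ^ count_list js i)" for js
  proof (induction js)
    case (Cons j js)
    have "(\<Prod>i\<in>UNIV. a $ i ^ count_list (j # js) i)
        = (\<Prod>i\<in>UNIV. (if i = j then a $ j else 1) * a $ i ^ count_list js i)"
      by (rule prod.cong) auto
    also have "\<dots> = a $ j * (\<Prod>i\<in>UNIV. a $ i ^ count_list js i)"
      by (simp add: prod.distrib prod.delta)
    finally show ?case using Cons by simp
  qed simp
  from this[of "multi_list \<alpha>"] show ?thesis by (simp add: count_multi_list)
qed

section \<open>The quasiconvex envelope\<close>

lemma content_unit_cube [simp]: "measure lborel (cbox 0 (1 :: real ^ 'n::finite)) = 1"
proof -
  have "(0 :: real ^ 'n) \<in> cbox 0 1" by (simp add: mem_box_cart)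
  then show ?thesis by (subst content_cbox_cart) auto
qed

lemma integral_unit_cube_le:
  fixes f g :: "real ^ 'n::finite \<Rightarrow> real"
  assumes "continuous_on (cbox 0 1) f" "continuous_on (cbox 0 1) g"
    and "\<And>x. x \<in> cbox 0 1 \<Longrightarrow> f x \<le> g x + B"
  shows "integral (cbox 0 1) f \<le> integral (cbox 0 1) g + B"
proof -
  have "integral (cbox 0 1) f \<le> integral (cbox 0 1) (\<lambda>x. g x + B)"
    using assms by (intro integral_le integrable_continuous continuous_intros) auto
  also have "\<dots> = integral (cbox 0 1) g + integral (cbox 0 (1 :: real ^ 'n)) (\<lambda>_. B)"
    by (rule Henstock_Kurzweil_Integration.integral_add) (intro integrable_continuous assms continuous_on_const)+
  finally show ?thesis by simp
qed

text \<open>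
  Jets of order \<open>k\<close> are functions on all multi-indices, of which only the values on
  \<open>multi_indices k\<close> carry information; \<open>jet_dist\<close> identifies jets that agree there.
\<close>

abbreviation jet :: "(real ^ 'n::finite \<Rightarrow> 'v::real_normed_vector) \<Rightarrow> real ^ 'n \<Rightarrow> ('n \<Rightarrow> nat) \<Rightarrow> 'v" where
  "jet \<phi> x \<equiv> (\<lambda>\<alpha>. multi_deriv \<alpha> \<phi> x)"

abbreviation jet_line :: "('a \<Rightarrow> 'v::real_vector) \<Rightarrow> real \<Rightarrow> ('a \<Rightarrow> 'v) \<Rightarrow> 'a \<Rightarrow> 'v" where
  "jet_line \<xi> s \<eta> \<equiv> (\<lambda>\<alpha>. \<xi> \<alpha> + s *\<^sub>R \<eta> \<alpha>)"

definition jet_dist :: "nat \<Rightarrow> (('n::finite \<Rightarrow> nat) \<Rightarrow> 'v::real_normed_vector) \<Rightarrow> (('n \<Rightarrow> nat) \<Rightarrow> 'v) \<Rightarrow> real" where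
  "jet_dist k \<xi> \<eta> = (\<Sum>\<alpha>\<in>multi_indices k. norm (\<xi> \<alpha> - \<eta> \<alpha>))"

definition energy :: "((('n::finite \<Rightarrow> nat) \<Rightarrow> 'v::real_normed_vector) \<Rightarrow> real) \<Rightarrow> (('n \<Rightarrow> nat) \<Rightarrow> 'v) \<Rightarrow>
    (real ^ 'n \<Rightarrow> 'v) \<Rightarrow> real" where
  "energy F \<xi> \<phi> = integral (cbox 0 1) (\<lambda>x. F (\<lambda>\<alpha>. \<xi> \<alpha> + multi_deriv \<alpha> \<phi> x))"

text \<open>
  The quasiconvex envelope of \<open>F\<close> with respect to derivatives of order \<open>k\<close>.
\<close>

definition envelope :: "((('n::finite \<Rightarrow> nat) \<Rightarrow> 'v::real_normed_vector) \<Rightarrow> real) \<Rightarrow> (('n \<Rightarrow> nat) \<Rightarrow> 'v) \<Rightarrow> real" where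
  "envelope F \<xi> = (INF \<phi>\<in>cube_tests. energy F \<xi> \<phi>)"

lemma continuous_on_lipschitz_jet:
  fixes \<Psi> :: "'a::topological_space \<Rightarrow> ('n::finite \<Rightarrow> nat) \<Rightarrow> 'v::real_normed_vector"
  assumes lip: "\<And>\<xi> \<eta>. \<bar>G \<xi> - G \<eta>\<bar> \<le> L * jet_dist k \<xi> \<eta>"
    and cont: "\<And>\<alpha>. \<alpha> \<in> multi_indices k \<Longrightarrow> continuous_on S (\<lambda>x. \<Psi> x \<alpha>)"
  shows "continuous_on S (\<lambda>x. G (\<Psi> x) :: real)"
  unfolding continuous_on_def
proof
  fix x assume x: "x \<in> S"
  have "((\<lambda>y. G (\<Psi> y) - G (\<Psi> x)) \<longlongrightarrow> 0) (at x within S)"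
  proof (rule Lim_null_comparison)
    show "\<forall>\<^sub>F y in at x within S. norm (G (\<Psi> y) - G (\<Psi> x)) \<le> L * jet_dist k (\<Psi> y) (\<Psi> x)"
      using lip by simp
    have "((\<lambda>y. L * jet_dist k (\<Psi> y) (\<Psi> x)) \<longlongrightarrow> L * jet_dist k (\<Psi> x) (\<Psi> x)) (at x within S)"
      unfolding jet_dist_def using cont x by (intro tendsto_intros) (auto simp: continuous_on_def)
    then show "((\<lambda>y. L * jet_dist k (\<Psi> y) (\<Psi> x)) \<longlongrightarrow> 0) (at x within S)"
      by (simp add: jet_dist_def)
  qed
  then show "((\<lambda>x. G (\<Psi> x)) \<longlongrightarrow> G (\<Psi> x)) (at x within S)"
    by (simp add: LIM_zero_iff)
qed

lemma continuous_on_multi_deriv: "smooth \<phi> \<Longrightarrow> continuous_on S (multi_deriv \<alpha> \<phi>)"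
  unfolding multi_deriv_eq by (intro smooth_continuous_on smooth_foldr)

lemma zero_in_cube_tests: "(\<lambda>_. 0) \<in> cube_tests"
  by (simp add: cube_tests_def smooth_const)

lemma multi_deriv_zero [simp]: "multi_deriv \<alpha> (\<lambda>_. 0) = (\<lambda>_. 0)"
  by (simp add: multi_deriv_eq)

lemma multi_deriv_scaleR: "smooth \<phi> \<Longrightarrow> multi_deriv \<alpha> (\<lambda>x. c *\<^sub>R \<phi> x) = (\<lambda>x. c *\<^sub>R multi_deriv \<alpha> \<phi> x)"
  by (simp add: multi_deriv_eq foldr_partial_deriv_scaleR)

lemma cube_tests_scaleR: "\<phi> \<in> cube_tests \<Longrightarrow> (\<lambda>x. c *\<^sub>R \<phi> x) \<in> cube_tests"
  by (simp add: cube_tests_def foldr_partial_deriv_scaleR smooth_scaleR smooth_const)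

text \<open>
  The hypotheses under which \<open>F\<close> turns out to be nonnegative. The last one says that the zero
  function minimises the energy at the zero jet; together with the Lipschitz bound it keeps
  \<open>envelope F\<close> finite.
\<close>

locale jet_integrand =
  fixes k :: nat and F :: "(('n::finite \<Rightarrow> nat) \<Rightarrow> 'v::real_normed_vector) \<Rightarrow> real" and L :: real
  assumes L: "L \<ge> 0"
    and lip: "\<And>\<xi> \<eta>. \<bar>F \<xi> - F \<eta>\<bar> \<le> L * jet_dist k \<xi> \<eta>"
    and hom: "\<And>r \<xi>. r > 0 \<Longrightarrow> F (\<lambda>\<alpha>. r *\<^sub>R \<xi> \<alpha>) = r * F \<xi>"
    and even: "\<And>\<xi>. F (\<lambda>\<alpha>. - \<xi> \<alpha>) = F \<xi>"
    and nonneg: "\<And>\<phi>. \<phi> \<in> cube_tests \<Longrightarrow> energy F (\<lambda>_. 0) \<phi> \<ge> 0"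
begin

lemma continuous_energy: "smooth \<phi> \<Longrightarrow> continuous_on S (\<lambda>x. F (\<lambda>\<alpha>. \<xi> \<alpha> + multi_deriv \<alpha> \<phi> x))"
  by (intro continuous_on_lipschitz_jet[OF lip] continuous_intros continuous_on_multi_deriv)

lemma energy_lip:
  assumes "smooth \<phi>"
  shows "energy F \<xi> \<phi> \<le> energy F \<eta> \<phi> + L * jet_dist k \<xi> \<eta>"
  unfolding energy_def
proof (rule integral_unit_cube_le)
  fix x
  show "F (\<lambda>\<alpha>. \<xi> \<alpha> + multi_deriv \<alpha> \<phi> x) \<le> F (\<lambda>\<alpha>. \<eta> \<alpha> + multi_deriv \<alpha> \<phi> x) + L * jet_dist k \<xi> \<eta>"
    using lip[of "\<lambda>\<alpha>. \<xi> \<alpha> + multi_deriv \<alpha> \<phi> x" "\<lambda>\<alpha>. \<eta> \<alpha> + multi_deriv \<alpha> \<phi> x"] by (simp add: jet_dist_def)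
qed (rule continuous_energy[OF assms])+

lemma energy_bounded_below:
  assumes "\<phi> \<in> cube_tests"
  shows "- (L * jet_dist k (\<lambda>_. 0) \<xi>) \<le> energy F \<xi> \<phi>"
  using energy_lip[OF cube_tests_smooth[OF assms], of "\<lambda>_. 0" \<xi>] nonneg[OF assms] by simp

lemma envelope_le: "\<phi> \<in> cube_tests \<Longrightarrow> envelope F \<xi> \<le> energy F \<xi> \<phi>"
  unfolding envelope_def using energy_bounded_below
  by (intro cINF_lower bdd_belowI2[where m = "- (L * jet_dist k (\<lambda>_. 0) \<xi>)"]) auto

lemma envelope_greatest: "(\<And>\<phi>. \<phi> \<in> cube_tests \<Longrightarrow> b \<le> energy F \<xi> \<phi>) \<Longrightarrow> b \<le> envelope F \<xi>"
  unfolding envelope_def using zero_in_cube_tests by (intro cINF_greatest) auto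

lemma envelope_approx:
  assumes "\<epsilon> > 0"
  obtains \<phi> where "\<phi> \<in> cube_tests" "energy F \<xi> \<phi> \<le> envelope F \<xi> + \<epsilon>"
proof -
  have "\<not> (\<forall>\<phi>\<in>cube_tests. envelope F \<xi> + \<epsilon> \<le> energy F \<xi> \<phi>)"
    using envelope_greatest[of "envelope F \<xi> + \<epsilon>" \<xi>] assms by fastforce
  then show thesis using that by (meson less_imp_le not_le)
qed

lemma envelope_le_self: "envelope F \<xi> \<le> F \<xi>"
  using envelope_le[OF zero_in_cube_tests, of \<xi>] by (simp add: energy_def)

text \<open>
  The energies of one test function at two jets differ by at most the Lipschitz bound, and this
  passes to infima.
\<close>

lemma envelope_lip: "\<bar>envelope F \<xi> - envelope F \<eta>\<bar> \<le> L * jet_dist k \<xi> \<eta>"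
proof -
  have le: "envelope F \<xi> - L * jet_dist k \<xi> \<eta> \<le> envelope F \<eta>" for \<xi> \<eta>
  proof (rule envelope_greatest)
    fix \<phi> :: "real ^ 'n \<Rightarrow> 'v" assume "\<phi> \<in> cube_tests"
    then show "envelope F \<xi> - L * jet_dist k \<xi> \<eta> \<le> energy F \<eta> \<phi>"
      using envelope_le[of \<phi> \<xi>] energy_lip[OF cube_tests_smooth, of \<phi> \<xi> \<eta>] by simp
  qed
  have "jet_dist k \<eta> \<xi> = jet_dist k \<xi> \<eta>" by (simp add: jet_dist_def norm_minus_commute)
  then show ?thesis using le[of \<xi> \<eta>] le[of \<eta> \<xi>] by (simp add: abs_le_iff)
qed

text \<open>
  A test function may be multiplied by \<open>r\<close>.
\<close>

lemma envelope_hom: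
  assumes r: "r > 0"
  shows "envelope F (\<lambda>\<alpha>. r *\<^sub>R \<xi> \<alpha>) = r * envelope F \<xi>"
proof (rule antisym)
  have le: "envelope F (\<lambda>\<alpha>. r *\<^sub>R \<xi> \<alpha>) \<le> r * envelope F \<xi>" if r: "r > 0" for r \<xi>
  proof -
    have "envelope F (\<lambda>\<alpha>. r *\<^sub>R \<xi> \<alpha>) / r \<le> envelope F \<xi>"
    proof (rule envelope_greatest)
      fix \<phi> :: "real ^ 'n \<Rightarrow> 'v" assume \<phi>: "\<phi> \<in> cube_tests"
      have "envelope F (\<lambda>\<alpha>. r *\<^sub>R \<xi> \<alpha>) \<le> energy F (\<lambda>\<alpha>. r *\<^sub>R \<xi> \<alpha>) (\<lambda>x. r *\<^sub>R \<phi> x)"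
        by (intro envelope_le cube_tests_scaleR \<phi>)
      also have "\<dots> = integral (cbox 0 1) (\<lambda>x. r * F (\<lambda>\<alpha>. \<xi> \<alpha> + multi_deriv \<alpha> \<phi> x))"
        using hom[OF r, of "\<lambda>\<alpha>. \<xi> \<alpha> + multi_deriv \<alpha> \<phi> _"]
        by (simp add: energy_def multi_deriv_scaleR cube_tests_smooth \<phi> scaleR_add_right)
      also have "\<dots> = r * energy F \<xi> \<phi>" by (simp add: energy_def)
      finally show "envelope F (\<lambda>\<alpha>. r *\<^sub>R \<xi> \<alpha>) / r \<le> energy F \<xi> \<phi>" using r by (simp add: field_simps)
    qed
    then show ?thesis using r by (simp add: field_simps)
  qed
  show "envelope F (\<lambda>\<alpha>. r *\<^sub>R \<xi> \<alpha>) \<le> r * envelope F \<xi>" by (rule le[OF r])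
  show "r * envelope F \<xi> \<le> envelope F (\<lambda>\<alpha>. r *\<^sub>R \<xi> \<alpha>)"
    using le[of "1 / r" "\<lambda>\<alpha>. r *\<^sub>R \<xi> \<alpha>"] r by (simp add: field_simps)
qed

lemma envelope_even: "envelope F (\<lambda>\<alpha>. - \<xi> \<alpha>) = envelope F \<xi>"
proof -
  have le: "envelope F (\<lambda>\<alpha>. - \<xi> \<alpha>) \<le> envelope F \<xi>" for \<xi>
  proof (rule envelope_greatest)
    fix \<phi> :: "real ^ 'n \<Rightarrow> 'v" assume \<phi>: "\<phi> \<in> cube_tests"
    have "envelope F (\<lambda>\<alpha>. - \<xi> \<alpha>) \<le> energy F (\<lambda>\<alpha>. - \<xi> \<alpha>) (\<lambda>x. (- 1) *\<^sub>R \<phi> x)"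
      by (intro envelope_le cube_tests_scaleR \<phi>)
    also have "\<dots> = energy F \<xi> \<phi>"
      using even[of "\<lambda>\<alpha>. \<xi> \<alpha> + multi_deriv \<alpha> \<phi> _"]
      by (simp only: energy_def multi_deriv_scaleR cube_tests_smooth \<phi>) simp
    finally show "envelope F (\<lambda>\<alpha>. - \<xi> \<alpha>) \<le> energy F \<xi> \<phi>" .
  qed
  show ?thesis using le[of \<xi>] le[of "\<lambda>\<alpha>. - \<xi> \<alpha>"] by simp
qed

end

section \<open>Quasiconvexity of the envelope by subdivision\<close>

lemma grid_division:
  fixes m :: nat
  assumes m: "m > 0"
  defines "Q \<equiv> (\<lambda>z :: 'n::finite \<Rightarrow> nat. cbox (\<chi> i. real (z i) / m) (\<chi> i. (real (z i) + 1) / m))"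
  shows "Q ` PiE UNIV (\<lambda>_. {..<m}) division_of cbox 0 1" and "inj_on Q (PiE UNIV (\<lambda>_. {..<m}))"
proof -
  have mem: "x \<in> Q z \<longleftrightarrow> (\<forall>i. real (z i) \<le> m * x $ i \<and> m * x $ i \<le> real (z i) + 1)" for x z
    using m by (simp add: Q_def mem_box_cart field_simps)
  have int: "x \<in> interior (Q z) \<longleftrightarrow> (\<forall>i. real (z i) < m * x $ i \<and> m * x $ i < real (z i) + 1)" for x z
    using m by (simp add: Q_def mem_box_cart field_simps)
  have eq: "z = z'" if "x \<in> interior (Q z)" "x \<in> interior (Q z')" for x z z'
  proof
    fix i
    have "real (z i) < real (z' i) + 1" "real (z' i) < real (z i) + 1"
      using that[unfolded int, rule_format, of i] by auto
    then show "z i = z' i" by linarith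
  qed
  have nonempty: "(\<chi> i. (real (z i) + 1 / 2) / m) \<in> interior (Q z)" for z
    using m by (simp add: int)
  show inj: "inj_on Q (PiE UNIV (\<lambda>_. {..<m}))"
    using eq nonempty by (metis inj_onI)
  show "Q ` PiE UNIV (\<lambda>_. {..<m}) division_of cbox 0 1"
  proof (rule division_ofI)
    show "finite (Q ` PiE UNIV (\<lambda>_. {..<m}))" by (intro finite_imageI finite_PiE) auto
    show "K \<subseteq> cbox 0 1" if KQ: "K \<in> Q ` PiE UNIV (\<lambda>_. {..<m})" for K
    proof -
      obtain z where "z \<in> PiE UNIV (\<lambda>_. {..<m})" and K: "K = Q z" using KQ by blast
      then have z: "z i < m" for i by (auto simp: PiE_iff)
      show ?thesis unfolding K
      proof
        fix x assume x: "x \<in> Q z"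
        have "0 \<le> x $ i \<and> x $ i \<le> 1" for i
        proof -
          have "0 \<le> m * x $ i" "m * x $ i \<le> real m * 1"
            using x[unfolded mem, rule_format, of i] z[of i] by linarith+
          then show ?thesis using m by (simp add: zero_le_mult_iff)
        qed
        then show "x \<in> cbox 0 1" by (simp add: mem_box_cart)
      qed
    qed
    show "K \<noteq> {}" if "K \<in> Q ` PiE UNIV (\<lambda>_. {..<m})" for K
      using that nonempty interior_subset by blast
    show "\<exists>a b. K = cbox a b" if "K \<in> Q ` PiE UNIV (\<lambda>_. {..<m})" for K
      using that by (auto simp: Q_def)
    show "interior K1 \<inter> interior K2 = {}"
      if "K1 \<in> Q ` PiE UNIV (\<lambda>_. {..<m})" "K2 \<in> Q ` PiE UNIV (\<lambda>_. {..<m})" "K1 \<noteq> K2" for K1 K2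
      using that eq by blast
    show "\<Union> (Q ` PiE UNIV (\<lambda>_. {..<m})) = cbox 0 1"
    proof
      show "\<Union> (Q ` PiE UNIV (\<lambda>_. {..<m})) \<subseteq> cbox 0 1"
        using \<open>\<And>K. K \<in> Q ` PiE UNIV (\<lambda>_. {..<m}) \<Longrightarrow> K \<subseteq> cbox 0 1\<close> by blast
      show "cbox 0 1 \<subseteq> \<Union> (Q ` PiE UNIV (\<lambda>_. {..<m}))"
      proof
        fix x :: "real ^ 'n" assume x: "x \<in> cbox 0 1"
        define z where "z i = min (nat \<lfloor>m * x $ i\<rfloor>) (m - 1)" for i
        have "real (z i) \<le> m * x $ i \<and> m * x $ i \<le> real (z i) + 1" for i
        proof -
          have x': "0 \<le> x $ i" "x $ i \<le> 1" using x by (auto simp: mem_box_cart)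
          then have y: "0 \<le> m * x $ i" "m * x $ i \<le> m" using m by (auto simp: mult_left_le)
          have fl: "real (nat \<lfloor>m * x $ i\<rfloor>) \<le> m * x $ i" "m * x $ i < real (nat \<lfloor>m * x $ i\<rfloor>) + 1"
            using y(1) by linarith+
          show ?thesis
          proof (cases "nat \<lfloor>m * x $ i\<rfloor> \<le> m - 1")
            case True
            then show ?thesis using fl by (simp add: z_def)
          next
            case False
            then have "real (z i) = real (m - 1)" by (simp add: z_def)
            moreover have "real (m - 1) \<le> real (nat \<lfloor>m * x $ i\<rfloor>)" using False by simp
            moreover have "real m = real (m - 1) + 1" using m by simp
            ultimately show ?thesis using fl y by linarith
          qed
        qed
        then have "x \<in> Q z" by (simp add: mem)
        moreover have "z \<in> PiE UNIV (\<lambda>_. {..<m})" using m by (auto simp: z_def)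
        ultimately show "x \<in> \<Union> (Q ` PiE UNIV (\<lambda>_. {..<m}))" by blast
      qed
    qed
  qed
qed

text \<open>
  The grid consists of closed cubes with overlapping faces, a division in the sense of the
  gauge integral.
\<close>

lemma integral_grid:
  fixes f :: "real ^ 'n::finite \<Rightarrow> real" and m :: nat
  assumes "m > 0" "continuous_on (cbox 0 1) f"
  shows "integral (cbox 0 1) f =
    (\<Sum>z\<in>PiE UNIV (\<lambda>_. {..<m}). integral (cbox (\<chi> i. real (z i) / m) (\<chi> i. (real (z i) + 1) / m)) f)"
  using integral_combine_division_topdown[OF integrable_continuous[OF assms(2)] grid_division(1)[OF assms(1)]]
  by (simp add: sum.reindex[OF grid_division(2)[OF assms(1)]])

lemma integral_small_cube:
  fixes f :: "real ^ 'n::finite \<Rightarrow> real" and m :: nat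
  assumes m: "m > 0" and f: "continuous_on (cbox 0 1) f"
  shows "integral (cbox (\<chi> i. real (z i) / m) (\<chi> i. (real (z i) + 1) / m))
      (\<lambda>x. f (real m *\<^sub>R x + - (\<chi> i. real (z i)))) = integral (cbox 0 1) f / real m ^ CARD('n)"
proof -
  have "(f has_integral integral (cbox 0 1) f) (cbox 0 1)"
    using integrable_continuous[OF f] by (rule integrable_integral)
  from has_integral_affinity[OF this, of "real m" "- (\<chi> i. real (z i))"] m
  have "((\<lambda>x. f (real m *\<^sub>R x + - (\<chi> i. real (z i)))) has_integral integral (cbox 0 1) f / real m ^ CARD('n))
    ((\<lambda>x. (1 / real m) *\<^sub>R x + - ((1 / real m) *\<^sub>R - (\<chi> i. real (z i)))) ` cbox 0 1)" by simp
  also have "(\<lambda>x. (1 / real m) *\<^sub>R x + - ((1 / real m) *\<^sub>R - (\<chi> i. real (z i)))) ` cbox 0 (1 :: real ^ 'n)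
      = cbox (\<chi> i. real (z i) / m) (\<chi> i. (real (z i) + 1) / m)"
  proof -
    have "(0 :: real ^ 'n) \<in> cbox 0 1" by (simp add: mem_box_cart)
    then have ne: "cbox 0 (1 :: real ^ 'n) \<noteq> {}" by blast
    have "(\<lambda>x. (1 / real m) *\<^sub>R x + - ((1 / real m) *\<^sub>R - (\<chi> i. real (z i)))) ` cbox 0 (1 :: real ^ 'n)
        = (\<lambda>x. (1 / real m) *\<^sub>R x + (1 / real m) *\<^sub>R (\<chi> i. real (z i))) ` cbox 0 (1 :: real ^ 'n)" by simp
    also have "\<dots> = cbox ((1 / real m) *\<^sub>R 0 + (1 / real m) *\<^sub>R (\<chi> i. real (z i)))
        ((1 / real m) *\<^sub>R 1 + (1 / real m) *\<^sub>R (\<chi> i. real (z i)))"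
      using image_affinity_cbox[of "1 / real m" "(1 / real m) *\<^sub>R (\<chi> i. real (z i))" 0 "1 :: real ^ 'n"] ne by simp
    also have "\<dots> = cbox (\<chi> i. real (z i) / m) (\<chi> i. (real (z i) + 1) / m)"
      by (intro arg_cong2[of _ _ _ _ cbox]) (auto simp: vec_eq_iff add_divide_distrib)
    finally show ?thesis .
  qed
  finally show ?thesis by (rule integral_unique)
qed

context jet_integrand
begin

lemma continuous_envelope:
  "(\<And>\<alpha>. \<alpha> \<in> multi_indices k \<Longrightarrow> continuous_on S (\<Psi> \<alpha>)) \<Longrightarrow>
    continuous_on S (\<lambda>x. envelope F (\<lambda>\<alpha>. \<Psi> \<alpha> x))"
  by (rule continuous_on_lipschitz_jet[OF envelope_lip])

lemma uniform_jet:
  fixes \<psi> :: "real ^ 'n \<Rightarrow> 'v"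
  assumes \<psi>: "smooth \<psi>" and \<delta>: "\<delta> > 0"
  obtains d where "d > 0" "\<And>x y. x \<in> cbox 0 1 \<Longrightarrow> y \<in> cbox 0 1 \<Longrightarrow> dist x y < d \<Longrightarrow>
    jet_dist k (jet \<psi> x) (jet \<psi> y) \<le> \<delta>"
proof -
  define M where "M = (multi_indices k :: ('n \<Rightarrow> nat) set)"
  define \<epsilon> where "\<epsilon> = \<delta> / (card M + 1)"
  have \<epsilon>: "\<epsilon> > 0" using \<delta> by (simp add: \<epsilon>_def add_nonneg_pos)
  have "\<exists>d>0. \<forall>x\<in>cbox 0 1. \<forall>y\<in>cbox 0 1. dist x y < d \<longrightarrow>
      norm (multi_deriv \<alpha> \<psi> x - multi_deriv \<alpha> \<psi> y) < \<epsilon>" for \<alpha>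
    using compact_uniformly_continuous[OF continuous_on_multi_deriv[OF \<psi>, of "cbox 0 1" \<alpha>] compact_cbox] \<epsilon>
    unfolding uniformly_continuous_on_def dist_norm by (metis norm_minus_commute)
  then obtain d where d: "\<And>\<alpha>. d \<alpha> > 0" "\<And>\<alpha> x y. x \<in> cbox 0 1 \<Longrightarrow> y \<in> cbox 0 1 \<Longrightarrow> dist x y < d \<alpha> \<Longrightarrow>
      norm (multi_deriv \<alpha> \<psi> x - multi_deriv \<alpha> \<psi> y) < \<epsilon>" by metis
  have fin: "finite M" by (simp add: M_def finite_multi_indices)
  show thesis
  proof (rule that[of "Min (insert 1 (d ` M))"])
    show "Min (insert 1 (d ` M)) > 0" using d(1) fin by simp
    fix x y :: "real ^ 'n" assume xy: "x \<in> cbox 0 1" "y \<in> cbox 0 1" "dist x y < Min (insert 1 (d ` M))"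
    have "jet_dist k (jet \<psi> x) (jet \<psi> y) \<le> (\<Sum>\<alpha>\<in>M. \<epsilon>)"
      unfolding jet_dist_def M_def[symmetric] using xy fin
      by (intro sum_mono less_imp_le d(2)) auto
    also have "\<dots> \<le> \<delta>" using \<delta> by (simp add: \<epsilon>_def field_simps)
    finally show "jet_dist k (jet \<psi> x) (jet \<psi> y) \<le> \<delta>" .
  qed
qed

text \<open>
  On a cube of a fine grid the jet of \<open>\<psi>\<close> is almost constant. Adding to \<open>\<psi>\<close>, on each cube, a scaled
  near-minimiser for \<open>F\<close> at that constant jet gives a competitor for \<open>envelope F \<xi>\<close> whose energy is
  close to the integral of \<open>envelope F\<close> along the jet of \<open>\<psi>\<close>.
\<close>

lemma envelope_quasiconvex_approx:
  fixes \<psi> :: "real ^ 'n \<Rightarrow> 'v"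
  assumes \<psi>: "\<psi> \<in> cube_tests" and \<epsilon>: "\<epsilon> > 0"
  shows "envelope F \<xi> \<le> energy (envelope F) \<xi> \<psi> + \<epsilon>"
proof -
  \<comment> \<open>the oscillation of \<open>\<psi>\<close> on a cube enters twice, through \<open>F\<close> and through its envelope, and the choice of near-minimisers once\<close>
  define e where "e = \<epsilon> / (2 * L + 1)"
  have e: "e > 0" using \<epsilon> L by (simp add: e_def add_nonneg_pos)
  have sm: "smooth \<psi>" using \<psi> by (rule cube_tests_smooth)
  obtain d where d: "d > 0" "\<And>x y. x \<in> cbox 0 1 \<Longrightarrow> y \<in> cbox 0 1 \<Longrightarrow> dist x y < d \<Longrightarrow>
    jet_dist k (jet \<psi> x) (jet \<psi> y) \<le> e"
    using uniform_jet[OF sm e] by metis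
  obtain m :: nat where m': "real CARD('n) / d < real m" using reals_Archimedean2 by blast
  have m: "m > 0" using m' d(1) by (metis divide_nonneg_pos less_eq_real_def not_less of_nat_0 of_nat_0_le_iff gr0I)
  define Z where "Z = PiE (UNIV :: 'n set) (\<lambda>_. {..<m})"
  define corner where "corner z = (\<chi> i. real (z i))" for z :: "'n \<Rightarrow> nat"
  define p where "p z = (\<chi> i. real (z i) / m)" for z :: "'n \<Rightarrow> nat"
  define Q where "Q z = cbox (p z) (\<chi> i. (real (z i) + 1) / m)" for z :: "'n \<Rightarrow> nat"
  have finZ: "finite Z" by (auto simp: Z_def intro: finite_PiE)
  define \<xi>' where "\<xi>' x = (\<lambda>\<alpha>. \<xi> \<alpha> + multi_deriv \<alpha> \<psi> x)" for x
  have mem: "x \<in> Q z \<longleftrightarrow> (\<forall>i. real (z i) \<le> m * x $ i \<and> m * x $ i \<le> real (z i) + 1)" for x z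
    using m by (simp add: Q_def p_def mem_box_cart field_simps)
  have Q_sub: "Q z \<subseteq> cbox 0 1" if "z \<in> Z" for z
    using division_ofD(2)[OF grid_division(1)[OF m], of "Q z"] that by (auto simp: Z_def Q_def p_def)
  have pQ: "p z \<in> Q z" for z using m by (simp add: mem p_def)
  have diam: "jet_dist k (jet \<psi> x) (jet \<psi> (p z)) \<le> e"
    if z: "z \<in> Z" and x: "x \<in> Q z" for x z
  proof (rule d(2))
    have "norm (x - p z) \<le> (\<Sum>i\<in>UNIV. \<bar>(x - p z) $ i\<bar>)" by (rule norm_le_l1_cart)
    also have "\<dots> \<le> (\<Sum>i\<in>(UNIV :: 'n set). 1 / m)"
    proof (rule sum_mono)
      fix i
      have "\<bar>m * x $ i - real (z i)\<bar> \<le> 1" using x[unfolded mem, rule_format, of i] by simp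
      moreover have "(x - p z) $ i = (m * x $ i - real (z i)) / m" using m by (simp add: p_def field_simps)
      ultimately show "\<bar>(x - p z) $ i\<bar> \<le> 1 / m" by (simp add: divide_right_mono)
    qed
    also have "\<dots> = real CARD('n) / m" by simp
    also have "\<dots> < d" using m' d(1) m by (simp add: field_simps)
    finally show "dist x (p z) < d" by (simp add: dist_norm)
  qed (use x z Q_sub pQ in auto)
  have "\<exists>\<phi>. \<phi> \<in> cube_tests \<and> energy F (\<xi>' (p z)) \<phi> \<le> envelope F (\<xi>' (p z)) + e" for z
    using envelope_approx[OF e, of "\<xi>' (p z)"] by metis
  then obtain \<phi> where \<phi>: "\<And>z. \<phi> z \<in> cube_tests"
    "\<And>z. energy F (\<xi>' (p z)) (\<phi> z) \<le> envelope F (\<xi>' (p z)) + e" by metis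
  \<comment> \<open>the factor makes the derivatives of order \<open>k\<close> scale invariant\<close>
  define piece where "piece z x = (1 / real m) ^ k *\<^sub>R \<phi> z (real m *\<^sub>R x + - corner z)" for z x
  define \<Phi> where "\<Phi> x = \<psi> x + (\<Sum>z\<in>Z. piece z x)" for x
  have piece_smooth: "smooth (piece z)" for z
    unfolding piece_def by (intro smooth_scaleR smooth_const smooth_affine cube_tests_smooth \<phi>)
  have piece_deriv: "foldr partial_deriv js (piece z) x
      = (1 / real m) ^ k *\<^sub>R (real m ^ length js *\<^sub>R foldr partial_deriv js (\<phi> z) (real m *\<^sub>R x + - corner z))" for js z x
    unfolding piece_def
    by (simp only: foldr_partial_deriv_scaleR smooth_affine cube_tests_smooth[OF \<phi>(1)] foldr_partial_deriv_affine)
  have inbox: "x \<in> box 0 1" "x \<in> Q z" "\<And>z'. x \<in> Q z' \<Longrightarrow> z' = z"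
    if z: "z \<in> Z" and x: "real m *\<^sub>R x + - corner z \<in> box 0 1" for x z
  proof -
    have b: "real (z i) < m * x $ i" "m * x $ i < real (z i) + 1" for i
      using x by (auto simp: mem_box_cart corner_def algebra_simps)
    show "x \<in> Q z" using b by (auto simp: mem less_imp_le)
    show "x \<in> box 0 1" unfolding mem_box_cart
    proof
      fix i
      have "z i < m" using z by (auto simp: Z_def PiE_iff)
      then have "0 < m * x $ i" "m * x $ i < real m * 1" using b[of i] by linarith+
      then show "0 $ i < x $ i \<and> x $ i < 1 $ i" using m by (simp add: zero_less_mult_iff)
    qed
    show "z' = z" if "x \<in> Q z'" for z'
    proof
      fix i
      have "real (z i) < real (z' i) + 1" "real (z' i) < real (z i) + 1"
        using that[unfolded mem, rule_format, of i] b[of i] by linarith+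
      then show "z' i = z i" by linarith
    qed
  qed
  have \<Phi>_smooth: "smooth \<Phi>"
    unfolding \<Phi>_def by (intro smooth_add sm smooth_sum piece_smooth)
  have \<Phi>_deriv: "foldr partial_deriv js \<Phi> x = foldr partial_deriv js \<psi> x + (\<Sum>z\<in>Z. foldr partial_deriv js (piece z) x)" for js x
    unfolding \<Phi>_def by (simp add: foldr_partial_deriv_add foldr_partial_deriv_sum sm piece_smooth smooth_sum)
  have "foldr partial_deriv js (piece z) x = 0" if "z \<in> Z" "x \<notin> box 0 1" for js z x
    using inbox(1)[OF that(1), of x] that(2) \<phi>(1)[of z] by (auto simp: piece_deriv cube_tests_def)
  then have \<Phi>_tests: "\<Phi> \<in> cube_tests"
    using \<psi> \<Phi>_smooth by (auto simp: cube_tests_def \<Phi>_deriv)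
  have \<Phi>_Q: "multi_deriv \<alpha> \<Phi> x = multi_deriv \<alpha> \<psi> x + multi_deriv \<alpha> (\<phi> z) (real m *\<^sub>R x + - corner z)"
    if \<alpha>: "\<alpha> \<in> multi_indices k" and z: "z \<in> Z" and x: "x \<in> Q z" for \<alpha> z x
  proof -
    have "foldr partial_deriv (multi_list \<alpha>) (piece z') x = 0" if "z' \<in> Z - {z}" for z'
      using inbox(3)[of z' x z] that x \<phi>(1)[of z'] by (auto simp: piece_deriv cube_tests_def)
    then have "(\<Sum>z\<in>Z. foldr partial_deriv (multi_list \<alpha>) (piece z) x) = foldr partial_deriv (multi_list \<alpha>) (piece z) x"
      using finZ z by (subst sum.remove[of _ z]) auto
    then show ?thesis
      using m by (simp add: multi_deriv_eq \<Phi>_deriv piece_deriv length_multi_list[OF \<alpha>] power_one_over)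
  qed
  define c where "c = (1 / real m ^ CARD('n))"
  have contQ: "measure lborel (Q z) = c" for z
    using integral_small_cube[OF m, of "\<lambda>_. 1" z] by (simp add: Q_def p_def c_def)
  have intQ: "f integrable_on Q z" if "continuous_on UNIV f" for f :: "real ^ 'n \<Rightarrow> real" and z
    unfolding Q_def using that by (intro integrable_continuous) (rule continuous_on_subset, auto)
  have cont\<Phi>: "continuous_on S (\<lambda>x. F (\<lambda>\<alpha>. \<xi> \<alpha> + multi_deriv \<alpha> \<Phi> x))" for S
    by (rule continuous_energy[OF \<Phi>_smooth])
  have contenv: "continuous_on S (\<lambda>x. envelope F (\<xi>' x))" for S
    unfolding \<xi>'_def by (intro continuous_envelope continuous_intros continuous_on_multi_deriv sm)
  have local: "integral (Q z) (\<lambda>x. F (\<lambda>\<alpha>. \<xi> \<alpha> + multi_deriv \<alpha> \<Phi> x)) \<le> integral (Q z) (\<lambda>x. envelope F (\<xi>' x)) + c * \<epsilon>"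
    if z: "z \<in> Z" for z
  proof -
    define h where "h x = F (\<lambda>\<alpha>. \<xi>' (p z) \<alpha> + multi_deriv \<alpha> (\<phi> z) x)" for x
    have conth: "continuous_on S h" for S
      unfolding h_def by (intro continuous_energy cube_tests_smooth \<phi>)
    have conth': "continuous_on S (\<lambda>x. h (real m *\<^sub>R x + - corner z))" for S
      by (rule continuous_on_compose2[OF conth[of UNIV]]) (auto intro!: continuous_intros)
    have "integral (Q z) (\<lambda>x. F (\<lambda>\<alpha>. \<xi> \<alpha> + multi_deriv \<alpha> \<Phi> x))
        \<le> integral (Q z) (\<lambda>x. h (real m *\<^sub>R x + - corner z) + L * e)"
    proof (rule integral_le)
      fix x assume x: "x \<in> Q z"
      have "\<bar>F (\<lambda>\<alpha>. \<xi> \<alpha> + multi_deriv \<alpha> \<Phi> x) - h (real m *\<^sub>R x + - corner z)\<bar>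
          \<le> L * jet_dist k (\<lambda>\<alpha>. \<xi> \<alpha> + multi_deriv \<alpha> \<Phi> x)
              (\<lambda>\<alpha>. \<xi>' (p z) \<alpha> + multi_deriv \<alpha> (\<phi> z) (real m *\<^sub>R x + - corner z))"
        unfolding h_def by (rule lip)
      also have "jet_dist k (\<lambda>\<alpha>. \<xi> \<alpha> + multi_deriv \<alpha> \<Phi> x)
              (\<lambda>\<alpha>. \<xi>' (p z) \<alpha> + multi_deriv \<alpha> (\<phi> z) (real m *\<^sub>R x + - corner z))
          = jet_dist k (jet \<psi> x) (jet \<psi> (p z))"
        unfolding jet_dist_def by (intro sum.cong refl) (simp add: \<Phi>_Q[OF _ z x] \<xi>'_def)
      also have "L * \<dots> \<le> L * e" using diam[OF z x] L by (intro mult_left_mono)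
      finally show "F (\<lambda>\<alpha>. \<xi> \<alpha> + multi_deriv \<alpha> \<Phi> x) \<le> h (real m *\<^sub>R x + - corner z) + L * e" by simp
    qed (intro intQ cont\<Phi> continuous_on_add[OF conth' continuous_on_const])+
    also have "\<dots> = integral (Q z) (\<lambda>x. h (real m *\<^sub>R x + - corner z)) + c * (L * e)"
      using contQ[of z]
      by (subst Henstock_Kurzweil_Integration.integral_add[OF intQ[OF conth'] intQ[OF continuous_on_const]]) (simp add: Q_def)
    also have "integral (Q z) (\<lambda>x. h (real m *\<^sub>R x + - corner z)) = c * energy F (\<xi>' (p z)) (\<phi> z)"
      using integral_small_cube[OF m conth[of "cbox 0 1"], of z]
      by (simp add: Q_def p_def corner_def c_def energy_def h_def[abs_def])
    also have "\<dots> \<le> c * (envelope F (\<xi>' (p z)) + e)"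
      using \<phi>(2)[of z] by (intro mult_left_mono) (auto simp: c_def)
    also have "c * (envelope F (\<xi>' (p z)) + e) + c * (L * e) = integral (Q z) (\<lambda>_. envelope F (\<xi>' (p z)) + e + L * e)"
      using contQ[of z] by (simp add: Q_def algebra_simps)
    also have "\<dots> \<le> integral (Q z) (\<lambda>x. envelope F (\<xi>' x) + \<epsilon>)"
    proof (rule integral_le)
      fix x assume x: "x \<in> Q z"
      have "\<bar>envelope F (\<xi>' x) - envelope F (\<xi>' (p z))\<bar> \<le> L * jet_dist k (\<xi>' x) (\<xi>' (p z))"
        by (rule envelope_lip)
      also have "jet_dist k (\<xi>' x) (\<xi>' (p z)) = jet_dist k (jet \<psi> x) (jet \<psi> (p z))"
        by (simp add: jet_dist_def \<xi>'_def)
      also have "L * \<dots> \<le> L * e" using diam[OF z x] L by (intro mult_left_mono)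
      finally have "envelope F (\<xi>' (p z)) \<le> envelope F (\<xi>' x) + L * e" by simp
      moreover have "\<epsilon> = 2 * L * e + e"
      proof -
        have "2 * L + 1 > 0" using L by simp
        then have "(2 * L + 1) * e = \<epsilon>" by (simp add: e_def)
        then show ?thesis by (simp add: algebra_simps)
      qed
      ultimately show "envelope F (\<xi>' (p z)) + e + L * e \<le> envelope F (\<xi>' x) + \<epsilon>" by simp
    qed (intro intQ continuous_on_const continuous_on_add[OF contenv continuous_on_const])+
    also have "\<dots> = integral (Q z) (\<lambda>x. envelope F (\<xi>' x)) + c * \<epsilon>"
      using contQ[of z]
      by (subst Henstock_Kurzweil_Integration.integral_add[OF intQ[OF contenv] intQ[OF continuous_on_const]]) (simp add: Q_def)
    finally show ?thesis by simp
  qed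
  have "envelope F \<xi> \<le> energy F \<xi> \<Phi>" by (rule envelope_le[OF \<Phi>_tests])
  also have "\<dots> = (\<Sum>z\<in>Z. integral (Q z) (\<lambda>x. F (\<lambda>\<alpha>. \<xi> \<alpha> + multi_deriv \<alpha> \<Phi> x)))"
    unfolding energy_def Z_def Q_def p_def by (rule integral_grid[OF m cont\<Phi>])
  also have "\<dots> \<le> (\<Sum>z\<in>Z. integral (Q z) (\<lambda>x. envelope F (\<xi>' x)) + c * \<epsilon>)"
    by (intro sum_mono local)
  also have "\<dots> = (\<Sum>z\<in>Z. integral (Q z) (\<lambda>x. envelope F (\<xi>' x))) + card Z * (c * \<epsilon>)"
    by (simp add: sum.distrib)
  also have "(\<Sum>z\<in>Z. integral (Q z) (\<lambda>x. envelope F (\<xi>' x))) = energy (envelope F) \<xi> \<psi>"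
    unfolding energy_def Z_def Q_def p_def \<xi>'_def[symmetric] by (rule integral_grid[OF m contenv, symmetric])
  also have "card Z * (c * \<epsilon>) = \<epsilon>"
    using m by (simp add: Z_def c_def card_PiE)
  finally show ?thesis .
qed

lemma envelope_quasiconvex:
  "\<psi> \<in> cube_tests \<Longrightarrow> envelope F \<xi> \<le> energy (envelope F) \<xi> \<psi>"
  using envelope_quasiconvex_approx field_le_epsilon by blast

end

section \<open>Convexity along rank-one jets and positivity\<close>

text \<open>
  The jet of \<open>\<lambda>x. h (a \<bullet> x) *\<^sub>R v\<close> is a multiple of this one for every function \<open>h\<close> of one
  variable: these are the directions in which jets can oscillate.
\<close>

definition rank_one :: "real ^ 'n::finite \<Rightarrow> 'v::real_normed_vector \<Rightarrow> ('n \<Rightarrow> nat) \<Rightarrow> 'v" where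
  "rank_one a v \<alpha> = (\<Prod>i\<in>UNIV. a $ i ^ \<alpha> i) *\<^sub>R v"

text \<open>
  The test function is \<open>r\<^sup>-\<^sup>k cos (r * (a \<bullet> x) + \<theta>') * \<beta> x *\<^sub>R v\<close>. The phase \<open>\<theta>'\<close> compensates the \<open>k\<close>
  quarter periods by which \<open>k\<close> differentiations shift the cosine; all terms in which \<open>\<beta>\<close> is
  differentiated are smaller by at least a factor \<open>r\<close>.
\<close>

lemma oscillating_tests:
  fixes a :: "real ^ 'n::finite" and v :: "'v::real_normed_vector" and \<beta> :: "real ^ 'n \<Rightarrow> real"
  assumes \<beta>: "smooth \<beta>" "open U" "- box 0 1 \<subseteq> U" "\<And>x. x \<in> U \<Longrightarrow> \<beta> x = 0"
    and \<epsilon>: "\<epsilon> > 0"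
  obtains R where "\<And>r. r \<ge> R \<Longrightarrow> \<exists>\<psi>\<in>cube_tests. \<forall>x\<in>cbox 0 1.
    jet_dist k (jet \<psi> x) (\<lambda>\<alpha>. (\<beta> x * cos (r * (a \<bullet> x) + \<theta>)) *\<^sub>R rank_one a v \<alpha>) \<le> \<epsilon>"
proof -
  define M where "M = (multi_indices k :: ('n \<Rightarrow> nat) set)"
  have finM: "finite M" by (simp add: M_def finite_multi_indices)
  define p where "p x = \<beta> x *\<^sub>R v" for x
  define \<theta>' where "\<theta>' = \<theta> - real k * (pi / 2)"
  have p: "smooth p" unfolding p_def by (intro smooth_scaleR \<beta> smooth_const)
  have "\<exists>P. \<forall>\<alpha>. (\<forall>i. smooth (P \<alpha> i)) \<and> P \<alpha> (length (multi_list \<alpha>)) = (\<lambda>x. prod_list (map (($) a) (multi_list \<alpha>)) *\<^sub>R p x) \<and>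
    (\<forall>r. foldr partial_deriv (multi_list \<alpha>) (\<lambda>x. cos (r * (a \<bullet> x) + \<theta>') *\<^sub>R p x) =
      (\<lambda>x. \<Sum>i\<le>length (multi_list \<alpha>). (r ^ i * cos (r * (a \<bullet> x) + (\<theta>' + real i * (pi / 2)))) *\<^sub>R P \<alpha> i x))"
    by (rule choice) (intro allI foldr_partial_deriv_oscillation p)
  then obtain P where P': "\<forall>\<alpha>. (\<forall>i. smooth (P \<alpha> i)) \<and>
    P \<alpha> (length (multi_list \<alpha>)) = (\<lambda>x. prod_list (map (($) a) (multi_list \<alpha>)) *\<^sub>R p x) \<and>
    (\<forall>r. foldr partial_deriv (multi_list \<alpha>) (\<lambda>x. cos (r * (a \<bullet> x) + \<theta>') *\<^sub>R p x) =
      (\<lambda>x. \<Sum>i\<le>length (multi_list \<alpha>). (r ^ i * cos (r * (a \<bullet> x) + (\<theta>' + real i * (pi / 2)))) *\<^sub>R P \<alpha> i x))"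
    ..
  have P: "\<And>\<alpha> i. smooth (P \<alpha> i)"
    "\<And>\<alpha>. \<alpha> \<in> M \<Longrightarrow> P \<alpha> k = (\<lambda>x. (\<Prod>i\<in>UNIV. a $ i ^ \<alpha> i) *\<^sub>R p x)"
    "\<And>\<alpha> r. \<alpha> \<in> M \<Longrightarrow> multi_deriv \<alpha> (\<lambda>x. cos (r * (a \<bullet> x) + \<theta>') *\<^sub>R p x) =
      (\<lambda>x. \<Sum>i\<le>k. (r ^ i * cos (r * (a \<bullet> x) + (\<theta>' + real i * (pi / 2)))) *\<^sub>R P \<alpha> i x)"
  proof -
    show "smooth (P \<alpha> i)" for \<alpha> i using P' by blast
    fix \<alpha> r assume \<alpha>: "\<alpha> \<in> M"
    then have len: "length (multi_list \<alpha>) = k" by (simp add: M_def length_multi_list)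
    show "P \<alpha> k = (\<lambda>x. (\<Prod>i\<in>UNIV. a $ i ^ \<alpha> i) *\<^sub>R p x)"
      using P'[rule_format, of \<alpha>, THEN conjunct2, THEN conjunct1] unfolding len prod_multi_list .
    show "multi_deriv \<alpha> (\<lambda>x. cos (r * (a \<bullet> x) + \<theta>') *\<^sub>R p x) =
      (\<lambda>x. \<Sum>i\<le>k. (r ^ i * cos (r * (a \<bullet> x) + (\<theta>' + real i * (pi / 2)))) *\<^sub>R P \<alpha> i x)"
      using P'[rule_format, of \<alpha>, THEN conjunct2, THEN conjunct2, rule_format, of r]
      unfolding len multi_deriv_eq .
  qed
  have "\<exists>B. \<forall>x\<in>cbox 0 1. norm (P \<alpha> i x) \<le> B" for \<alpha> i
    using compact_imp_bounded[OF compact_continuous_image[OF smooth_continuous_on[OF P(1)] compact_cbox]]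
    unfolding bounded_iff by blast
  then obtain B where B: "\<And>\<alpha> i x. x \<in> cbox 0 1 \<Longrightarrow> norm (P \<alpha> i x) \<le> B \<alpha> i" by metis
  have B0: "0 \<le> B \<alpha> i" for \<alpha> i
    using order_trans[OF norm_ge_zero B[of 0 \<alpha> i]] by (simp add: mem_box_cart)
  define C where "C = (\<Sum>\<alpha>\<in>M. \<Sum>i<k. B \<alpha> i)"
  have C0: "C \<ge> 0" unfolding C_def using B0 by (intro sum_nonneg)
  show thesis
  proof (rule that[of "max 1 (C / \<epsilon>)"])
    fix r assume r: "max 1 (C / \<epsilon>) \<le> r"
    then have r1: "r \<ge> 1" and rC: "C \<le> r * \<epsilon>" using \<epsilon> by (auto simp: field_simps)
    define \<psi> where "\<psi> x = (1 / r ^ k) *\<^sub>R (cos (r * (a \<bullet> x) + \<theta>') *\<^sub>R p x)" for x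
    show "\<exists>\<psi>\<in>cube_tests. \<forall>x\<in>cbox 0 1.
      jet_dist k (jet \<psi> x) (\<lambda>\<alpha>. (\<beta> x * cos (r * (a \<bullet> x) + \<theta>)) *\<^sub>R rank_one a v \<alpha>) \<le> \<epsilon>"
    proof (rule bexI[of _ \<psi>], rule ballI)
      have sm: "smooth (\<lambda>x. cos (r * (a \<bullet> x) + \<theta>') *\<^sub>R p x)"
        by (intro smooth_scaleR smooth_cos p)
      show "\<psi> \<in> cube_tests"
        by (rule cube_testsI_open[OF _ \<beta>(2,3)])
          (unfold \<psi>_def, rule smooth_scaleR[OF smooth_const sm], simp add: p_def \<beta>(4))
      fix x :: "real ^ 'n" assume x: "x \<in> cbox 0 1"
      have "norm (multi_deriv \<alpha> \<psi> x - (\<beta> x * cos (r * (a \<bullet> x) + \<theta>)) *\<^sub>R rank_one a v \<alpha>) \<le> (\<Sum>i<k. B \<alpha> i) / r"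
        if \<alpha>: "\<alpha> \<in> M" for \<alpha>
      proof -
        define w where "w i = r ^ i * cos (r * (a \<bullet> x) + (\<theta>' + real i * (pi / 2)))" for i
        have "multi_deriv \<alpha> \<psi> x = (1 / r ^ k) *\<^sub>R (\<Sum>i\<le>k. w i *\<^sub>R P \<alpha> i x)"
          unfolding \<psi>_def multi_deriv_scaleR[OF sm] P(3)[OF \<alpha>] w_def ..
        also have "(\<Sum>i\<le>k. w i *\<^sub>R P \<alpha> i x) = w k *\<^sub>R P \<alpha> k x + (\<Sum>i<k. w i *\<^sub>R P \<alpha> i x)"
          by (simp add: lessThan_Suc_atMost[symmetric] add.commute)
        also have "(1 / r ^ k) *\<^sub>R (w k *\<^sub>R P \<alpha> k x + (\<Sum>i<k. w i *\<^sub>R P \<alpha> i x))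
            = (\<beta> x * cos (r * (a \<bullet> x) + \<theta>)) *\<^sub>R rank_one a v \<alpha> + (1 / r ^ k) *\<^sub>R (\<Sum>i<k. w i *\<^sub>R P \<alpha> i x)"
          using r1 by (simp add: scaleR_add_right P(2)[OF \<alpha>] w_def \<theta>'_def p_def rank_one_def mult.commute)
        finally have "norm (multi_deriv \<alpha> \<psi> x - (\<beta> x * cos (r * (a \<bullet> x) + \<theta>)) *\<^sub>R rank_one a v \<alpha>)
            = (1 / r ^ k) * norm (\<Sum>i<k. w i *\<^sub>R P \<alpha> i x)"
          using r1 by simp
        also have "norm (\<Sum>i<k. w i *\<^sub>R P \<alpha> i x) \<le> (\<Sum>i<k. r ^ (k - 1) * B \<alpha> i)"
        proof (rule sum_norm_le)
          fix i assume i: "i \<in> {..<k}"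
          have "\<bar>w i\<bar> \<le> r ^ i"
            using r1 by (simp add: w_def abs_mult mult_left_le)
          also have "\<dots> \<le> r ^ (k - 1)" using i r1 by (intro power_increasing) auto
          finally show "norm (w i *\<^sub>R P \<alpha> i x) \<le> r ^ (k - 1) * B \<alpha> i"
            using B[OF x, of \<alpha> i] r1 by (simp add: mult_mono)
        qed
        also have "(1 / r ^ k) * (\<Sum>i<k. r ^ (k - 1) * B \<alpha> i) = (\<Sum>i<k. B \<alpha> i) / r"
          using r1 by (cases k) (simp_all add: sum_distrib_left[symmetric])
        finally show ?thesis using r1 by (simp add: divide_right_mono)
      qed
      then have "jet_dist k (jet \<psi> x) (\<lambda>\<alpha>. (\<beta> x * cos (r * (a \<bullet> x) + \<theta>)) *\<^sub>R rank_one a v \<alpha>)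
          \<le> (\<Sum>\<alpha>\<in>M. (\<Sum>i<k. B \<alpha> i) / r)"
        unfolding jet_dist_def M_def[symmetric] by (rule sum_mono)
      also have "\<dots> = C / r" by (simp add: C_def sum_divide_distrib)
      also have "\<dots> \<le> \<epsilon>" using rC r1 by (simp add: field_simps)
      finally show "jet_dist k (jet \<psi> x) (\<lambda>\<alpha>. (\<beta> x * cos (r * (a \<bullet> x) + \<theta>)) *\<^sub>R rank_one a v \<alpha>) \<le> \<epsilon>" .
    qed
  qed
qed

context jet_integrand
begin

lemma continuous_envelope_line:
  "continuous_on S f \<Longrightarrow> continuous_on S (\<lambda>x. envelope F (\<lambda>\<alpha>. \<xi> \<alpha> + f x *\<^sub>R \<eta> \<alpha>))"
  by (rule continuous_envelope) (intro continuous_intros)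

lemma envelope_oscillation:
  fixes a :: "real ^ 'n" and v :: 'v and \<beta> :: "real ^ 'n \<Rightarrow> real"
  assumes \<beta>: "smooth \<beta>" "open U" "- box 0 1 \<subseteq> U" "\<And>x. x \<in> U \<Longrightarrow> \<beta> x = 0"
    and \<epsilon>: "\<epsilon> > 0"
  shows "\<exists>R. \<forall>r\<ge>R.
    envelope F \<xi> \<le> integral (cbox 0 1) (\<lambda>x. envelope F (jet_line \<xi> (\<beta> x * cos (r * (a \<bullet> x) + \<theta>)) (rank_one a v))) + \<epsilon>"
proof -
  define \<epsilon>' where "\<epsilon>' = \<epsilon> / (L + 1)"
  have \<epsilon>': "\<epsilon>' > 0" "L * \<epsilon>' \<le> \<epsilon>" using \<epsilon> L by (auto simp: \<epsilon>'_def add_nonneg_pos field_simps)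
  obtain R where R: "\<And>r. r \<ge> R \<Longrightarrow> \<exists>\<psi>\<in>cube_tests. \<forall>x\<in>cbox 0 1.
    jet_dist k (jet \<psi> x) (\<lambda>\<alpha>. (\<beta> x * cos (r * (a \<bullet> x) + \<theta>)) *\<^sub>R rank_one a v \<alpha>) \<le> \<epsilon>'"
    using oscillating_tests[OF \<beta> \<epsilon>'(1)] by metis
  show ?thesis
  proof (intro exI allI impI)
    fix r assume "r \<ge> R"
    then obtain \<psi> where \<psi>: "\<psi> \<in> cube_tests" "\<And>x. x \<in> cbox 0 1 \<Longrightarrow>
      jet_dist k (jet \<psi> x) (\<lambda>\<alpha>. (\<beta> x * cos (r * (a \<bullet> x) + \<theta>)) *\<^sub>R rank_one a v \<alpha>) \<le> \<epsilon>'"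
      using R by blast
    have "envelope F \<xi> \<le> energy (envelope F) \<xi> \<psi>" by (rule envelope_quasiconvex[OF \<psi>(1)])
    also have "\<dots> \<le> integral (cbox 0 1) (\<lambda>x. envelope F (jet_line \<xi> (\<beta> x * cos (r * (a \<bullet> x) + \<theta>)) (rank_one a v))) + \<epsilon>"
      unfolding energy_def
    proof (rule integral_unit_cube_le)
      show "continuous_on (cbox 0 1) (\<lambda>x. envelope F (\<lambda>\<alpha>. \<xi> \<alpha> + multi_deriv \<alpha> \<psi> x))"
        by (intro continuous_envelope continuous_intros continuous_on_multi_deriv cube_tests_smooth \<psi>)
      show "continuous_on (cbox 0 1) (\<lambda>x. envelope F (jet_line \<xi> (\<beta> x * cos (r * (a \<bullet> x) + \<theta>)) (rank_one a v)))"
        by (intro continuous_envelope_line continuous_intros smooth_continuous_on \<beta>)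
      fix x :: "real ^ 'n" assume x: "x \<in> cbox 0 1"
      have "\<bar>envelope F (\<lambda>\<alpha>. \<xi> \<alpha> + multi_deriv \<alpha> \<psi> x)
          - envelope F (jet_line \<xi> (\<beta> x * cos (r * (a \<bullet> x) + \<theta>)) (rank_one a v))\<bar>
        \<le> L * jet_dist k (\<lambda>\<alpha>. \<xi> \<alpha> + multi_deriv \<alpha> \<psi> x)
            (jet_line \<xi> (\<beta> x * cos (r * (a \<bullet> x) + \<theta>)) (rank_one a v))"
        by (rule envelope_lip)
      also have "\<dots> \<le> L * \<epsilon>'" using \<psi>(2)[OF x] L by (intro mult_left_mono) (simp_all add: jet_dist_def)
      finally show "envelope F (\<lambda>\<alpha>. \<xi> \<alpha> + multi_deriv \<alpha> \<psi> x)
        \<le> envelope F (jet_line \<xi> (\<beta> x * cos (r * (a \<bullet> x) + \<theta>)) (rank_one a v)) + \<epsilon>"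
        using \<epsilon>'(2) by linarith
    qed
    finally show "envelope F \<xi> \<le> integral (cbox 0 1) (\<lambda>x. envelope F (jet_line \<xi> (\<beta> x * cos (r * (a \<bullet> x) + \<theta>)) (rank_one a v))) + \<epsilon>" .
  qed
qed

text \<open>
  Let \<open>\<kappa> b\<close> be the amount by which the midpoint inequality fails at distance \<open>b\<close>, and suppose that it is
  positive for all \<open>b\<close> in \<open>{0<..1}\<close>. Averaging the quasiconvexity inequality over an
  oscillation and its negative shows that the integral of \<open>\<kappa> (\<beta> x * cos (r * (a \<bullet> x)))\<close> is
  arbitrarily small for large \<open>r\<close>, and the same holds with the sine. As sine and cosine are never both small, \<open>\<kappa>\<close> of one
  of the two arguments is bounded below on the set where \<open>\<beta>\<close> is not small, which is impossible.
\<close>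

lemma envelope_midpoint:
  fixes a :: "real ^ 'n" and v :: 'v
  shows "\<exists>b\<in>{0<..1}. envelope F \<xi> \<le>
    (envelope F (jet_line \<xi> b (rank_one a v)) + envelope F (\<lambda>\<alpha>. \<xi> \<alpha> - b *\<^sub>R rank_one a v \<alpha>)) / 2"
proof (rule ccontr)
  assume neg: "\<not> ?thesis"
  define f where "f b = envelope F (jet_line \<xi> b (rank_one a v))" for b
  define \<kappa> where "\<kappa> b = f 0 - (f b + f (- b)) / 2" for b
  have fcont: "continuous_on S (\<lambda>x. f (h x))" if "continuous_on S h" for S h
    unfolding f_def using that by (rule continuous_envelope_line)
  have \<kappa>cont: "continuous_on S (\<lambda>x. \<kappa> (h x))" if "continuous_on S h" for S h
    unfolding \<kappa>_def using that by (intro continuous_intros fcont) simp_all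
  have \<kappa>even: "\<kappa> (- b) = \<kappa> b" for b by (simp add: \<kappa>_def)
  have \<kappa>abs: "\<kappa> \<bar>b\<bar> = \<kappa> b" for b using \<kappa>even by (simp add: abs_if)
  have pos: "\<kappa> b > 0" if "0 < b" "b \<le> 1" for b
    using neg that by (auto simp: \<kappa>_def f_def not_le)
  have nonneg: "\<kappa> b \<ge> 0" if "\<bar>b\<bar> \<le> 1" for b
    using pos[of "\<bar>b\<bar>"] that by (cases "b = 0") (simp_all add: \<kappa>abs, simp add: \<kappa>_def)
  obtain \<beta> :: "real ^ 'n \<Rightarrow> real" and U where \<beta>:
    "smooth \<beta>" "\<And>x. 0 \<le> \<beta> x" "\<And>x. \<beta> x \<le> 1" "open U" "- box 0 1 \<subseteq> U"
    "\<And>x. x \<in> U \<Longrightarrow> \<beta> x = 0" "\<beta> (\<chi> i. 1 / 2) > 0"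
    by (rule bump_exists) (assumption | rule that)+
  define \<beta>0 where "\<beta>0 = \<beta> (\<chi> i. 1 / 2) / 2"
  have \<beta>0: "\<beta>0 > 0" "\<beta>0 \<le> 1" using \<beta>(7) \<beta>(3)[of "\<chi> i. 1 / 2"] by (auto simp: \<beta>0_def)
  have "compact {\<beta>0 / 2..1}" "{\<beta>0 / 2..1} \<noteq> {}" using \<beta>0 by auto
  from continuous_attains_inf[OF this, of \<kappa>] \<kappa>cont[OF continuous_on_id]
  obtain b0 where b0: "b0 \<in> {\<beta>0 / 2..1}" "\<And>b. b \<in> {\<beta>0 / 2..1} \<Longrightarrow> \<kappa> b0 \<le> \<kappa> b" by auto
  define \<kappa>0 where "\<kappa>0 = \<kappa> b0"
  have \<kappa>0: "\<kappa>0 > 0" unfolding \<kappa>0_def using b0(1) \<beta>0 by (intro pos) auto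
  have \<kappa>0_le: "\<kappa>0 \<le> \<kappa> b" if "\<beta>0 / 2 \<le> \<bar>b\<bar>" "\<bar>b\<bar> \<le> 1" for b
    using b0(2)[of "\<bar>b\<bar>"] that by (simp add: \<kappa>0_def \<kappa>abs)
  have "open {x. \<beta>0 < \<beta> x}"
    using smooth_continuous_on[OF \<beta>(1)] by (intro open_Collect_less continuous_on_const)
  then have "open {x. \<beta>0 < \<beta> x}" "(\<chi> i. 1 / 2) \<in> {x. \<beta>0 < \<beta> x}" using \<beta>(7) by (auto simp: \<beta>0_def)
  then obtain u w where uw: "(\<chi> i. 1 / 2) \<in> box u w" "cbox u w \<subseteq> {x. \<beta>0 < \<beta> x}"
    using open_contains_cbox by metis
  have uw_sub: "cbox u w \<subseteq> cbox 0 1"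
  proof
    fix x assume "x \<in> cbox u w"
    then have "\<beta> x \<noteq> 0" using uw(2) \<beta>0 by force
    then have "x \<in> box 0 1" using \<beta>(5,6) by blast
    then show "x \<in> cbox 0 1" using box_subset_cbox by blast
  qed
  define s where "s = measure lborel (cbox u w)"
  have s: "s > 0"
    using uw(1) content_pos_lt_eq[of u w] by (auto simp: s_def box_eq_empty box_ne_empty mem_box)
  define \<epsilon> where "\<epsilon> = \<kappa>0 * s / 4"
  have \<epsilon>: "\<epsilon> > 0" using \<kappa>0 s by (simp add: \<epsilon>_def)
  obtain R where R: "\<And>\<theta> \<sigma> r. \<theta> \<in> {0, - (pi / 2)} \<Longrightarrow> \<sigma> \<in> {1, - 1} \<Longrightarrow> r \<ge> R \<Longrightarrow>
    f 0 \<le> integral (cbox 0 1) (\<lambda>x. f (\<sigma> * (\<beta> x * cos (r * (a \<bullet> x) + \<theta>)))) + \<epsilon>"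
  proof -
    have "\<exists>R. \<forall>r\<ge>R. f 0 \<le> integral (cbox 0 1) (\<lambda>x. f (\<sigma> * (\<beta> x * cos (r * (a \<bullet> x) + \<theta>)))) + \<epsilon>" for \<sigma> \<theta>
    proof -
      have eq: "(b *\<^sub>R rank_one a (\<sigma> *\<^sub>R v) \<alpha> :: 'v) = (\<sigma> * b) *\<^sub>R rank_one a v \<alpha>" for b \<alpha>
        by (simp add: rank_one_def mult.commute)
      have "\<exists>R. \<forall>r\<ge>R. envelope F \<xi> \<le> integral (cbox 0 1)
          (\<lambda>x. envelope F (\<lambda>\<alpha>. \<xi> \<alpha> + (\<beta> x * cos (r * (a \<bullet> x) + \<theta>)) *\<^sub>R rank_one a (\<sigma> *\<^sub>R v) \<alpha>)) + \<epsilon>"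
        by (rule envelope_oscillation[OF \<beta>(1,4,5,6) \<epsilon>])
      moreover have "f 0 = envelope F \<xi>" by (simp add: f_def)
      ultimately show ?thesis unfolding eq f_def[symmetric] by auto
    qed
    note ex = this
    let ?P = "\<lambda>\<sigma> \<theta> r. f 0 \<le> integral (cbox 0 1) (\<lambda>x. f (\<sigma> * (\<beta> x * cos (r * (a \<bullet> x) + \<theta>)))) + \<epsilon>"
    obtain R1 where R1: "\<forall>r\<ge>R1. ?P 1 0 r" using ex[of "1" "0"] ..
    obtain R2 where R2: "\<forall>r\<ge>R2. ?P (- 1) 0 r" using ex[of "(- 1)" "0"] ..
    obtain R3 where R3: "\<forall>r\<ge>R3. ?P 1 (- (pi / 2)) r" using ex[of "1" "(- (pi / 2))"] ..
    obtain R4 where R4: "\<forall>r\<ge>R4. ?P (- 1) (- (pi / 2)) r" using ex[of "(- 1)" "(- (pi / 2))"] ..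
    show thesis
    proof (rule that[of "max (max R1 R2) (max R3 R4)"])
      fix \<theta> \<sigma> r :: real
      assume \<theta>: "\<theta> \<in> {0, - (pi / 2)}" and \<sigma>: "\<sigma> \<in> {1, - 1}" and "max (max R1 R2) (max R3 R4) \<le> r"
      then have "?P 1 0 r" "?P (- 1) 0 r" "?P 1 (- (pi / 2)) r" "?P (- 1) (- (pi / 2)) r"
        using R1[rule_format, of r] R2[rule_format, of r] R3[rule_format, of r] R4[rule_format, of r] by linarith+
      then show "?P \<sigma> \<theta> r" using \<theta> \<sigma> by blast
    qed
  qed
  define c where "c \<theta> x = \<beta> x * cos (R * (a \<bullet> x) + \<theta>)" for \<theta> x
  have ccont: "continuous_on S (c \<theta>)" for S \<theta>
    unfolding c_def by (intro continuous_intros smooth_continuous_on \<beta>)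
  have c1: "\<bar>c \<theta> x\<bar> \<le> 1" for \<theta> x
    using \<beta>(2,3)[of x] abs_cos_le_one[of "R * (a \<bullet> x) + \<theta>"] by (simp add: c_def abs_mult mult_le_one)
  have small: "integral (cbox 0 1) (\<lambda>x. \<kappa> (c \<theta> x)) \<le> \<epsilon>" if \<theta>: "\<theta> \<in> {0, - (pi / 2)}" for \<theta>
  proof -
    have i: "(\<lambda>x. f (c \<theta> x)) integrable_on cbox 0 1" "(\<lambda>x. f (- c \<theta> x)) integrable_on cbox 0 1"
      by (intro integrable_continuous fcont ccont continuous_intros)+
    have le: "f 0 \<le> integral (cbox 0 1) (\<lambda>x. f (c \<theta> x)) + \<epsilon>" "f 0 \<le> integral (cbox 0 1) (\<lambda>x. f (- c \<theta> x)) + \<epsilon>"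
      using R[OF \<theta>, of 1 R] R[OF \<theta>, of "- 1" R] by (simp_all add: c_def)
    have "((\<lambda>x. f 0 - (f (c \<theta> x) + f (- c \<theta> x)) / 2) has_integral
      (1 *\<^sub>R f 0 - (integral (cbox 0 1) (\<lambda>x. f (c \<theta> x)) + integral (cbox 0 1) (\<lambda>x. f (- c \<theta> x))) / 2)) (cbox 0 1)"
      using has_integral_const[of "f 0" 0 "1 :: real ^ 'n"] i
      by (intro has_integral_diff has_integral_divide has_integral_add integrable_integral) simp_all
    from integral_unique[OF this] show ?thesis using le unfolding \<kappa>_def by simp argo
  qed
  have "\<kappa>0 * s = integral (cbox u w) (\<lambda>_. \<kappa>0)" by (simp add: s_def)
  also have "\<dots> \<le> integral (cbox u w) (\<lambda>x. \<kappa> (c 0 x) + \<kappa> (c (- (pi / 2)) x))"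
  proof (rule integral_le)
    fix x assume x: "x \<in> cbox u w"
    define t where "t = R * (a \<bullet> x)"
    have "\<beta>0 < \<beta> x" using x uw(2) by blast
    have cs: "c 0 x = \<beta> x * cos t" "c (- (pi / 2)) x = \<beta> x * sin t"
      by (simp_all add: c_def t_def cos_diff)
    have "\<bar>cos t\<bar> \<ge> 1 / 2 \<or> \<bar>sin t\<bar> \<ge> 1 / 2"
    proof (rule ccontr)
      assume "\<not> ?thesis"
      then have "\<bar>cos t\<bar>\<^sup>2 < (1 / 2)\<^sup>2" "\<bar>sin t\<bar>\<^sup>2 < (1 / 2)\<^sup>2"
        by (intro power_strict_mono; simp)+
      then have "(cos t)\<^sup>2 < 1 / 4" "(sin t)\<^sup>2 < 1 / 4" by (simp_all add: power_divide)
      then show False using sin_cos_squared_add[of t] by linarith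
    qed
    then have "\<beta>0 / 2 \<le> \<bar>c 0 x\<bar> \<or> \<beta>0 / 2 \<le> \<bar>c (- (pi / 2)) x\<bar>"
    proof
      assume "\<bar>cos t\<bar> \<ge> 1 / 2"
      then have "\<beta>0 * (1 / 2) \<le> \<beta> x * \<bar>cos t\<bar>" using \<open>\<beta>0 < \<beta> x\<close> \<beta>0 by (intro mult_mono) auto
      then show ?thesis using \<beta>(2)[of x] by (simp add: cs abs_mult)
    next
      assume "\<bar>sin t\<bar> \<ge> 1 / 2"
      then have "\<beta>0 * (1 / 2) \<le> \<beta> x * \<bar>sin t\<bar>" using \<open>\<beta>0 < \<beta> x\<close> \<beta>0 by (intro mult_mono) auto
      then show ?thesis using \<beta>(2)[of x] by (simp add: cs abs_mult)
    qed
    then show "\<kappa>0 \<le> \<kappa> (c 0 x) + \<kappa> (c (- (pi / 2)) x)"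
      using \<kappa>0_le[OF _ c1, of 0 x] \<kappa>0_le[OF _ c1, of "- (pi / 2)" x] nonneg[OF c1, of 0 x] nonneg[OF c1, of "- (pi / 2)" x]
      by linarith
  qed (intro integrable_continuous continuous_on_const continuous_on_add \<kappa>cont ccont)+
  also have "\<dots> \<le> integral (cbox 0 1) (\<lambda>x. \<kappa> (c 0 x) + \<kappa> (c (- (pi / 2)) x))"
  proof (rule integral_subset_le[OF uw_sub])
    show "\<forall>x\<in>cbox 0 1. 0 \<le> \<kappa> (c 0 x) + \<kappa> (c (- (pi / 2)) x)"
      by (intro ballI add_nonneg_nonneg nonneg c1)
  qed (intro integrable_continuous continuous_on_add \<kappa>cont ccont)+
  also have "\<dots> = integral (cbox 0 1) (\<lambda>x. \<kappa> (c 0 x)) + integral (cbox 0 1) (\<lambda>x. \<kappa> (c (- (pi / 2)) x))"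
    by (rule Henstock_Kurzweil_Integration.integral_add) (intro integrable_continuous \<kappa>cont ccont)+
  also have "\<dots> \<le> 2 * \<epsilon>" using small[of 0] small[of "- (pi / 2)"] by simp
  finally show False using \<kappa>0 s by (simp add: \<epsilon>_def)
qed

text \<open>
  Midpoint inequalities at every scale \<open>\<rho>\<close> come from replacing \<open>v\<close> by \<open>\<rho> *\<^sub>R v\<close>.
\<close>

lemma envelope_convex_rank_one:
  fixes a :: "real ^ 'n" and v :: 'v
  shows "convex_on UNIV (\<lambda>r. envelope F (jet_line \<xi> r (rank_one a v)))"
proof (rule convex_on_of_local_midpoint)
  show "continuous_on UNIV (\<lambda>r. envelope F (jet_line \<xi> r (rank_one a v)))"
    by (intro continuous_envelope_line continuous_intros)
  fix x \<rho> :: real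
  show "\<exists>b\<in>{0<..1}. envelope F (jet_line \<xi> x (rank_one a v)) \<le>
    (envelope F (jet_line \<xi> (x + \<rho> * b) (rank_one a v)) +
     envelope F (jet_line \<xi> (x - \<rho> * b) (rank_one a v))) / 2"
  proof -
    have "rank_one a (\<rho> *\<^sub>R v) \<alpha> = \<rho> *\<^sub>R rank_one a v \<alpha>" for \<alpha> :: "'n \<Rightarrow> nat"
      by (simp add: rank_one_def mult.commute)
    then have eq: "\<xi> \<alpha> + x *\<^sub>R rank_one a v \<alpha> + b *\<^sub>R rank_one a (\<rho> *\<^sub>R v) \<alpha> = \<xi> \<alpha> + (x + \<rho> * b) *\<^sub>R rank_one a v \<alpha>"
      "\<xi> \<alpha> + x *\<^sub>R rank_one a v \<alpha> - b *\<^sub>R rank_one a (\<rho> *\<^sub>R v) \<alpha> = \<xi> \<alpha> + (x - \<rho> * b) *\<^sub>R rank_one a v \<alpha>"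
      for b \<alpha>
      by (simp_all add: scaleR_add_left scaleR_diff_left mult.commute)
    show ?thesis
      using envelope_midpoint[of "\<lambda>\<alpha>. \<xi> \<alpha> + x *\<^sub>R rank_one a v \<alpha>" a "\<rho> *\<^sub>R v"] unfolding eq .
  qed
qed

text \<open>
  By \<open>monomials_separate\<close> the jet \<open>\<xi>\<close> is a sum of finitely many rank-one jets. In the coordinates of
  these summands the envelope is convex in each variable, so it is nonnegative by
  \<open>nonneg_of_even_convex\<close>; and it lies below \<open>F\<close>.
\<close>

lemma nonneg_everywhere: "F \<xi> \<ge> 0"
proof -
  define M where "M = (multi_indices k :: ('n \<Rightarrow> nat) set)"
  define N where "N = PiE (UNIV :: 'n set) (\<lambda>_. {..k})"
  have "\<exists>c. \<forall>\<beta>\<in>M. (\<Sum>f\<in>N. c f * (\<Prod>i\<in>UNIV. real (f i) ^ \<beta> i)) = (if \<beta> = \<alpha> then 1 else 0)"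
    if \<alpha>: "\<alpha> \<in> M" for \<alpha>
  proof -
    show ?thesis
      unfolding M_def N_def by (rule monomials_separate[OF \<alpha>[unfolded M_def]]) blast
  qed
  then have "\<exists>c. \<forall>\<alpha>\<in>M. \<forall>\<beta>\<in>M. (\<Sum>f\<in>N. c \<alpha> f * (\<Prod>i\<in>UNIV. real (f i) ^ \<beta> i)) = (if \<beta> = \<alpha> then 1 else 0)"
    by (intro bchoice ballI)
  then obtain c where c: "\<And>\<alpha> \<beta>. \<alpha> \<in> M \<Longrightarrow> \<beta> \<in> M \<Longrightarrow>
      (\<Sum>f\<in>N. c \<alpha> f * (\<Prod>i\<in>UNIV. real (f i) ^ \<beta> i)) = (if \<beta> = \<alpha> then 1 else 0)" by blast
  define J where "J = M \<times> N"
  have fin: "finite M" "finite N" "finite J"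
    by (auto simp: J_def M_def N_def finite_multi_indices intro!: finite_PiE)
  define dir where "dir j = rank_one (\<chi> i. real (snd j i)) (c (fst j) (snd j) *\<^sub>R \<xi> (fst j))" for j
  define g where "g t = envelope F (\<lambda>\<beta>. \<Sum>j\<in>J. t j *\<^sub>R dir j \<beta>)" for t
  define K where "K = L * (\<Sum>j\<in>J. \<Sum>\<beta>\<in>M. norm (dir j \<beta>))"
  have "g (\<lambda>_. 1) \<ge> 0"
  proof (rule nonneg_of_even_convex[OF fin(3), of g K])
    show "g (\<lambda>j. r * t j) = r * g t" if "r > 0" for r t
      using envelope_hom[OF that, of "\<lambda>\<beta>. \<Sum>j\<in>J. t j *\<^sub>R dir j \<beta>"] by (simp add: g_def scaleR_sum_right)
    show "g (\<lambda>j. - t j) = g t" for t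
      using envelope_even[of "\<lambda>\<beta>. \<Sum>j\<in>J. t j *\<^sub>R dir j \<beta>"] by (simp add: g_def sum_negf)
    show "\<bar>g s - g t\<bar> \<le> K * (\<Sum>j\<in>J. \<bar>s j - t j\<bar>)" for s t
    proof -
      have "\<bar>g s - g t\<bar> \<le> L * jet_dist k (\<lambda>\<beta>. \<Sum>j\<in>J. s j *\<^sub>R dir j \<beta>) (\<lambda>\<beta>. \<Sum>j\<in>J. t j *\<^sub>R dir j \<beta>)"
        unfolding g_def by (rule envelope_lip)
      also have "jet_dist k (\<lambda>\<beta>. \<Sum>j\<in>J. s j *\<^sub>R dir j \<beta>) (\<lambda>\<beta>. \<Sum>j\<in>J. t j *\<^sub>R dir j \<beta>)
          = (\<Sum>\<beta>\<in>M. norm (\<Sum>j\<in>J. (s j - t j) *\<^sub>R dir j \<beta>))"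
        by (simp add: jet_dist_def M_def scaleR_diff_left sum_subtractf)
      also have "\<dots> \<le> (\<Sum>\<beta>\<in>M. \<Sum>j\<in>J. \<bar>s j - t j\<bar> * norm (dir j \<beta>))"
        by (intro sum_mono sum_norm_le) simp
      also have "\<dots> = (\<Sum>j\<in>J. \<bar>s j - t j\<bar> * (\<Sum>\<beta>\<in>M. norm (dir j \<beta>)))"
        by (subst sum.swap) (simp add: sum_distrib_left)
      also have "\<dots> \<le> (\<Sum>j\<in>J. \<bar>s j - t j\<bar> * (\<Sum>j\<in>J. \<Sum>\<beta>\<in>M. norm (dir j \<beta>)))"
        using fin by (intro sum_mono mult_left_mono member_le_sum[of _ J "\<lambda>j. \<Sum>\<beta>\<in>M. norm (dir j \<beta>)"]) (auto intro: sum_nonneg)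
      also have "L * \<dots> = K * (\<Sum>j\<in>J. \<bar>s j - t j\<bar>)"
        by (simp add: K_def sum_distrib_right[symmetric] mult.commute mult.left_commute)
      finally show ?thesis using L by (simp add: mult_left_mono)
    qed
    show "convex_on UNIV (\<lambda>r. g (t(j := r)))" if j: "j \<in> J" for j t
    proof -
      have "g (t(j := r)) = envelope F (\<lambda>\<beta>. (\<Sum>i\<in>J - {j}. t i *\<^sub>R dir i \<beta>) + r *\<^sub>R dir j \<beta>)" for r
      proof -
        have "(\<Sum>i\<in>J. (t(j := r)) i *\<^sub>R dir i \<beta>) = (\<Sum>i\<in>J - {j}. t i *\<^sub>R dir i \<beta>) + r *\<^sub>R dir j \<beta>" for \<beta>
        proof -
          have "(\<Sum>i\<in>J - {j}. (t(j := r)) i *\<^sub>R dir i \<beta>) = (\<Sum>i\<in>J - {j}. t i *\<^sub>R dir i \<beta>)"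
            by (rule sum.cong) auto
          then show ?thesis
            using sum.remove[OF fin(3) j, of "\<lambda>i. (t(j := r)) i *\<^sub>R dir i \<beta>"] by simp
        qed
        then show ?thesis by (simp only: g_def)
      qed
      then show ?thesis using envelope_convex_rank_one by (simp add: dir_def)
    qed
  qed
  also have "g (\<lambda>_. 1) = envelope F \<xi>"
  proof -
    have "(\<Sum>j\<in>J. dir j \<beta>) = \<xi> \<beta>" if \<beta>: "\<beta> \<in> M" for \<beta>
    proof -
      have "(\<Sum>j\<in>J. dir j \<beta>) = (\<Sum>\<alpha>\<in>M. \<Sum>f\<in>N. (c \<alpha> f * (\<Prod>i\<in>UNIV. real (f i) ^ \<beta> i)) *\<^sub>R \<xi> \<alpha>)"
        by (simp add: J_def sum.cartesian_product dir_def rank_one_def case_prod_unfold mult.commute)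
      also have "\<dots> = (\<Sum>\<alpha>\<in>M. (if \<beta> = \<alpha> then 1 else 0) *\<^sub>R \<xi> \<alpha>)"
        by (intro sum.cong refl) (simp add: c \<beta> flip: scaleR_sum_left)
      also have "\<dots> = \<xi> \<beta>"
        using fin(1) \<beta> by (simp add: if_distrib[of "\<lambda>x. x *\<^sub>R _"] cong: if_cong)
      finally show ?thesis .
    qed
    then have "jet_dist k (\<lambda>\<beta>. \<Sum>j\<in>J. dir j \<beta>) \<xi> = 0" by (simp add: jet_dist_def M_def)
    then show ?thesis using envelope_lip[of "\<lambda>\<beta>. \<Sum>j\<in>J. dir j \<beta>" \<xi>] by (simp add: g_def)
  qed
  also have "envelope F \<xi> \<le> F \<xi>" by (rule envelope_le_self)
  finally show ?thesis .
qed

end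

section \<open>Measurability in finite dimensional spaces\<close>

text \<open>
  The reconstruction property of orthonormal bases. It provides coordinates on types that are finite
  dimensional without being of class \<open>euclidean_space\<close>, such as the zero space.
\<close>

definition parseval_frame :: "'w::real_inner set \<Rightarrow> bool" where
  "parseval_frame B \<longleftrightarrow> finite B \<and> (\<forall>w. (\<Sum>b\<in>B. (w \<bullet> b) *\<^sub>R b) = w)"

lemma parseval_frame_finite: "parseval_frame B \<Longrightarrow> finite B"
  by (simp add: parseval_frame_def)

lemma parseval_frame_expand: "parseval_frame B \<Longrightarrow> (\<Sum>b\<in>B. (w \<bullet> b) *\<^sub>R b) = w"
  by (simp add: parseval_frame_def)

text \<open>
  Normalise an orthogonal spanning set, zero removed. The difference of the two sides is orthogonal to
  all of it, hence to itself.
\<close>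

lemma exists_parseval_frame:
  assumes "finite_dimensional TYPE('w::real_inner)"
  shows "\<exists>B :: 'w::real_inner set. parseval_frame B"
proof -
  obtain B0 :: "'w set" where B0: "finite B0" "span B0 = UNIV"
    using assms unfolding finite_dimensional_def by blast
  obtain C :: "'w set" where C: "finite C" "span C = UNIV" "pairwise orthogonal C"
    using basis_orthogonal[OF B0(1)] B0(2) by metis
  define B where "B = sgn ` (C - {0})"
  have fin: "finite B" using C(1) by (simp add: B_def)
  have unit: "norm b = 1" if "b \<in> B" for b
    using that by (auto simp: B_def norm_sgn split: if_splits)
  have orth: "b \<bullet> b' = 0" if bb': "b \<in> B" "b' \<in> B" "b \<noteq> b'" for b b'
  proof -
    obtain x y where xy: "x \<in> C" "y \<in> C" "b = sgn x" "b' = sgn y" using bb' by (auto simp: B_def)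
    then have "x \<noteq> y" using bb' by auto
    then have "x \<bullet> y = 0" using C(3) xy by (auto simp: pairwise_def orthogonal_def)
    then show ?thesis by (simp add: xy sgn_div_norm)
  qed
  have "(\<Sum>b\<in>B. (w \<bullet> b) *\<^sub>R b) = w" for w
  proof -
    define v where "v = w - (\<Sum>b\<in>B. (w \<bullet> b) *\<^sub>R b)"
    have vb: "v \<bullet> b = 0" if b: "b \<in> B" for b
    proof -
      have "(\<Sum>b'\<in>B. (w \<bullet> b') * (b' \<bullet> b)) = (\<Sum>b'\<in>B. if b' = b then w \<bullet> b else 0)"
        using orth unit[OF b] b by (intro sum.cong) (auto simp: dot_square_norm)
      then show ?thesis using fin b by (simp add: v_def inner_diff_left inner_sum_left)
    qed
    have "v \<bullet> x = 0" if "x \<in> C" for x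
    proof (cases "x = 0")
      case False
      then have "v \<bullet> sgn x = 0" using that by (intro vb) (auto simp: B_def)
      then show ?thesis using False by (simp add: sgn_div_norm)
    qed simp
    then have "orthogonal v v" using C(2)
      by (intro orthogonal_to_span[of v C]) (auto simp: orthogonal_def)
    then show ?thesis by (simp add: v_def orthogonal_def)
  qed
  with fin have "parseval_frame B" by (simp add: parseval_frame_def)
  then show ?thesis ..
qed

text \<open>
  Since the spaces are finite dimensional only by hypothesis, their types are not of class
  \<open>second_countable_topology\<close>, and sums and inner products of measurable functions are handled through
  scalar components.
\<close>

definition weakly_measurable :: "'a measure \<Rightarrow> ('a \<Rightarrow> 'w::real_inner) \<Rightarrow> bool" where
  "weakly_measurable M g \<longleftrightarrow> (\<forall>e. (\<lambda>x. g x \<bullet> e) \<in> borel_measurable M)"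

lemma weakly_measurableD: "weakly_measurable M g \<Longrightarrow> (\<lambda>x. g x \<bullet> e) \<in> borel_measurable M"
  by (simp add: weakly_measurable_def)

lemma weakly_measurable_const: "weakly_measurable M (\<lambda>_. w)"
  by (simp add: weakly_measurable_def)

lemma weakly_measurable_scaleR:
  "r \<in> borel_measurable M \<Longrightarrow> weakly_measurable M g \<Longrightarrow> weakly_measurable M (\<lambda>x. r x *\<^sub>R g x)"
  unfolding weakly_measurable_def inner_scaleR_left by (intro allI borel_measurable_times) blast+

lemma weakly_measurable_sum:
  "(\<And>i. i \<in> I \<Longrightarrow> weakly_measurable M (f i)) \<Longrightarrow> weakly_measurable M (\<lambda>x. \<Sum>i\<in>I. f i x)"
  unfolding weakly_measurable_def inner_sum_left by (intro allI borel_measurable_sum) blast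

lemma weakly_measurable_inner:
  assumes fd: "finite_dimensional TYPE('w::real_inner)"
    and f: "weakly_measurable M f" and g: "weakly_measurable M (g :: _ \<Rightarrow> 'w::real_inner)"
  shows "(\<lambda>x. f x \<bullet> g x) \<in> borel_measurable M"
proof -
  obtain B :: "'w set" where "parseval_frame B"
    using exists_parseval_frame[OF fd] ..
  note B = parseval_frame_expand[OF this]
  have "f x \<bullet> g x = (\<Sum>b\<in>B. (f x \<bullet> b) * (g x \<bullet> b))" for x
  proof -
    have "(\<Sum>b\<in>B. (f x \<bullet> b) *\<^sub>R b) \<bullet> g x = (\<Sum>b\<in>B. (f x \<bullet> b) * (g x \<bullet> b))"
      by (simp add: inner_sum_left inner_commute[of "g x"])
    then show ?thesis unfolding B .
  qed
  then show ?thesis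
    by (simp only:) (intro borel_measurable_sum borel_measurable_times weakly_measurableD f g)
qed

lemma weakly_measurable_norm:
  assumes "finite_dimensional TYPE('w::real_inner)" "weakly_measurable M (g :: _ \<Rightarrow> 'w::real_inner)"
  shows "(\<lambda>x. norm (g x)) \<in> borel_measurable M"
proof -
  have [measurable]: "(\<lambda>x. g x \<bullet> g x) \<in> borel_measurable M"
    by (rule weakly_measurable_inner[OF assms(1,2,2)])
  show ?thesis unfolding norm_eq_sqrt_inner by measurable
qed

text \<open>
  The sum factors through the second countable space of real sequences, on which it is continuous in the
  coefficients.
\<close>

lemma borel_measurable_sum_scaleR:
  fixes e :: "'i \<Rightarrow> 'b::real_normed_vector"
  assumes fin: "finite I" and c: "\<And>i. i \<in> I \<Longrightarrow> c i \<in> borel_measurable M"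
  shows "(\<lambda>x. \<Sum>i\<in>I. c i x *\<^sub>R e i) \<in> borel_measurable M"
proof -
  obtain h where h: "bij_betw h {0..<card I} I" using ex_bij_betw_nat_finite[OF fin] by blast
  define T where "T u = (\<Sum>j\<in>{0..<card I}. u j *\<^sub>R e (h j))" for u :: "nat \<Rightarrow> real"
  define C where "C x j = (if j < card I then c (h j) x else 0)" for x j
  have "C \<in> borel_measurable M"
  proof (rule measurable_coordinatewise_then_product)
    fix j
    show "(\<lambda>x. C x j) \<in> borel_measurable M"
      using c bij_betwE[OF h] by (cases "j < card I") (auto simp: C_def)
  qed
  moreover have "T \<in> borel_measurable borel"
    unfolding T_def
    by (intro borel_measurable_continuous_onI continuous_intros continuous_on_product_coordinates)
  ultimately have "(\<lambda>x. T (C x)) \<in> borel_measurable M" by (rule measurable_compose)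
  also have "(\<lambda>x. T (C x)) = (\<lambda>x. \<Sum>i\<in>I. c i x *\<^sub>R e i)"
  proof
    fix x
    show "T (C x) = (\<Sum>i\<in>I. c i x *\<^sub>R e i)"
      using sum.reindex_bij_betw[OF h, of "\<lambda>i. c i x *\<^sub>R e i"] by (simp add: T_def C_def)
  qed
  finally show ?thesis .
qed

text \<open>
  The argument is expanded in a Parseval frame, which leaves operators applied to fixed
  vectors.
\<close>

lemma weakly_measurable_blinfun_apply:
  assumes fd: "finite_dimensional TYPE('v::real_inner)"
    and a: "(a :: 'a \<Rightarrow> 'v::real_inner \<Rightarrow>\<^sub>L 'w::real_inner) \<in> borel_measurable N"
    and X: "X \<in> measurable M N" and g: "weakly_measurable M g"
  shows "weakly_measurable M (\<lambda>z. blinfun_apply (a (X z)) (g z))"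
proof -
  obtain B :: "'v set" where "parseval_frame B"
    using exists_parseval_frame[OF fd] ..
  note B = parseval_frame_expand[OF this]
  have "blinfun_apply A v = (\<Sum>b\<in>B. (v \<bullet> b) *\<^sub>R blinfun_apply A b)" for A :: "'v \<Rightarrow>\<^sub>L 'w" and v
  proof -
    have "blinfun_apply A (\<Sum>b\<in>B. (v \<bullet> b) *\<^sub>R b) = (\<Sum>b\<in>B. (v \<bullet> b) *\<^sub>R blinfun_apply A b)"
      by (simp add: blinfun.sum_right blinfun.scaleR_right)
    then show ?thesis unfolding B .
  qed
  then have eq: "(\<lambda>z. blinfun_apply (a (X z)) (g z)) = (\<lambda>z. \<Sum>b\<in>B. (g z \<bullet> b) *\<^sub>R blinfun_apply (a (X z)) b)"
    by (rule ext)
  have "weakly_measurable M (\<lambda>z. blinfun_apply (a (X z)) b)" for b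
    unfolding weakly_measurable_def
  proof
    fix e
    have "(\<lambda>A :: 'v \<Rightarrow>\<^sub>L 'w. blinfun_apply A b \<bullet> e) \<in> borel_measurable borel"
      by (intro borel_measurable_continuous_onI continuous_intros)
    from measurable_compose[OF measurable_compose[OF X a] this]
    show "(\<lambda>z. blinfun_apply (a (X z)) b \<bullet> e) \<in> borel_measurable M" .
  qed
  then show ?thesis unfolding eq
    by (intro weakly_measurable_sum weakly_measurable_scaleR weakly_measurableD[OF g])
qed

lemma weakly_measurable_continuous:
  assumes "continuous_on UNIV f" "T \<in> borel_measurable M"
  shows "weakly_measurable M (\<lambda>z. f (T z))"
  unfolding weakly_measurable_def
proof
  fix e
  have "(\<lambda>y. f y \<bullet> e) \<in> borel_measurable borel"
    by (intro borel_measurable_continuous_onI continuous_intros assms)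
  from measurable_compose[OF assms(2) this] show "(\<lambda>z. f (T z) \<bullet> e) \<in> borel_measurable M" .
qed

lemma sigma_finite_lebesgue: "sigma_finite_measure (lebesgue :: 'a::euclidean_space measure)"
proof
  show "\<exists>A. countable A \<and> A \<subseteq> sets (lebesgue :: 'a measure) \<and> \<Union> A = space lebesgue \<and> (\<forall>a\<in>A. emeasure lebesgue a \<noteq> \<infinity>)"
  proof (intro exI conjI ballI)
    show "countable (range (\<lambda>n :: nat. cball (0 :: 'a) n))" by simp
    show "range (\<lambda>n :: nat. cball (0 :: 'a) n) \<subseteq> sets lebesgue" by auto
    have "x \<in> \<Union> (range (\<lambda>n :: nat. cball (0 :: 'a) n))" for x
      using real_arch_simple[of "norm x"] by auto
    then show "\<Union> (range (\<lambda>n :: nat. cball (0 :: 'a) n)) = space lebesgue" by auto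
    show "emeasure lebesgue a \<noteq> \<infinity>" if "a \<in> range (\<lambda>n :: nat. cball (0 :: 'a) n)" for a
      using that emeasure_bounded_finite[of a] by auto
  qed
qed

lemma exists_rational_sequence:
  fixes t :: real
  obtains q where "\<And>m. q m \<in> \<rat>" "q \<longlonglongrightarrow> t"
proof -
  have ex: "\<exists>q. q \<in> \<rat> \<and> t < q \<and> q < t + inverse (real (Suc m))" for m
    using Rats_dense_in_real[of t "t + inverse (real (Suc m))"] by auto
  define q where "q m = (SOME q. q \<in> \<rat> \<and> t < q \<and> q < t + inverse (real (Suc m)))" for m
  have q: "q m \<in> \<rat>" "t < q m" "q m < t + inverse (real (Suc m))" for m
    using someI_ex[OF ex[of m]] by (simp_all add: q_def)
  have "(\<lambda>m. t + inverse (real (Suc m))) \<longlonglongrightarrow> t + 0"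
    by (intro tendsto_intros LIMSEQ_inverse_real_of_nat)
  then have "q \<longlonglongrightarrow> t"
    by (intro tendsto_sandwich[of "\<lambda>_. t" q _ "\<lambda>m. t + inverse (real (Suc m))"] always_eventually allI
        less_imp_le[OF q(2)] less_imp_le[OF q(3)] tendsto_const) simp
  then show thesis by (rule that[OF q(1)])
qed

section \<open>Weighted seminorms of an operator\<close>

text \<open>
  The operator with its derivatives replaced by the entries of a jet. Passing from functions to jets
  separates the dependence on \<open>x\<close> from that on the test function.
\<close>

definition symbol_op :: "nat \<Rightarrow> (('n::finite \<Rightarrow> nat) \<Rightarrow> real ^ 'n \<Rightarrow> 'v::real_normed_vector \<Rightarrow>\<^sub>L 'w::real_normed_vector)
    \<Rightarrow> real ^ 'n \<Rightarrow> (('n \<Rightarrow> nat) \<Rightarrow> 'v) \<Rightarrow> 'w" where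
  "symbol_op k a x \<xi> = (\<Sum>\<alpha>\<in>multi_indices k. blinfun_apply (a \<alpha> x) (\<xi> \<alpha>))"

lemma diff_op_eq: "diff_op k a \<phi> x = symbol_op k a x (jet \<phi> x)"
  by (simp add: diff_op_def symbol_op_def)

lemma symbol_op_scaleR: "symbol_op k a x (\<lambda>\<alpha>. r *\<^sub>R \<xi> \<alpha>) = r *\<^sub>R symbol_op k a x \<xi>"
  by (simp add: symbol_op_def blinfun.scaleR_right scaleR_sum_right)

lemma symbol_op_diff: "symbol_op k a x \<xi> - symbol_op k a x \<eta> = symbol_op k a x (\<lambda>\<alpha>. \<xi> \<alpha> - \<eta> \<alpha>)"
  by (simp add: symbol_op_def blinfun.diff_right sum_subtractf)

lemma symbol_op_uminus: "symbol_op k a x (\<lambda>\<alpha>. - \<xi> \<alpha>) = - symbol_op k a x \<xi>"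
  by (simp add: symbol_op_def blinfun.minus_right sum_negf)

lemma symbol_op_cong: "(\<And>\<alpha>. \<alpha> \<in> multi_indices k \<Longrightarrow> \<xi> \<alpha> = \<eta> \<alpha>) \<Longrightarrow> symbol_op k a x \<xi> = symbol_op k a x \<eta>"
  by (simp add: symbol_op_def)

lemma norm_symbol_op_le: "norm (symbol_op k a x \<xi>) \<le> (\<Sum>\<alpha>\<in>multi_indices k. norm (a \<alpha> x) * norm (\<xi> \<alpha>))"
  unfolding symbol_op_def by (intro sum_norm_le norm_blinfun)

definition weight :: "('a::euclidean_space \<Rightarrow> real) \<Rightarrow> bool" where
  "weight w \<longleftrightarrow> continuous_on UNIV w \<and> (\<forall>x. 0 \<le> w x) \<and> (\<exists>K. compact K \<and> (\<forall>x. x \<notin> K \<longrightarrow> w x = 0))"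

lemma weight_bounded:
  assumes "weight w"
  shows "\<exists>W\<ge>0. \<forall>x. w x \<le> W"
proof -
  obtain K where K: "continuous_on UNIV w" "\<forall>x. 0 \<le> w x" "compact K" "\<forall>x. x \<notin> K \<longrightarrow> w x = 0"
    using assms unfolding weight_def by blast
  have "bounded (w ` K)"
    using K by (intro compact_imp_bounded compact_continuous_image continuous_on_subset[OF K(1)]) auto
  then obtain W where W: "\<forall>y\<in>w ` K. norm y \<le> W" unfolding bounded_iff by blast
  have "w x \<le> max 0 W" for x
    using W K(4) by (cases "x \<in> K") force+
  then show ?thesis by (intro exI[of _ "max 0 W"]) simp
qed

locale coefficients =
  fixes k :: nat and a :: "('n::finite \<Rightarrow> nat) \<Rightarrow> real ^ 'n \<Rightarrow> 'v::real_inner \<Rightarrow>\<^sub>L 'w::real_inner"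
  assumes fdv: "finite_dimensional TYPE('v)" and fdw: "finite_dimensional TYPE('w)"
    and loc: "\<And>\<alpha>. \<alpha> \<in> multi_indices k \<Longrightarrow> a \<alpha> \<in> L1_loc"
begin

lemma coeff_measurable: "\<alpha> \<in> multi_indices k \<Longrightarrow> a \<alpha> \<in> borel_measurable lebesgue"
  using loc by (auto simp: L1_loc_def)

lemma symbol_op_measurable:
  assumes X: "X \<in> measurable M lebesgue"
    and \<Xi>: "\<And>\<alpha>. \<alpha> \<in> multi_indices k \<Longrightarrow> weakly_measurable M (\<Xi> \<alpha>)"
  shows "(\<lambda>z. norm (symbol_op k a (X z) (\<lambda>\<alpha>. \<Xi> \<alpha> z))) \<in> borel_measurable M"
  unfolding symbol_op_def
  by (intro weakly_measurable_norm fdw weakly_measurable_sum weakly_measurable_blinfun_apply[OF fdv coeff_measurable X] \<Xi>)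

lemma symbol_op_measurable_const: "(\<lambda>x. norm (symbol_op k a x \<xi>)) \<in> borel_measurable lebesgue"
  using symbol_op_measurable[of "\<lambda>x. x" lebesgue "\<lambda>\<alpha> _. \<xi> \<alpha>"] by (simp add: weakly_measurable_const)

definition coeff_norm :: "real ^ 'n \<Rightarrow> real" where
  "coeff_norm x = (\<Sum>\<alpha>\<in>multi_indices k. norm (a \<alpha> x))"

lemma coeff_norm_nonneg: "coeff_norm x \<ge> 0"
  by (simp add: coeff_norm_def sum_nonneg)

lemma norm_symbol_op_le_coeff_norm:
  assumes "\<And>\<alpha>. \<alpha> \<in> multi_indices k \<Longrightarrow> norm (\<xi> \<alpha>) \<le> P"
  shows "norm (symbol_op k a x \<xi>) \<le> coeff_norm x * P"
proof -
  have "norm (symbol_op k a x \<xi>) \<le> (\<Sum>\<alpha>\<in>multi_indices k. norm (a \<alpha> x) * P)"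
    using assms by (intro order_trans[OF norm_symbol_op_le] sum_mono mult_left_mono) auto
  then show ?thesis by (simp add: coeff_norm_def sum_distrib_right)
qed

lemma coeff_norm_measurable: "coeff_norm \<in> borel_measurable lebesgue"
  unfolding coeff_norm_def[abs_def]
  by (intro borel_measurable_sum measurable_compose[OF coeff_measurable borel_measurable_norm])

lemma coeff_norm_integrable:
  assumes K: "compact K"
  shows "integrable lebesgue (\<lambda>x. indicator K x * coeff_norm x)"
proof -
  have "integrable lebesgue (\<lambda>x. indicator K x * norm (a \<alpha> x))" if "\<alpha> \<in> multi_indices k" for \<alpha>
    using loc[OF that] K by (auto simp: L1_loc_def set_integrable_def)
  then show ?thesis unfolding coeff_norm_def sum_distrib_left by (rule Bochner_Integration.integrable_sum)
qed

definition weighted_norm :: "(real ^ 'n \<Rightarrow> real) \<Rightarrow> (('n \<Rightarrow> nat) \<Rightarrow> 'v) \<Rightarrow> real" where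
  "weighted_norm w \<xi> = (\<integral>x. w x * norm (symbol_op k a x \<xi>) \<partial>lebesgue)"

lemma weight_measurable: "weight w \<Longrightarrow> w \<in> borel_measurable lebesgue" for w :: "real ^ 'n \<Rightarrow> real"
proof -
  assume "weight w"
  then have "w \<in> borel_measurable borel"
    unfolding weight_def by (blast intro: borel_measurable_continuous_onI)
  then have "w \<in> borel_measurable lborel" by simp
  then show ?thesis by (rule measurable_completion)
qed

lemma weighted_coeff_norm_integrable:
  assumes w: "weight w"
  shows "integrable lebesgue (\<lambda>x. w x * coeff_norm x)"
proof -
  obtain W where W: "W \<ge> 0" "\<And>x. w x \<le> W" using weight_bounded[OF w] by blast
  obtain K where K: "\<forall>x. 0 \<le> w x" "compact K" "\<forall>x. x \<notin> K \<longrightarrow> w x = 0"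
    using w unfolding weight_def by blast
  have "integrable lebesgue (\<lambda>x. W * (indicator K x * coeff_norm x))"
    by (intro Bochner_Integration.integrable_mult_right coeff_norm_integrable K)
  then show ?thesis
  proof (rule Bochner_Integration.integrable_bound)
    show "(\<lambda>x. w x * coeff_norm x) \<in> borel_measurable lebesgue"
      by (intro borel_measurable_times weight_measurable w coeff_norm_measurable)
    have "norm (w x * coeff_norm x) \<le> norm (W * (indicator K x * coeff_norm x))" for x
      using W K coeff_norm_nonneg[of x] by (cases "x \<in> K") (auto simp: abs_mult intro: mult_right_mono)
    then show "AE x in lebesgue. norm (w x * coeff_norm x) \<le> norm (W * (indicator K x * coeff_norm x))" by simp
  qed
qed

lemma weighted_integrable:
  assumes w: "weight w"
  shows "integrable lebesgue (\<lambda>x. w x * norm (symbol_op k a x \<xi>))"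
proof -
  define P where "P = (\<Sum>\<alpha>\<in>multi_indices k. norm (\<xi> \<alpha>))"
  have P: "norm (\<xi> \<alpha>) \<le> P" if "\<alpha> \<in> multi_indices k" for \<alpha>
    unfolding P_def using that by (intro member_le_sum[of \<alpha> _ "\<lambda>\<alpha>. norm (\<xi> \<alpha>)"] finite_multi_indices) auto
  have P0: "P \<ge> 0" by (simp add: P_def sum_nonneg)
  have w0: "0 \<le> w x" for x using w by (simp add: weight_def)
  have "integrable lebesgue (\<lambda>x. P * (w x * coeff_norm x))"
    by (intro Bochner_Integration.integrable_mult_right weighted_coeff_norm_integrable w)
  then show ?thesis
  proof (rule Bochner_Integration.integrable_bound)
    show "(\<lambda>x. w x * norm (symbol_op k a x \<xi>)) \<in> borel_measurable lebesgue"
      by (intro borel_measurable_times weight_measurable w symbol_op_measurable_const)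
    have "norm (w x * norm (symbol_op k a x \<xi>)) \<le> norm (P * (w x * coeff_norm x))" for x
    proof -
      have "w x * norm (symbol_op k a x \<xi>) \<le> w x * (coeff_norm x * P)"
        by (intro mult_left_mono norm_symbol_op_le_coeff_norm P w0)
      then show ?thesis using w0[of x] coeff_norm_nonneg[of x] P0 by (simp add: abs_mult mult_ac)
    qed
    then show "AE x in lebesgue. norm (w x * norm (symbol_op k a x \<xi>)) \<le> norm (P * (w x * coeff_norm x))" by simp
  qed
qed

lemma weighted_norm_lip:
  assumes w: "weight w"
  shows "\<bar>weighted_norm w \<xi> - weighted_norm w \<eta>\<bar> \<le> (\<integral>x. w x * coeff_norm x \<partial>lebesgue) * jet_dist k \<xi> \<eta>"
proof -
  have w0: "0 \<le> w x" for x using w by (simp add: weight_def)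
  have le: "weighted_norm w \<xi> - weighted_norm w \<eta> \<le> (\<integral>x. w x * coeff_norm x \<partial>lebesgue) * jet_dist k \<xi> \<eta>" for \<xi> \<eta>
  proof -
    have d: "norm (\<xi> \<alpha> - \<eta> \<alpha>) \<le> jet_dist k \<xi> \<eta>" if "\<alpha> \<in> multi_indices k" for \<alpha>
      unfolding jet_dist_def using that
      by (intro member_le_sum[of \<alpha> _ "\<lambda>\<alpha>. norm (\<xi> \<alpha> - \<eta> \<alpha>)"] finite_multi_indices) auto
    have "weighted_norm w \<xi> - weighted_norm w \<eta>
        = (\<integral>x. w x * norm (symbol_op k a x \<xi>) - w x * norm (symbol_op k a x \<eta>) \<partial>lebesgue)"
      unfolding weighted_norm_def
      by (rule Bochner_Integration.integral_diff[symmetric]) (intro weighted_integrable w)+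
    also have "\<dots> \<le> (\<integral>x. w x * coeff_norm x * jet_dist k \<xi> \<eta> \<partial>lebesgue)"
    proof (rule Bochner_Integration.integral_mono)
      fix x
      have "norm (symbol_op k a x \<xi>) - norm (symbol_op k a x \<eta>) \<le> norm (symbol_op k a x \<xi> - symbol_op k a x \<eta>)"
        by (rule norm_triangle_ineq2)
      also have "\<dots> \<le> coeff_norm x * jet_dist k \<xi> \<eta>"
        unfolding symbol_op_diff by (intro norm_symbol_op_le_coeff_norm d)
      finally have "w x * (norm (symbol_op k a x \<xi>) - norm (symbol_op k a x \<eta>)) \<le> w x * (coeff_norm x * jet_dist k \<xi> \<eta>)"
        by (intro mult_left_mono w0)
      then show "w x * norm (symbol_op k a x \<xi>) - w x * norm (symbol_op k a x \<eta>) \<le> w x * coeff_norm x * jet_dist k \<xi> \<eta>"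
        by (simp add: right_diff_distrib mult.assoc)
    qed (intro Bochner_Integration.integrable_diff Bochner_Integration.integrable_mult_left weighted_coeff_norm_integrable weighted_integrable w)+
    also have "\<dots> = (\<integral>x. w x * coeff_norm x \<partial>lebesgue) * jet_dist k \<xi> \<eta>"
      by (rule Bochner_Integration.integral_mult_left) (intro weighted_coeff_norm_integrable w)
    finally show ?thesis .
  qed
  have "jet_dist k \<eta> \<xi> = jet_dist k \<xi> \<eta>" by (simp add: jet_dist_def norm_minus_commute)
  then show ?thesis using le[of \<xi> \<eta>] le[of \<eta> \<xi>] by (simp add: abs_le_iff)
qed

lemma weighted_norm_nonneg: "weight w \<Longrightarrow> weighted_norm w \<xi> \<ge> 0"
  unfolding weighted_norm_def weight_def by (intro Bochner_Integration.integral_nonneg) simp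

lemma weighted_norm_hom: "r > 0 \<Longrightarrow> weighted_norm w (\<lambda>\<alpha>. r *\<^sub>R \<xi> \<alpha>) = r * weighted_norm w \<xi>"
proof -
  assume "r > 0"
  then have "weighted_norm w (\<lambda>\<alpha>. r *\<^sub>R \<xi> \<alpha>) = (\<integral>x. r * (w x * norm (symbol_op k a x \<xi>)) \<partial>lebesgue)"
    unfolding weighted_norm_def by (simp add: symbol_op_scaleR mult.left_commute)
  then show ?thesis by (simp add: weighted_norm_def)
qed

lemma weighted_norm_even: "weighted_norm w (\<lambda>\<alpha>. - \<xi> \<alpha>) = weighted_norm w \<xi>"
  by (simp add: weighted_norm_def symbol_op_uminus)

lemma nn_weighted_norm:
  assumes "weight w"
  shows "(\<integral>\<^sup>+x. ennreal (w x * norm (symbol_op k a x \<xi>)) \<partial>lebesgue) = ennreal (weighted_norm w \<xi>)"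
  unfolding weighted_norm_def
  by (rule nn_integral_eq_integral[OF weighted_integrable[OF assms]]) (use assms in \<open>simp add: weight_def\<close>)

end

section \<open>Localisation by averaging over translations\<close>

lemma sigma_finite_lborel: "sigma_finite_measure lborel"
  by (rule lborel.sigma_finite_measure_axioms)

lemma pair_sigma_finite_lebesgue_lborel:
  "pair_sigma_finite (lebesgue :: 'a::euclidean_space measure) (lborel :: 'b::euclidean_space measure)"
  by (intro pair_sigma_finite.intro sigma_finite_lebesgue sigma_finite_lborel)

lemma nn_integral_reflect_scale:
  fixes h :: "real ^ 'n::finite \<Rightarrow> ennreal"
  assumes h: "h \<in> borel_measurable borel" and \<epsilon>: "\<epsilon> > 0"
  shows "(\<integral>\<^sup>+s. h s \<partial>lborel) = ennreal (\<epsilon> ^ CARD('n)) * (\<integral>\<^sup>+y. h (x - \<epsilon> *\<^sub>R y) \<partial>lborel)"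
proof -
  define T where "T = (\<lambda>y :: real ^ 'n. x + (- \<epsilon>) *\<^sub>R y)"
  have T: "T \<in> measurable lborel borel"
    unfolding T_def by simp
  have hT: "(\<lambda>y. h (T y)) \<in> borel_measurable lborel"
    by (rule measurable_compose[OF T h])
  have lb: "lborel = density (distr lborel borel T) (\<lambda>_. ennreal (\<epsilon> ^ CARD('n)))"
    using lborel_affine[of "- \<epsilon>" x] \<epsilon> by (simp add: T_def ennreal_power)
  have "(\<integral>\<^sup>+s. h s \<partial>lborel) = (\<integral>\<^sup>+s. h s \<partial>density (distr lborel borel T) (\<lambda>_. ennreal (\<epsilon> ^ CARD('n))))"
    by (rule arg_cong[where f = "\<lambda>M. integral\<^sup>N M h", OF lb])
  also have "\<dots> = (\<integral>\<^sup>+s. ennreal (\<epsilon> ^ CARD('n)) * h s \<partial>distr lborel borel T)"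
    using h by (intro nn_integral_density) auto
  also have "\<dots> = (\<integral>\<^sup>+y. ennreal (\<epsilon> ^ CARD('n)) * h (T y) \<partial>lborel)"
    using h by (intro nn_integral_distr T) auto
  also have "\<dots> = ennreal (\<epsilon> ^ CARD('n)) * (\<integral>\<^sup>+y. h (T y) \<partial>lborel)"
    by (rule nn_integral_cmult[OF hT])
  finally show ?thesis by (simp add: T_def)
qed

definition rescaled :: "real \<Rightarrow> (real ^ 'n::finite) \<Rightarrow> (real ^ 'n \<Rightarrow> 'v::real_normed_vector) \<Rightarrow> real ^ 'n \<Rightarrow> 'v" where
  "rescaled \<epsilon> s \<psi> = (\<lambda>x. \<psi> ((1 / \<epsilon>) *\<^sub>R x + - ((1 / \<epsilon>) *\<^sub>R s)))"

lemma rescaled_test_function: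
  assumes \<psi>: "\<psi> \<in> cube_tests" and \<epsilon>: "\<epsilon> > 0"
  shows "rescaled \<epsilon> s \<psi> \<in> test_functions"
proof -
  have "support_on UNIV (rescaled \<epsilon> s \<psi>) \<subseteq> (\<lambda>y. s + \<epsilon> *\<^sub>R y) ` cbox 0 1"
  proof
    fix x assume "x \<in> support_on UNIV (rescaled \<epsilon> s \<psi>)"
    then have "foldr partial_deriv [] \<psi> ((1 / \<epsilon>) *\<^sub>R x + - ((1 / \<epsilon>) *\<^sub>R s)) \<noteq> 0"
      by (simp add: support_on_def rescaled_def)
    then have "(1 / \<epsilon>) *\<^sub>R x + - ((1 / \<epsilon>) *\<^sub>R s) \<in> box 0 1"
      using \<psi> unfolding cube_tests_def by blast
    then have "(1 / \<epsilon>) *\<^sub>R x + - ((1 / \<epsilon>) *\<^sub>R s) \<in> cbox 0 1"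
      using box_subset_cbox by blast
    moreover have "x = s + \<epsilon> *\<^sub>R ((1 / \<epsilon>) *\<^sub>R x + - ((1 / \<epsilon>) *\<^sub>R s))"
      using \<epsilon> by (simp add: scaleR_right_diff_distrib)
    ultimately show "x \<in> (\<lambda>y. s + \<epsilon> *\<^sub>R y) ` cbox 0 1" by (rule rev_image_eqI)
  qed
  moreover have "compact ((\<lambda>y. s + \<epsilon> *\<^sub>R y) ` cbox 0 1)"
    by (intro compact_continuous_image continuous_intros compact_cbox)
  ultimately have "bounded (support_on UNIV (rescaled \<epsilon> s \<psi>))"
    using bounded_subset compact_imp_bounded by blast
  moreover have "smooth (rescaled \<epsilon> s \<psi>)"
    unfolding rescaled_def by (intro smooth_affine cube_tests_smooth \<psi>)
  ultimately show ?thesis by (simp add: test_functions_def compact_closure)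
qed

lemma multi_deriv_rescaled:
  assumes "smooth \<psi>" "\<alpha> \<in> multi_indices k"
  shows "multi_deriv \<alpha> (rescaled \<epsilon> s \<psi>) x
    = (1 / \<epsilon>) ^ k *\<^sub>R multi_deriv \<alpha> \<psi> ((1 / \<epsilon>) *\<^sub>R x + - ((1 / \<epsilon>) *\<^sub>R s))"
  unfolding rescaled_def multi_deriv_eq foldr_partial_deriv_affine[OF assms(1)] length_multi_list[OF assms(2)] ..

context coefficients
begin

lemma jet_integrand_measurable:
  assumes T: "T \<in> borel_measurable (lebesgue \<Otimes>\<^sub>M lborel)" and \<psi>: "smooth \<psi>"
    and u: "u \<in> borel_measurable (lebesgue \<Otimes>\<^sub>M lborel)"
  shows "(\<lambda>z. ennreal (u z * norm (symbol_op k a (fst z) (jet \<psi> (T z)))))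
    \<in> borel_measurable (lebesgue \<Otimes>\<^sub>M lborel)"
  by (intro measurable_compose[OF _ measurable_ennreal] borel_measurable_times u symbol_op_measurable measurable_fst
      weakly_measurable_continuous[OF continuous_on_multi_deriv[OF \<psi>] T])

text \<open>
  Up to a power of \<open>\<epsilon>\<close>, the weighted average over all translations \<open>s\<close> of the norm of the operator on
  \<open>rescaled \<epsilon> s \<psi>\<close>. At \<open>\<epsilon> = 0\<close> the weight sits at the point where the coefficients are evaluated.
\<close>

definition averaged :: "(real ^ 'n \<Rightarrow> real) \<Rightarrow> (real ^ 'n \<Rightarrow> 'v) \<Rightarrow> real \<Rightarrow> ennreal" where
  "averaged w \<psi> \<epsilon> = (\<integral>\<^sup>+z. ennreal (w (fst z - \<epsilon> *\<^sub>R snd z) *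
      norm (symbol_op k a (fst z) (jet \<psi> (snd z)))) \<partial>(lebesgue \<Otimes>\<^sub>M lborel))"

lemma id_lebesgue_borel: "(\<lambda>x :: real ^ 'n. x) \<in> borel_measurable lebesgue"
  by (rule measurable_completion) simp

lemma fst_lebesgue_borel:
  "(fst :: (real ^ 'n) \<times> 'b \<Rightarrow> _) \<in> borel_measurable (lebesgue \<Otimes>\<^sub>M M)"
  by (rule measurable_compose[OF measurable_fst id_lebesgue_borel])

lemma snd_lborel_borel: "snd \<in> borel_measurable (lebesgue \<Otimes>\<^sub>M lborel)"
  by (rule measurable_compose[OF measurable_snd]) simp

lemma weight_borel: "weight w \<Longrightarrow> w \<in> borel_measurable borel" for w :: "real ^ 'n \<Rightarrow> real"
  unfolding weight_def by (blast intro: borel_measurable_continuous_onI)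

lemma averaged_measurable:
  assumes \<psi>: "smooth \<psi>" and w: "weight w"
  shows "(\<lambda>z. ennreal (w (fst z - \<epsilon> *\<^sub>R snd z) * norm (symbol_op k a (fst z) (jet \<psi> (snd z)))))
    \<in> borel_measurable (lebesgue \<Otimes>\<^sub>M lborel)"
proof (intro jet_integrand_measurable snd_lborel_borel \<psi>)
  have "(\<lambda>z. fst z - \<epsilon> *\<^sub>R snd z) \<in> borel_measurable (lebesgue \<Otimes>\<^sub>M (lborel :: (real ^ 'n) measure))"
    by (intro borel_measurable_diff borel_measurable_scaleR borel_measurable_const fst_lebesgue_borel snd_lborel_borel)
  from measurable_compose[OF this weight_borel[OF w]]
  show "(\<lambda>z. w (fst z - \<epsilon> *\<^sub>R snd z)) \<in> borel_measurable (lebesgue \<Otimes>\<^sub>M lborel)" .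
qed

text \<open>
  Tonelli's theorem, and for fixed \<open>x\<close> the substitution \<open>s = x - \<epsilon> *\<^sub>R y\<close>, under which the argument
  \<open>(x - s) / \<epsilon>\<close> of \<open>\<psi>\<close> becomes \<open>y\<close>.
\<close>

lemma average_over_translations:
  assumes \<psi>: "\<psi> \<in> cube_tests" and w: "weight w" and \<epsilon>: "\<epsilon> > 0"
  shows "(\<lambda>s. ennreal (w s) * L1_norm (diff_op k a (rescaled \<epsilon> s \<psi>))) \<in> borel_measurable lborel"
    and "(\<integral>\<^sup>+s. ennreal (w s) * L1_norm (diff_op k a (rescaled \<epsilon> s \<psi>)) \<partial>lborel)
      = ennreal ((1 / \<epsilon>) ^ k * \<epsilon> ^ CARD('n)) * averaged w \<psi> \<epsilon>"
proof -
  define S where "S z = (1 / \<epsilon>) *\<^sub>R fst z + - ((1 / \<epsilon>) *\<^sub>R snd z)" for z :: "(real ^ 'n) \<times> (real ^ 'n)"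
  define f where "f z = ennreal (w (snd z) * norm (symbol_op k a (fst z) (jet \<psi> (S z))))" for z
  define r where "r = (1 / \<epsilon>) ^ k"
  have sm: "smooth \<psi>" using \<psi> by (rule cube_tests_smooth)
  have w0: "w x \<ge> 0" for x using w by (simp add: weight_def)
  have r0: "r > 0" using \<epsilon> by (simp add: r_def)
  have S: "S \<in> borel_measurable (lebesgue \<Otimes>\<^sub>M lborel)"
    unfolding S_def
    by (intro borel_measurable_add borel_measurable_uminus borel_measurable_scaleR borel_measurable_const
        fst_lebesgue_borel snd_lborel_borel)
  have f: "f \<in> borel_measurable (lebesgue \<Otimes>\<^sub>M lborel)"
    unfolding f_def
    by (intro jet_integrand_measurable S sm measurable_compose[OF snd_lborel_borel weight_borel[OF w]])
  define g where "g z = ennreal (w (fst z - \<epsilon> *\<^sub>R snd z) *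
    norm (symbol_op k a (fst z) (jet \<psi> (snd z))))" for z
  have g: "g \<in> borel_measurable (lebesgue \<Otimes>\<^sub>M lborel)"
    unfolding g_def by (rule averaged_measurable[OF sm w])
  interpret P: pair_sigma_finite "lebesgue :: (real ^ 'n) measure" "lborel :: (real ^ 'n) measure"
    by (rule pair_sigma_finite_lebesgue_lborel)
  have eq: "ennreal (w s) * L1_norm (diff_op k a (rescaled \<epsilon> s \<psi>)) = ennreal r * (\<integral>\<^sup>+x. f (x, s) \<partial>lebesgue)" for s
  proof -
    have "norm (diff_op k a (rescaled \<epsilon> s \<psi>) x) = r * norm (symbol_op k a x (jet \<psi> (S (x, s))))" for x
    proof -
      have "diff_op k a (rescaled \<epsilon> s \<psi>) x = symbol_op k a x (\<lambda>\<alpha>. r *\<^sub>R multi_deriv \<alpha> \<psi> (S (x, s)))"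
        unfolding diff_op_eq by (rule symbol_op_cong) (simp add: multi_deriv_rescaled[OF sm] S_def r_def)
      then show ?thesis using r0 by (simp add: symbol_op_scaleR)
    qed
    then have "ennreal (w s) * ennreal (norm (diff_op k a (rescaled \<epsilon> s \<psi>) x)) = ennreal r * f (x, s)" for x
      using w0[of s] r0 by (simp add: f_def ennreal_mult[symmetric] mult.left_commute)
    moreover have m: "(\<lambda>x. ennreal (norm (diff_op k a (rescaled \<epsilon> s \<psi>) x))) \<in> borel_measurable lebesgue"
    proof -
      have "smooth (rescaled \<epsilon> s \<psi>)" unfolding rescaled_def by (intro smooth_affine sm)
      then have "weakly_measurable lebesgue (\<lambda>x. multi_deriv \<alpha> (rescaled \<epsilon> s \<psi>) x)" for \<alpha>
        by (intro weakly_measurable_continuous[OF continuous_on_multi_deriv] id_lebesgue_borel)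
      from symbol_op_measurable[OF _ this, of "\<lambda>x. x"] show ?thesis
        unfolding diff_op_eq by (intro measurable_compose[OF _ measurable_ennreal]) simp
    qed
    ultimately have "ennreal (w s) * L1_norm (diff_op k a (rescaled \<epsilon> s \<psi>)) = (\<integral>\<^sup>+x. ennreal r * f (x, s) \<partial>lebesgue)"
      unfolding L1_norm_def by (subst nn_integral_cmult[OF m, symmetric]) simp
    also have "\<dots> = ennreal r * (\<integral>\<^sup>+x. f (x, s) \<partial>lebesgue)"
      by (rule nn_integral_cmult, rule measurable_compose[OF _ f], simp)
    finally show ?thesis .
  qed
  have m: "(\<lambda>s. \<integral>\<^sup>+x. f (x, s) \<partial>lebesgue) \<in> borel_measurable lborel"
    using P.M1.borel_measurable_nn_integral_fst[of "\<lambda>z. f (snd z, fst z)" lborel] measurable_pair_swap[OF f]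
    by (simp add: case_prod_unfold)
  show "(\<lambda>s. ennreal (w s) * L1_norm (diff_op k a (rescaled \<epsilon> s \<psi>))) \<in> borel_measurable lborel"
    unfolding eq by (intro borel_measurable_times_ennreal m) simp
  have "(\<integral>\<^sup>+s. ennreal (w s) * L1_norm (diff_op k a (rescaled \<epsilon> s \<psi>)) \<partial>lborel)
      = ennreal r * (\<integral>\<^sup>+s. \<integral>\<^sup>+x. f (x, s) \<partial>lebesgue \<partial>lborel)"
    unfolding eq by (rule nn_integral_cmult[OF m])
  also have "(\<integral>\<^sup>+s. \<integral>\<^sup>+x. f (x, s) \<partial>lebesgue \<partial>lborel) = (\<integral>\<^sup>+x. \<integral>\<^sup>+s. f (x, s) \<partial>lborel \<partial>lebesgue)"
    by (rule P.Fubini[OF f])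
  also have "\<dots> = (\<integral>\<^sup>+x. ennreal (\<epsilon> ^ CARD('n)) * (\<integral>\<^sup>+y. f (x, x - \<epsilon> *\<^sub>R y) \<partial>lborel) \<partial>lebesgue)"
  proof (rule nn_integral_cong)
    fix x :: "real ^ 'n"
    have "(\<lambda>s. f (x, s)) \<in> borel_measurable lborel"
      by (rule measurable_compose[OF _ f]) simp
    then have "(\<lambda>s. f (x, s)) \<in> borel_measurable borel" by simp
    from nn_integral_reflect_scale[OF this \<epsilon>, of x]
    show "(\<integral>\<^sup>+s. f (x, s) \<partial>lborel) = ennreal (\<epsilon> ^ CARD('n)) * (\<integral>\<^sup>+y. f (x, x - \<epsilon> *\<^sub>R y) \<partial>lborel)" .
  qed
  also have "\<dots> = (\<integral>\<^sup>+x. ennreal (\<epsilon> ^ CARD('n)) * (\<integral>\<^sup>+y. g (x, y) \<partial>lborel) \<partial>lebesgue)"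
    using \<epsilon> by (simp add: f_def g_def S_def scaleR_right_diff_distrib)
  also have "\<dots> = ennreal (\<epsilon> ^ CARD('n)) * (\<integral>\<^sup>+x. \<integral>\<^sup>+y. g (x, y) \<partial>lborel \<partial>lebesgue)"
    by (rule nn_integral_cmult[OF sigma_finite_measure.borel_measurable_nn_integral_fst[OF sigma_finite_lborel g]])
  also have "(\<integral>\<^sup>+x. \<integral>\<^sup>+y. g (x, y) \<partial>lborel \<partial>lebesgue) = averaged w \<psi> \<epsilon>"
    unfolding averaged_def g_def[symmetric] by (rule sigma_finite_measure.nn_integral_fst[OF sigma_finite_lborel g])
  finally show "(\<integral>\<^sup>+s. ennreal (w s) * L1_norm (diff_op k a (rescaled \<epsilon> s \<psi>)) \<partial>lborel)
      = ennreal ((1 / \<epsilon>) ^ k * \<epsilon> ^ CARD('n)) * averaged w \<psi> \<epsilon>"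
    using \<epsilon> r0 by (simp add: r_def ennreal_mult mult.assoc)
qed

lemma multi_deriv_bounded:
  fixes \<psi> :: "real ^ 'n \<Rightarrow> 'v"
  assumes \<psi>: "\<psi> \<in> cube_tests"
  shows "\<exists>P\<ge>0. \<forall>\<alpha>\<in>multi_indices k. \<forall>y. norm (multi_deriv \<alpha> \<psi> y) \<le> P"
proof -
  have zero: "multi_deriv \<alpha> \<psi> y = 0" if "y \<notin> cbox 0 1" for \<alpha> y
    using that \<psi> box_subset_cbox unfolding cube_tests_def multi_deriv_eq by blast
  have "\<exists>P. \<forall>y. norm (multi_deriv \<alpha> \<psi> y) \<le> P" for \<alpha>
  proof -
    have "bounded (multi_deriv \<alpha> \<psi> ` cbox 0 1)"
      by (intro compact_imp_bounded compact_continuous_image continuous_on_multi_deriv cube_tests_smooth \<psi> compact_cbox)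
    then obtain P where P: "\<forall>y\<in>cbox 0 1. norm (multi_deriv \<alpha> \<psi> y) \<le> P" unfolding bounded_iff by blast
    have "norm (multi_deriv \<alpha> \<psi> y) \<le> max 0 P" for y
      using P zero[of y \<alpha>] by (cases "y \<in> cbox 0 1") force+
    then show ?thesis by blast
  qed
  then have "\<forall>\<alpha>. \<exists>P. \<forall>y. norm (multi_deriv \<alpha> \<psi> y) \<le> P" ..
  from choice[OF this] obtain P where P: "\<forall>\<alpha> y. norm (multi_deriv \<alpha> \<psi> y) \<le> P \<alpha>" ..
  then have P0: "0 \<le> P \<alpha>" for \<alpha> using order_trans[OF norm_ge_zero] by blast
  have "norm (multi_deriv \<alpha> \<psi> y) \<le> sum P (multi_indices k)" if "\<alpha> \<in> multi_indices k" for \<alpha> y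
    using P member_le_sum[OF that, of P] P0 finite_multi_indices order_trans by blast
  then show ?thesis using P0 by (intro exI[of _ "sum P (multi_indices k)"]) (simp add: sum_nonneg)
qed

text \<open>
  Dominated convergence on the product space. For \<open>\<epsilon> \<le> 1\<close> the integrands are supported in a fixed
  compact set, because \<open>y\<close> ranges over the unit cube and \<open>x - \<epsilon> *\<^sub>R y\<close> over the support of the
  weight.
\<close>

lemma averaged_limit:
  assumes \<psi>: "\<psi> \<in> cube_tests" and w: "weight w"
  shows "(\<lambda>m. averaged w \<psi> (1 / real (Suc m))) \<longlonglongrightarrow> averaged w \<psi> 0"
proof -
  have sm: "smooth \<psi>" using \<psi> by (rule cube_tests_smooth)
  obtain W where W: "W \<ge> 0" "\<And>x. w x \<le> W" using weight_bounded[OF w] by blast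
  obtain P where P: "P \<ge> 0" "\<And>\<alpha> y. \<alpha> \<in> multi_indices k \<Longrightarrow> norm (multi_deriv \<alpha> \<psi> y) \<le> P"
    using multi_deriv_bounded[OF \<psi>] by blast
  obtain K where K: "continuous_on UNIV w" "\<forall>x. 0 \<le> w x" "compact K" "\<forall>x. x \<notin> K \<longrightarrow> w x = 0"
    using w unfolding weight_def by blast
  obtain R where R: "\<forall>x\<in>K. norm x \<le> R" using compact_imp_bounded[OF K(3)] unfolding bounded_iff by blast
  define B where "B = cball (0 :: real ^ 'n) (R + real CARD('n))"
  define g where "g x = W * P * (indicator B x * coeff_norm x)" for x
  have g_int: "integrable lebesgue g"
    unfolding g_def B_def by (intro Bochner_Integration.integrable_mult_right coeff_norm_integrable compact_cball)
  have g0: "g x \<ge> 0" for x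
    using W(1) P(1) coeff_norm_nonneg[of x] by (simp add: g_def)
  have bound: "w (x - \<epsilon> *\<^sub>R y) * norm (symbol_op k a x (jet \<psi> y)) \<le> g x * indicator (cbox 0 1) y"
    if \<epsilon>: "0 \<le> \<epsilon>" "\<epsilon> \<le> 1" for x y \<epsilon>
  proof (cases "y \<in> cbox 0 1 \<and> x \<in> B")
    case True
    have "w (x - \<epsilon> *\<^sub>R y) * norm (symbol_op k a x (jet \<psi> y)) \<le> W * (coeff_norm x * P)"
      by (intro mult_mono W norm_symbol_op_le_coeff_norm P) simp_all
    then show ?thesis using True by (simp add: g_def mult_ac)
  next
    case False
    have vanish: "w (x - \<epsilon> *\<^sub>R y) * norm (symbol_op k a x (jet \<psi> y)) = 0"
    proof (cases "y \<in> cbox 0 1")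
      case False
      then have "multi_deriv \<alpha> \<psi> y = 0" for \<alpha>
        using \<psi> box_subset_cbox unfolding cube_tests_def multi_deriv_eq by blast
      then show ?thesis by (simp add: symbol_op_def)
    next
      case True
      then have x: "x \<notin> B" using \<open>\<not> (y \<in> cbox 0 1 \<and> x \<in> B)\<close> by simp
      have "x - \<epsilon> *\<^sub>R y \<notin> K"
      proof
        assume "x - \<epsilon> *\<^sub>R y \<in> K"
        then have "norm (x - \<epsilon> *\<^sub>R y) \<le> R" using R by blast
        moreover have "norm y \<le> real CARD('n)"
        proof -
          have "norm y \<le> (\<Sum>i\<in>UNIV. \<bar>y $ i\<bar>)" by (rule norm_le_l1_cart)
          also have "\<dots> \<le> (\<Sum>i\<in>(UNIV :: 'n set). 1)"
            using True by (intro sum_mono) (simp add: mem_box_cart)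
          finally show ?thesis by simp
        qed
        then have "norm (\<epsilon> *\<^sub>R y) \<le> real CARD('n)"
          using \<epsilon> mult_mono[of \<epsilon> 1 "norm y" "real CARD('n)"] by simp
        moreover have "norm x \<le> norm (x - \<epsilon> *\<^sub>R y) + norm (\<epsilon> *\<^sub>R y)"
          using norm_triangle_ineq[of "x - \<epsilon> *\<^sub>R y" "\<epsilon> *\<^sub>R y"] by simp
        ultimately show False using x by (simp add: B_def)
      qed
      then show ?thesis using K(4) by simp
    qed
    show ?thesis unfolding vanish using g0[of x] by simp
  qed
  show ?thesis
    unfolding averaged_def
  proof (rule nn_integral_dominated_convergence[where w = "\<lambda>z. ennreal (g (fst z)) * indicator (cbox 0 1) (snd z)"])
    show bm: "(\<lambda>z. ennreal (g (fst z)) * indicator (cbox 0 1) (snd z)) \<in> borel_measurable (lebesgue \<Otimes>\<^sub>M lborel)"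
    proof (intro borel_measurable_times_ennreal)
      show "(\<lambda>z. ennreal (g (fst z))) \<in> borel_measurable (lebesgue \<Otimes>\<^sub>M lborel)"
        by (rule measurable_compose[OF measurable_fst measurable_compose[OF borel_measurable_integrable[OF g_int] measurable_ennreal]])
      show "(\<lambda>z. indicator (cbox 0 1) (snd z) :: ennreal) \<in> borel_measurable (lebesgue \<Otimes>\<^sub>M lborel)"
        by (rule measurable_compose[OF measurable_snd]) simp
    qed
    show "AE z in lebesgue \<Otimes>\<^sub>M lborel. ennreal (w (fst z - (1 / real (Suc j)) *\<^sub>R snd z) *
        norm (symbol_op k a (fst z) (jet \<psi> (snd z))))
      \<le> ennreal (g (fst z)) * indicator (cbox 0 1) (snd z)" for j
    proof (intro AE_I2)
      fix z :: "(real ^ 'n) \<times> (real ^ 'n)"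
      have "ennreal (w (fst z - (1 / real (Suc j)) *\<^sub>R snd z) *
          norm (symbol_op k a (fst z) (jet \<psi> (snd z))))
        \<le> ennreal (g (fst z) * indicator (cbox 0 1) (snd z))"
        by (intro ennreal_leI bound) simp_all
      also have "\<dots> = ennreal (g (fst z)) * indicator (cbox 0 1) (snd z)"
        by (simp split: split_indicator)
      finally show "ennreal (w (fst z - (1 / real (Suc j)) *\<^sub>R snd z) *
          norm (symbol_op k a (fst z) (jet \<psi> (snd z))))
        \<le> ennreal (g (fst z)) * indicator (cbox 0 1) (snd z)" .
    qed
    have "(\<integral>\<^sup>+z. ennreal (g (fst z)) * indicator (cbox 0 (1 :: real ^ 'n)) (snd z) \<partial>(lebesgue \<Otimes>\<^sub>M lborel))
        = (\<integral>\<^sup>+x. \<integral>\<^sup>+y. ennreal (g x) * indicator (cbox 0 (1 :: real ^ 'n)) y \<partial>lborel \<partial>lebesgue)"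
      using sigma_finite_measure.nn_integral_fst[OF sigma_finite_lborel bm] unfolding fst_conv snd_conv by (rule sym)
    also have "\<dots> = (\<integral>\<^sup>+x. ennreal (g x) * emeasure lborel (cbox 0 (1 :: real ^ 'n)) \<partial>lebesgue)"
      by (simp add: nn_integral_cmult_indicator)
    also have "\<dots> = (\<integral>\<^sup>+x. ennreal (g x) \<partial>lebesgue)"
    proof -
      have "emeasure lborel (cbox 0 (1 :: real ^ 'n)) = ennreal (measure lborel (cbox 0 (1 :: real ^ 'n)))"
        by (rule emeasure_eq_ennreal_measure) (use emeasure_lborel_cbox_finite[of 0 "1 :: real ^ 'n"] in simp)
      then show ?thesis by simp
    qed
    also have "\<dots> < \<infinity>"
      using nn_integral_eq_integral[OF g_int] g0 by simp
    finally show "(\<integral>\<^sup>+z. ennreal (g (fst z)) * indicator (cbox 0 (1 :: real ^ 'n)) (snd z) \<partial>(lebesgue \<Otimes>\<^sub>M lborel)) < \<infinity>" .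
    show "AE z in lebesgue \<Otimes>\<^sub>M lborel.
      (\<lambda>j. ennreal (w (fst z - (1 / real (Suc j)) *\<^sub>R snd z) *
          norm (symbol_op k a (fst z) (jet \<psi> (snd z)))))
      \<longlonglongrightarrow> ennreal (w (fst z - 0 *\<^sub>R snd z) * norm (symbol_op k a (fst z) (jet \<psi> (snd z))))"
    proof (intro AE_I2 tendsto_ennrealI tendsto_mult tendsto_const)
      fix z :: "(real ^ 'n) \<times> (real ^ 'n)"
      have "(\<lambda>j. fst z - (1 / real (Suc j)) *\<^sub>R snd z) \<longlonglongrightarrow> fst z - 0 *\<^sub>R snd z"
        using LIMSEQ_inverse_real_of_nat by (intro tendsto_intros) (simp add: inverse_eq_divide)
      moreover have "isCont w (fst z - 0 *\<^sub>R snd z)"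
        using K(1) continuous_on_eq_continuous_at open_UNIV by blast
      ultimately show "(\<lambda>j. w (fst z - (1 / real (Suc j)) *\<^sub>R snd z)) \<longlonglongrightarrow> w (fst z - 0 *\<^sub>R snd z)"
        by (rule isCont_tendsto_compose[rotated])
    qed
  qed (rule averaged_measurable[OF sm w])+
qed

text \<open>
  Integrating over \<open>x\<close> first turns the inner integral into the weighted seminorm of the jet of \<open>\<psi>\<close> at
  \<open>y\<close>.
\<close>

lemma averaged_zero:
  assumes \<psi>: "\<psi> \<in> cube_tests" and w: "weight w"
  shows "averaged w \<psi> 0 = ennreal (integral (cbox 0 1) (\<lambda>y. weighted_norm w (jet \<psi> y)))"
proof -
  have sm: "smooth \<psi>" using \<psi> by (rule cube_tests_smooth)
  interpret P: pair_sigma_finite "lebesgue :: (real ^ 'n) measure" "lborel :: (real ^ 'n) measure"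
    by (rule pair_sigma_finite_lebesgue_lborel)
  define f where "f y = weighted_norm w (jet \<psi> y)" for y
  have cont: "continuous_on S f" for S
    unfolding f_def
    by (rule continuous_on_lipschitz_jet[OF weighted_norm_lip[OF w]]) (rule continuous_on_multi_deriv[OF sm])
  have zero: "f y = 0" if "y \<notin> cbox 0 1" for y
  proof -
    have "multi_deriv \<alpha> \<psi> y = 0" for \<alpha>
      using that \<psi> box_subset_cbox unfolding cube_tests_def multi_deriv_eq by blast
    then show ?thesis by (simp add: f_def weighted_norm_def symbol_op_def)
  qed
  have "averaged w \<psi> 0 = (\<integral>\<^sup>+y. \<integral>\<^sup>+x. ennreal (w x * norm (symbol_op k a x (jet \<psi> y))) \<partial>lebesgue \<partial>lborel)"
    using P.nn_integral_snd[OF averaged_measurable[OF sm w, of 0]] by (simp add: averaged_def)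
  also have "\<dots> = (\<integral>\<^sup>+y. ennreal (f y) \<partial>lborel)"
    by (simp add: nn_weighted_norm[OF w] f_def)
  also have "\<dots> = ennreal (integral (cbox 0 1) f)"
  proof (rule nn_integral_has_integral_lborel)
    show "f \<in> borel_measurable borel" by (rule borel_measurable_continuous_onI[OF cont])
    show "0 \<le> f y" for y by (simp add: f_def weighted_norm_nonneg[OF w])
    show "(f has_integral integral (cbox 0 1) f) UNIV"
      by (rule has_integral_on_superset[OF integrable_integral[OF integrable_continuous[OF cont]]]) (auto intro: zero)
  qed
  finally show ?thesis unfolding f_def[abs_def] .
qed

end

text \<open>
  Averaging over translations and letting \<open>\<epsilon>\<close> tend to \<open>0\<close> verifies the hypotheses of
  \<open>jet_integrand\<close> for the difference of the two sides.
\<close>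

lemma weighted_norm_le:
  fixes a1 :: "('n::finite \<Rightarrow> nat) \<Rightarrow> real ^ 'n \<Rightarrow> 'v::real_inner \<Rightarrow>\<^sub>L 'w1::real_inner"
    and a2 :: "('n \<Rightarrow> nat) \<Rightarrow> real ^ 'n \<Rightarrow> 'v \<Rightarrow>\<^sub>L 'w2::real_inner"
  assumes c1: "coefficients k a1" and c2: "coefficients k a2" and c: "c \<ge> 0" and w: "weight w"
    and le: "\<And>\<phi>. \<phi> \<in> test_functions \<Longrightarrow> L1_norm (diff_op k a2 \<phi>) \<le> ennreal c * L1_norm (diff_op k a1 \<phi>)"
  shows "coefficients.weighted_norm k a2 w \<xi> \<le> c * coefficients.weighted_norm k a1 w \<xi>"
proof -
  interpret C1: coefficients k a1 by (rule c1)
  interpret C2: coefficients k a2 by (rule c2)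
  have avg: "C2.averaged w \<psi> \<epsilon> \<le> ennreal c * C1.averaged w \<psi> \<epsilon>" if \<psi>: "\<psi> \<in> cube_tests" and \<epsilon>: "\<epsilon> > 0" for \<psi> \<epsilon>
  proof -
    define r where "r = ennreal ((1 / \<epsilon>) ^ k * \<epsilon> ^ CARD('n))"
    have r: "r \<noteq> 0" "r \<noteq> top" using \<epsilon> by (simp_all add: r_def)
    have "r * C2.averaged w \<psi> \<epsilon> = (\<integral>\<^sup>+s. ennreal (w s) * L1_norm (diff_op k a2 (rescaled \<epsilon> s \<psi>)) \<partial>lborel)"
      unfolding r_def by (rule C2.average_over_translations(2)[OF \<psi> w \<epsilon>, symmetric])
    also have "\<dots> \<le> (\<integral>\<^sup>+s. ennreal c * (ennreal (w s) * L1_norm (diff_op k a1 (rescaled \<epsilon> s \<psi>))) \<partial>lborel)"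
    proof (rule nn_integral_mono)
      fix s
      have "ennreal (w s) * L1_norm (diff_op k a2 (rescaled \<epsilon> s \<psi>))
          \<le> ennreal (w s) * (ennreal c * L1_norm (diff_op k a1 (rescaled \<epsilon> s \<psi>)))"
        by (intro mult_left_mono le rescaled_test_function \<psi> \<epsilon>) simp
      then show "ennreal (w s) * L1_norm (diff_op k a2 (rescaled \<epsilon> s \<psi>))
          \<le> ennreal c * (ennreal (w s) * L1_norm (diff_op k a1 (rescaled \<epsilon> s \<psi>)))"
        by (simp add: mult.left_commute)
    qed
    also have "\<dots> = ennreal c * (\<integral>\<^sup>+s. ennreal (w s) * L1_norm (diff_op k a1 (rescaled \<epsilon> s \<psi>)) \<partial>lborel)"
      by (rule nn_integral_cmult[OF C1.average_over_translations(1)[OF \<psi> w \<epsilon>]])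
    also have "\<dots> = r * (ennreal c * C1.averaged w \<psi> \<epsilon>)"
      unfolding r_def C1.average_over_translations(2)[OF \<psi> w \<epsilon>] by (rule mult.left_commute)
    finally show ?thesis using ennreal_mult_le_mult_iff[OF r] by blast
  qed
  have main: "integral (cbox 0 1) (\<lambda>y. C2.weighted_norm w (jet \<psi> y))
      \<le> c * integral (cbox 0 1) (\<lambda>y. C1.weighted_norm w (jet \<psi> y))"
    if \<psi>: "\<psi> \<in> cube_tests" for \<psi>
  proof -
    have "C2.averaged w \<psi> 0 \<le> ennreal c * C1.averaged w \<psi> 0"
    proof (rule LIMSEQ_le)
      show "(\<lambda>m. C2.averaged w \<psi> (1 / real (Suc m))) \<longlonglongrightarrow> C2.averaged w \<psi> 0"
        by (rule C2.averaged_limit[OF \<psi> w])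
      show "(\<lambda>m. ennreal c * C1.averaged w \<psi> (1 / real (Suc m))) \<longlonglongrightarrow> ennreal c * C1.averaged w \<psi> 0"
        by (intro ennreal_tendsto_cmult C1.averaged_limit[OF \<psi> w]) simp
      show "\<exists>N. \<forall>m\<ge>N. C2.averaged w \<psi> (1 / real (Suc m)) \<le> ennreal c * C1.averaged w \<psi> (1 / real (Suc m))"
        by (intro exI allI impI avg \<psi>) simp
    qed
    moreover have nn: "0 \<le> integral (cbox 0 1) (\<lambda>y. C1.weighted_norm w (jet \<psi> y))"
      by (rule Henstock_Kurzweil_Integration.integral_nonneg)
        (auto intro!: integrable_continuous continuous_on_lipschitz_jet[OF C1.weighted_norm_lip[OF w]]
          continuous_on_multi_deriv cube_tests_smooth[OF \<psi>] C1.weighted_norm_nonneg[OF w])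
    ultimately show ?thesis
      using c by (simp add: C1.averaged_zero[OF \<psi> w] C2.averaged_zero[OF \<psi> w] ennreal_mult[symmetric] ennreal_le_iff)
  qed
  define F where "F \<eta> = c * C1.weighted_norm w \<eta> - C2.weighted_norm w \<eta>" for \<eta>
  define L1 where "L1 = (\<integral>x. w x * C1.coeff_norm x \<partial>lebesgue)"
  define L2 where "L2 = (\<integral>x. w x * C2.coeff_norm x \<partial>lebesgue)"
  have w0: "0 \<le> w x" for x using w by (simp add: weight_def)
  interpret J: jet_integrand k F "c * L1 + L2"
  proof
    have "0 \<le> L1" "0 \<le> L2"
      unfolding L1_def L2_def
      by (intro Bochner_Integration.integral_nonneg mult_nonneg_nonneg w0 C1.coeff_norm_nonneg C2.coeff_norm_nonneg)+
    then show "c * L1 + L2 \<ge> 0" using c by simp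
    show "\<bar>F \<eta> - F \<zeta>\<bar> \<le> (c * L1 + L2) * jet_dist k \<eta> \<zeta>" for \<eta> \<zeta>
    proof -
      have "\<bar>F \<eta> - F \<zeta>\<bar> \<le> c * \<bar>C1.weighted_norm w \<eta> - C1.weighted_norm w \<zeta>\<bar>
          + \<bar>C2.weighted_norm w \<eta> - C2.weighted_norm w \<zeta>\<bar>"
      proof -
        have "F \<eta> - F \<zeta> = c * (C1.weighted_norm w \<eta> - C1.weighted_norm w \<zeta>)
          - (C2.weighted_norm w \<eta> - C2.weighted_norm w \<zeta>)" by (simp add: F_def algebra_simps)
        then show ?thesis
          using abs_triangle_ineq4[of "c * (C1.weighted_norm w \<eta> - C1.weighted_norm w \<zeta>)"
              "C2.weighted_norm w \<eta> - C2.weighted_norm w \<zeta>"] c by (simp add: abs_mult)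
      qed
      also have "\<dots> \<le> c * (L1 * jet_dist k \<eta> \<zeta>) + L2 * jet_dist k \<eta> \<zeta>"
        unfolding L1_def L2_def
        by (intro add_mono mult_left_mono C1.weighted_norm_lip C2.weighted_norm_lip w c)
      finally show ?thesis by (simp add: algebra_simps)
    qed
    show "F (\<lambda>\<alpha>. r *\<^sub>R \<eta> \<alpha>) = r * F \<eta>" if "r > 0" for r \<eta>
      using that by (simp add: F_def C1.weighted_norm_hom C2.weighted_norm_hom algebra_simps)
    show "F (\<lambda>\<alpha>. - \<eta> \<alpha>) = F \<eta>" for \<eta>
      by (simp add: F_def C1.weighted_norm_even C2.weighted_norm_even)
    fix \<psi> :: "real ^ 'n \<Rightarrow> 'v" assume \<psi>: "\<psi> \<in> cube_tests"
    have i1: "(\<lambda>y. C1.weighted_norm w (jet \<psi> y)) integrable_on cbox 0 1"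
      by (intro integrable_continuous continuous_on_lipschitz_jet[OF C1.weighted_norm_lip[OF w]]
          continuous_on_multi_deriv cube_tests_smooth[OF \<psi>])
    have i2: "(\<lambda>y. C2.weighted_norm w (jet \<psi> y)) integrable_on cbox 0 1"
      by (intro integrable_continuous continuous_on_lipschitz_jet[OF C2.weighted_norm_lip[OF w]]
          continuous_on_multi_deriv cube_tests_smooth[OF \<psi>])
    have "((\<lambda>y. F (jet \<psi> y)) has_integral
      (c * integral (cbox 0 1) (\<lambda>y. C1.weighted_norm w (jet \<psi> y))
        - integral (cbox 0 1) (\<lambda>y. C2.weighted_norm w (jet \<psi> y)))) (cbox 0 1)"
      unfolding F_def by (intro has_integral_diff has_integral_mult_right integrable_integral i1 i2)
    from integral_unique[OF this] main[OF \<psi>] show "0 \<le> energy F (\<lambda>_. 0) \<psi>"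
      by (simp add: energy_def)
  qed
  from J.nonneg_everywhere[of \<xi>] show ?thesis by (simp add: F_def)
qed

section \<open>From weighted integrals to pointwise inequalities\<close>

text \<open>
  Weights decreasing to the indicator of a compact set \<open>K\<close> show that the integral of \<open>h\<close> over
  \<open>K\<close> is nonnegative. If \<open>{x. h x < 0}\<close> had positive measure, it would contain a compact set of positive measure.
\<close>

lemma AE_nonneg_of_weighted:
  fixes h :: "'a::euclidean_space \<Rightarrow> real"
  assumes meas: "h \<in> borel_measurable lebesgue"
    and int: "\<And>w. weight w \<Longrightarrow> integrable lebesgue (\<lambda>x. w x * h x)"
    and nonneg: "\<And>w. weight w \<Longrightarrow> 0 \<le> (\<integral>x. w x * h x \<partial>lebesgue)"
  shows "AE x in lebesgue. 0 \<le> h x"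
proof -
  have compact: "integrable lebesgue (\<lambda>x. indicator K x * h x)" "0 \<le> (\<integral>x. indicator K x * h x \<partial>lebesgue)"
    if K: "compact K" "K \<noteq> {}" for K
  proof -
    define w where "w j x = max 0 (1 - real (Suc j) * infdist x K)" for j x
    have w: "weight (w j)" for j
      unfolding weight_def
    proof (intro conjI allI exI impI)
      show "continuous_on UNIV (w j)" unfolding w_def by (intro continuous_intros)
      show "0 \<le> w j x" for x by (simp add: w_def)
      show "compact {x. infdist x K \<le> 1}" by (rule compact_infdist_le) (use K in auto)
      fix x assume "x \<notin> {x. infdist x K \<le> 1}"
      then have "1 * 1 \<le> real (Suc j) * infdist x K" by (intro mult_mono) auto
      then show "w j x = 0" by (simp add: w_def)
    qed
    have wm: "w j \<in> borel_measurable lebesgue" for j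
    proof -
      have "w j \<in> borel_measurable lborel"
        using w[of j] unfolding weight_def by (auto intro: borel_measurable_continuous_onI)
      then show ?thesis by (rule measurable_completion)
    qed
    have lim: "(\<lambda>j. w j x * h x) \<longlonglongrightarrow> indicator K x * h x" for x
    proof (cases "x \<in> K")
      case True
      then show ?thesis by (simp add: w_def)
    next
      case False
      then have d: "infdist x K > 0"
        using infdist_pos_not_in_closed[OF compact_imp_closed[OF K(1)] K(2)] by simp
      obtain N :: nat where N: "1 / infdist x K < real N" using reals_Archimedean2 by blast
      have "w j x = 0" if "j \<ge> N" for j
      proof -
        have "1 / infdist x K \<le> real (Suc j)" using N that by linarith
        then show ?thesis using d by (simp add: w_def field_simps)
      qed
      then have "\<forall>\<^sub>F j in sequentially. w j x * h x = 0"
        unfolding eventually_sequentially by (intro exI[of _ N]) simp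
      then show ?thesis using False by (simp add: tendsto_eventually)
    qed
    have bound: "norm (w j x * h x) \<le> norm (w 0 x * h x)" for j x
    proof -
      have "infdist x K \<le> real (Suc j) * infdist x K"
        using infdist_nonneg[of x K] by (simp add: distrib_right)
      then have "w j x \<le> w 0 x" "0 \<le> w j x" by (auto simp: w_def)
      then show ?thesis by (simp add: abs_mult mult_right_mono)
    qed
    have hm: "(\<lambda>x. w j x * h x) \<in> borel_measurable lebesgue" for j
      by (intro borel_measurable_times wm meas)
    have km: "(\<lambda>x. indicator K x * h x) \<in> borel_measurable lebesgue"
      using K(1) by (intro borel_measurable_times meas borel_measurable_indicator) (simp add: compact_imp_closed)
    note D = km hm integrable_norm[OF int[OF w[of 0]]] AE_I2[OF lim] AE_I2[OF bound]
    show "integrable lebesgue (\<lambda>x. indicator K x * h x)"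
      by (rule integrable_dominated_convergence[OF D])
    have "(\<lambda>j. \<integral>x. w j x * h x \<partial>lebesgue) \<longlonglongrightarrow> (\<integral>x. indicator K x * h x \<partial>lebesgue)"
      by (rule integral_dominated_convergence[OF D])
    then show "0 \<le> (\<integral>x. indicator K x * h x \<partial>lebesgue)"
      by (rule LIMSEQ_le_const) (use nonneg[OF w] in auto)
  qed
  define N where "N = {x. h x < 0}"
  have N: "N \<in> sets lebesgue"
    using borel_measurable_less[OF meas borel_measurable_const[of 0]] by (simp add: N_def)
  have null: "N \<inter> cball 0 (real n) \<in> null_sets lebesgue" for n
  proof (rule ccontr)
    define S where "S = N \<inter> cball 0 (real n)"
    assume "N \<inter> cball 0 (real n) \<notin> null_sets lebesgue"
    moreover have S: "S \<in> sets lebesgue" unfolding S_def by (intro sets.Int N fmeasurableD[OF lmeasurable_cball])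
    ultimately have pos: "emeasure lebesgue S \<noteq> 0" by (simp add: S_def null_sets_def)
    have "emeasure lebesgue S \<le> emeasure lebesgue (cball (0::'a) (real n))"
      by (intro emeasure_mono) (auto simp: S_def)
    also have "\<dots> < \<infinity>" using emeasure_bounded_finite[of "cball (0::'a) (real n)"] by simp
    finally have fin: "emeasure lebesgue S < \<infinity>" .
    define s where "s = measure lebesgue S"
    have s: "emeasure lebesgue S = ennreal s"
      unfolding s_def by (rule emeasure_eq_ennreal_measure) (use fin in simp)
    have "s > 0" using pos s by (simp add: ennreal_eq_0_iff not_le)
    then obtain T where T: "closed T" "T \<subseteq> S" "S - T \<in> lmeasurable" "emeasure lebesgue (S - T) < ennreal s"
      using sets_lebesgue_inner_closed[OF S] by metis
    have Tsets: "T \<in> sets lebesgue" using T(1) by (simp add: borel_closed)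
    have Tpos: "emeasure lebesgue T \<noteq> 0"
    proof
      assume 0: "emeasure lebesgue T = 0"
      have "emeasure lebesgue S \<le> emeasure lebesgue T + emeasure lebesgue (S - T)"
        using emeasure_subadditive[of T lebesgue "S - T"] Tsets S T(2) by (simp add: Un_absorb1)
      then show False using 0 T(4) s by simp
    qed
    have cT: "compact T"
      using T(1,2) bounded_subset[OF bounded_cball[of "0::'a" "real n"], of T] by (auto simp: S_def compact_eq_bounded_closed)
    have neT: "T \<noteq> {}" using Tpos by auto
    have neg: "h x < 0" if "x \<in> T" for x using that T(2) by (auto simp: S_def N_def)
    have i: "integrable lebesgue (\<lambda>x. - (indicator T x * h x))"
      using compact(1)[OF cT neT] by simp
    have pw: "0 \<le> - (indicator T x * h x)" for x
      using neg[of x] by (cases "x \<in> T") auto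
    have "(\<integral>x. - (indicator T x * h x) \<partial>lebesgue) = 0"
      using compact(2)[OF cT neT] Bochner_Integration.integral_nonneg[of lebesgue "\<lambda>x. - (indicator T x * h x)", OF pw] by simp
    then have "AE x in lebesgue. - (indicator T x * h x) = 0"
      using integral_nonneg_eq_0_iff_AE[OF i] pw by simp
    then have "AE x in lebesgue. x \<notin> T"
      by eventually_elim (use neg in \<open>force split: split_indicator_asm\<close>)
    then have "T \<in> null_sets lebesgue" using AE_iff_null_sets[OF Tsets] by simp
    then show False using Tpos by (simp add: null_sets_def)
  qed
  have "(\<Union>n. N \<inter> cball 0 (real n)) \<in> null_sets lebesgue"
    by (intro null_sets_UN null)
  moreover have "(\<Union>n. N \<inter> cball 0 (real n)) = N"
    using real_arch_simple by (fastforce simp: mem_cball)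
  ultimately have "AE x in lebesgue. x \<notin> N"
    by (intro AE_not_in) simp
  then show ?thesis by eventually_elim (simp add: N_def)
qed

lemma AE_symbol_le:
  fixes a1 :: "('n::finite \<Rightarrow> nat) \<Rightarrow> real ^ 'n \<Rightarrow> 'v::real_inner \<Rightarrow>\<^sub>L 'w1::real_inner"
    and a2 :: "('n \<Rightarrow> nat) \<Rightarrow> real ^ 'n \<Rightarrow> 'v \<Rightarrow>\<^sub>L 'w2::real_inner"
  assumes c1: "coefficients k a1" and c2: "coefficients k a2" and c: "c \<ge> 0"
    and le: "\<And>\<phi>. \<phi> \<in> test_functions \<Longrightarrow> L1_norm (diff_op k a2 \<phi>) \<le> ennreal c * L1_norm (diff_op k a1 \<phi>)"
  shows "AE x in lebesgue. norm (symbol_op k a2 x \<xi>) \<le> c * norm (symbol_op k a1 x \<xi>)"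
proof -
  interpret C1: coefficients k a1 by (rule c1)
  interpret C2: coefficients k a2 by (rule c2)
  define h where "h x = c * norm (symbol_op k a1 x \<xi>) - norm (symbol_op k a2 x \<xi>)" for x
  have eq: "w x * h x = c * (w x * norm (symbol_op k a1 x \<xi>)) - w x * norm (symbol_op k a2 x \<xi>)" for w x
    by (simp add: h_def right_diff_distrib)
  have "AE x in lebesgue. 0 \<le> h x"
  proof (rule AE_nonneg_of_weighted)
    show "h \<in> borel_measurable lebesgue"
      unfolding h_def
      by (intro borel_measurable_diff borel_measurable_times borel_measurable_const
          C1.symbol_op_measurable_const C2.symbol_op_measurable_const)
    fix w :: "real ^ 'n \<Rightarrow> real" assume w: "weight w"
    note i1 = C1.weighted_integrable[OF w, of \<xi>] and i2 = C2.weighted_integrable[OF w, of \<xi>]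
    show "integrable lebesgue (\<lambda>x. w x * h x)"
      unfolding eq by (intro Bochner_Integration.integrable_diff Bochner_Integration.integrable_mult_right i1 i2)
    have "(\<integral>x. w x * h x \<partial>lebesgue) = c * C1.weighted_norm w \<xi> - C2.weighted_norm w \<xi>"
      unfolding eq C1.weighted_norm_def C2.weighted_norm_def
      by (subst Bochner_Integration.integral_diff[OF Bochner_Integration.integrable_mult_right[OF i1] i2]) simp
    then show "0 \<le> (\<integral>x. w x * h x \<partial>lebesgue)"
      using weighted_norm_le[OF c1 c2 c w le, of \<xi>] by simp
  qed
  then show ?thesis by (simp add: h_def)
qed

lemma tendsto_symbol_op:
  assumes "\<And>\<alpha>. \<alpha> \<in> multi_indices k \<Longrightarrow> (\<lambda>m. \<Xi> m \<alpha>) \<longlonglongrightarrow> \<xi> \<alpha>"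
  shows "(\<lambda>m. symbol_op k a x (\<Xi> m)) \<longlonglongrightarrow> symbol_op k a x \<xi>"
  unfolding symbol_op_def using assms by (intro tendsto_intros)

text \<open>
  The exceptional null set depends on \<open>\<xi>\<close>. It suffices to consider the countably many jets with
  rational coordinates, since both sides are continuous in \<open>\<xi>\<close>.
\<close>

lemma AE_all_symbol_le:
  fixes a1 :: "('n::finite \<Rightarrow> nat) \<Rightarrow> real ^ 'n \<Rightarrow> 'v::real_inner \<Rightarrow>\<^sub>L 'w1::real_inner"
    and a2 :: "('n \<Rightarrow> nat) \<Rightarrow> real ^ 'n \<Rightarrow> 'v \<Rightarrow>\<^sub>L 'w2::real_inner"
  assumes c1: "coefficients k a1" and c2: "coefficients k a2" and c: "c \<ge> 0"
    and le: "\<And>\<phi>. \<phi> \<in> test_functions \<Longrightarrow> L1_norm (diff_op k a2 \<phi>) \<le> ennreal c * L1_norm (diff_op k a1 \<phi>)"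
  shows "AE x in lebesgue. \<forall>\<xi>. norm (symbol_op k a2 x \<xi>) \<le> c * norm (symbol_op k a1 x \<xi>)"
proof -
  obtain B :: "'v set" where B: "parseval_frame B"
    using exists_parseval_frame[OF coefficients.fdv[OF c1]] ..
  define I where "I = (multi_indices k :: ('n \<Rightarrow> nat) set) \<times> B"
  have finI: "finite I" by (simp add: I_def finite_multi_indices parseval_frame_finite[OF B])
  define Q where "Q = PiE I (\<lambda>_. \<rat> :: real set)"
  define rat_jet where "rat_jet q \<alpha> = (\<Sum>b\<in>B. q (\<alpha>, b) *\<^sub>R b)" for q :: "('n \<Rightarrow> nat) \<times> 'v \<Rightarrow> real" and \<alpha>
  have "countable Q" unfolding Q_def by (intro countable_PiE finI countable_rat)
  then have "AE x in lebesgue. \<forall>q\<in>Q. norm (symbol_op k a2 x (rat_jet q)) \<le> c * norm (symbol_op k a1 x (rat_jet q))"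
    by (subst AE_ball_countable) (auto intro: AE_symbol_le[OF c1 c2 c le])
  then show ?thesis
  proof eventually_elim
    case (elim x)
    show ?case
    proof
      fix \<xi> :: "('n \<Rightarrow> nat) \<Rightarrow> 'v"
      have "\<exists>q. (\<forall>m. q m \<in> \<rat>) \<and> q \<longlonglongrightarrow> t" for t :: real
        by (rule exists_rational_sequence[of t]) blast
      then have "\<forall>t :: real. \<exists>q. (\<forall>m. q m \<in> \<rat>) \<and> q \<longlonglongrightarrow> t" ..
      from choice[OF this] obtain r where r: "\<forall>t :: real. (\<forall>m. r t m \<in> \<rat>) \<and> r t \<longlonglongrightarrow> t" ..
      define q where "q m = restrict (\<lambda>p. r (\<xi> (fst p) \<bullet> snd p) m) I" for m
      have qQ: "q m \<in> Q" for m using r by (auto simp: q_def Q_def)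
      have rat_jet_eq: "rat_jet (q m) \<alpha> = (\<Sum>b\<in>B. r (\<xi> \<alpha> \<bullet> b) m *\<^sub>R b)" if "\<alpha> \<in> multi_indices k" for m \<alpha>
        unfolding rat_jet_def q_def using that by (intro sum.cong refl) (simp add: I_def)
      have "(\<lambda>m. rat_jet (q m) \<alpha>) \<longlonglongrightarrow> \<xi> \<alpha>" if \<alpha>: "\<alpha> \<in> multi_indices k" for \<alpha>
      proof -
        have "(\<lambda>m. \<Sum>b\<in>B. r (\<xi> \<alpha> \<bullet> b) m *\<^sub>R b) \<longlonglongrightarrow> (\<Sum>b\<in>B. (\<xi> \<alpha> \<bullet> b) *\<^sub>R b)"
          using r by (intro tendsto_sum tendsto_scaleR tendsto_const) blast
        then show ?thesis unfolding rat_jet_eq[OF \<alpha>] parseval_frame_expand[OF B] .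
      qed
      then have lim: "(\<lambda>m. symbol_op k a1 x (rat_jet (q m))) \<longlonglongrightarrow> symbol_op k a1 x \<xi>"
        "(\<lambda>m. symbol_op k a2 x (rat_jet (q m))) \<longlonglongrightarrow> symbol_op k a2 x \<xi>"
        by (intro tendsto_symbol_op; assumption)+
      show "norm (symbol_op k a2 x \<xi>) \<le> c * norm (symbol_op k a1 x \<xi>)"
        by (rule LIMSEQ_le[OF tendsto_norm[OF lim(2)] tendsto_mult[OF tendsto_const tendsto_norm[OF lim(1)]]])
          (use elim qQ in blast)
    qed
  qed
qed

section \<open>Measurable Gram-Schmidt orthonormalisation\<close>

text \<open>
  The vectors \<open>q i\<close> are the output of the Gram-Schmidt process for the family \<open>u\<close>, with zero vectors
  wherever the family is linearly dependent, and \<open>p i\<close> is the same linear combination of \<open>z\<close> that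
  \<open>q i\<close> is of \<open>u\<close>. Recording this as membership of pairs in a span avoids naming the coefficients.
\<close>

definition orthonormalises :: "'i set \<Rightarrow> ('i \<Rightarrow> 'w1::real_inner) \<Rightarrow> ('i \<Rightarrow> 'w2::real_vector) \<Rightarrow> ('i \<Rightarrow> 'w1) \<Rightarrow> ('i \<Rightarrow> 'w2) \<Rightarrow> bool" where
  "orthonormalises I u z q p \<longleftrightarrow>
    (\<forall>i\<in>I. (q i, p i) \<in> span ((\<lambda>i. (u i, z i)) ` I)) \<and>
    (\<forall>i\<in>I. \<forall>j\<in>I. i \<noteq> j \<longrightarrow> q i \<bullet> q j = 0) \<and>
    (\<forall>i\<in>I. q i = 0 \<or> q i \<bullet> q i = 1) \<and>
    (\<forall>i\<in>I. (\<Sum>j\<in>I. (u i \<bullet> q j) *\<^sub>R q j) = u i)"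

lemma orthonormalisesD:
  assumes "orthonormalises I u z q p" "i \<in> I"
  shows "(q i, p i) \<in> span ((\<lambda>i. (u i, z i)) ` I)" "q i = 0 \<or> q i \<bullet> q i = 1"
    "(\<Sum>j\<in>I. (u i \<bullet> q j) *\<^sub>R q j) = u i"
    and "j \<in> I \<Longrightarrow> i \<noteq> j \<Longrightarrow> q i \<bullet> q j = 0"
  using assms unfolding orthonormalises_def by simp_all

lemma inner_orthonormalised_sum:
  assumes on: "orthonormalises I u z q p" and fin: "finite I" and j: "j \<in> I"
  shows "(\<Sum>l\<in>I. (w \<bullet> q l) *\<^sub>R q l) \<bullet> q j = w \<bullet> q j"
proof -
  have "(\<Sum>l\<in>I. (w \<bullet> q l) * (q l \<bullet> q j)) = (\<Sum>l\<in>I. if l = j then w \<bullet> q j else 0)"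
  proof (rule sum.cong[OF refl])
    fix l assume "l \<in> I"
    then show "(w \<bullet> q l) * (q l \<bullet> q j) = (if l = j then w \<bullet> q j else 0)"
      using orthonormalisesD(4)[OF on _ j, of l] orthonormalisesD(2)[OF on j] by (cases "l = j") auto
  qed
  then show ?thesis using fin j by (simp add: inner_sum_left)
qed

text \<open>
  One step of the Gram-Schmidt process. If the new vector depends on the previous ones, then \<open>r = 0\<close> and
  the convention \<open>inverse 0 = 0\<close> makes both new entries zero.
\<close>

lemma orthonormalises_insert:
  assumes on: "orthonormalises I u z q p" and fin: "finite I" and i0: "i0 \<notin> I"
  defines "r \<equiv> u i0 - (\<Sum>j\<in>I. (u i0 \<bullet> q j) *\<^sub>R q j)"
    and "t \<equiv> z i0 - (\<Sum>j\<in>I. (u i0 \<bullet> q j) *\<^sub>R p j)"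
  shows "orthonormalises (insert i0 I) u z
    (q(i0 := inverse (norm r) *\<^sub>R r)) (p(i0 := inverse (norm r) *\<^sub>R t))"
proof -
  define e where "e = inverse (norm r) *\<^sub>R r"
  define d where "d = inverse (norm r) *\<^sub>R t"
  have r_orth: "r \<bullet> q j = 0" if "j \<in> I" for j
    using inner_orthonormalised_sum[OF on fin that, of "u i0"] by (simp add: r_def inner_diff_left)
  then have e_orth: "e \<bullet> q j = 0" "q j \<bullet> e = 0" if "j \<in> I" for j
    using that by (simp_all add: e_def inner_commute)
  have "(\<Sum>j\<in>I. (u i0 \<bullet> q j) *\<^sub>R q j) \<bullet> r = 0"
    using r_orth by (subst inner_commute) (simp add: inner_sum_right)
  then have ur: "u i0 \<bullet> r = r \<bullet> r" by (simp add: r_def inner_diff_left)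
  have e_part: "(u i0 \<bullet> e) *\<^sub>R e = r"
  proof (cases "r = 0")
    case False
    then have "u i0 \<bullet> e = norm r" using ur by (simp add: e_def dot_square_norm power2_eq_square)
    then show ?thesis using False by (simp add: e_def)
  qed (simp add: e_def)
  have unit: "e = 0 \<or> e \<bullet> e = 1"
    by (cases "r = 0") (simp_all add: e_def dot_square_norm power2_eq_square)
  let ?S = "span ((\<lambda>i. (u i, z i)) ` insert i0 I)"
  have sub: "span ((\<lambda>i. (u i, z i)) ` I) \<subseteq> ?S" by (intro span_mono) auto
  have "(r, t) = (u i0, z i0) - (\<Sum>j\<in>I. (u i0 \<bullet> q j) *\<^sub>R (q j, p j))"
    by (simp add: r_def t_def prod_eq_iff fst_sum snd_sum)
  moreover have "(u i0, z i0) \<in> ?S" by (rule span_base) simp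
  moreover have "(\<Sum>j\<in>I. (u i0 \<bullet> q j) *\<^sub>R (q j, p j)) \<in> ?S"
    by (rule span_sum, rule span_scale) (use orthonormalisesD(1)[OF on] sub in blast)
  ultimately have "(r, t) \<in> ?S" by (simp only: span_diff)
  then have "inverse (norm r) *\<^sub>R (r, t) \<in> ?S" by (rule span_scale)
  then have ed: "(e, d) \<in> ?S" by (simp add: e_def d_def)
  define q' where "q' = q(i0 := e)"
  define p' where "p' = p(i0 := d)"
  have new: "q' i0 = e" "p' i0 = d" by (simp_all add: q'_def p'_def)
  have old: "q' i = q i" "p' i = p i" if "i \<in> I" for i
    using that i0 by (auto simp: q'_def p'_def)
  have "orthonormalises (insert i0 I) u z q' p'"
    unfolding orthonormalises_def
  proof (intro conjI ballI impI)
    fix i assume i: "i \<in> insert i0 I"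
    show "(q' i, p' i) \<in> ?S"
    proof (cases "i = i0")
      case True
      then show ?thesis using ed by (simp add: new)
    next
      case False
      then show ?thesis using i orthonormalisesD(1)[OF on, of i] sub by (auto simp: old)
    qed
    show "q' i = 0 \<or> q' i \<bullet> q' i = 1"
    proof (cases "i = i0")
      case True
      then show ?thesis using unit by (simp add: new)
    next
      case False
      then show ?thesis using i orthonormalisesD(2)[OF on, of i] by (simp add: old)
    qed
    have sum_eq: "(\<Sum>j\<in>insert i0 I. (w \<bullet> q' j) *\<^sub>R q' j) = (w \<bullet> e) *\<^sub>R e + (\<Sum>j\<in>I. (w \<bullet> q j) *\<^sub>R q j)" for w
      using fin i0 by (simp add: old new)
    show "(\<Sum>j\<in>insert i0 I. (u i \<bullet> q' j) *\<^sub>R q' j) = u i"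
    proof (cases "i = i0")
      case True
      then show ?thesis unfolding sum_eq by (simp add: e_part) (simp add: r_def)
    next
      case False
      then have iI: "i \<in> I" using i by simp
      have "(\<Sum>j\<in>I. (u i \<bullet> q j) *\<^sub>R q j) \<bullet> e = 0"
        using e_orth by (simp add: inner_sum_left)
      then have "u i \<bullet> e = 0" unfolding orthonormalisesD(3)[OF on iI] .
      then show ?thesis unfolding sum_eq orthonormalisesD(3)[OF on iI] by simp
    qed
    fix j assume j: "j \<in> insert i0 I" and ij: "i \<noteq> j"
    consider "i = i0" "j \<in> I" | "i \<in> I" "j = i0" | "i \<in> I" "j \<in> I" using i j ij by blast
    then show "q' i \<bullet> q' j = 0"
      using e_orth orthonormalisesD(4)[OF on _ _ ij] by cases (simp_all add: old new)
  qed
  then show ?thesis by (simp only: q'_def p'_def e_def d_def)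
qed

text \<open>
  Every step of the process is an explicit formula in inner products and norms, hence preserves
  measurability in the parameter.
\<close>

lemma measurable_gram_schmidt:
  fixes u :: "'i \<Rightarrow> 'a \<Rightarrow> 'w1::real_inner" and z :: "'i \<Rightarrow> 'a \<Rightarrow> 'w2::real_inner"
  assumes fd: "finite_dimensional TYPE('w1::real_inner)" and fin: "finite I"
    and u: "\<And>i. i \<in> I \<Longrightarrow> weakly_measurable M (u i)" and z: "\<And>i. i \<in> I \<Longrightarrow> weakly_measurable M (z i)"
  shows "\<exists>q p. (\<forall>i\<in>I. weakly_measurable M (q i) \<and> weakly_measurable M (p i)) \<and>
    (\<forall>x. orthonormalises I (\<lambda>i. u i x) (\<lambda>i. z i x) (\<lambda>i. q i x) (\<lambda>i. p i x))"
  using fin u z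
proof (induction I)
  case empty
  show ?case by (simp add: orthonormalises_def)
next
  case (insert i0 I)
  have "\<exists>q p. (\<forall>i\<in>I. weakly_measurable M (q i) \<and> weakly_measurable M (p i)) \<and>
    (\<forall>x. orthonormalises I (\<lambda>i. u i x) (\<lambda>i. z i x) (\<lambda>i. q i x) (\<lambda>i. p i x))"
    by (rule insert.IH) (use insert.prems in simp_all)
  then obtain q p where wm: "\<forall>i\<in>I. weakly_measurable M (q i) \<and> weakly_measurable M (p i)"
    and on: "\<forall>x. orthonormalises I (\<lambda>i. u i x) (\<lambda>i. z i x) (\<lambda>i. q i x) (\<lambda>i. p i x)"
    by (elim exE conjE)
  define r where "r x = u i0 x - (\<Sum>j\<in>I. (u i0 x \<bullet> q j x) *\<^sub>R q j x)" for x
  define t where "t x = z i0 x - (\<Sum>j\<in>I. (u i0 x \<bullet> q j x) *\<^sub>R p j x)" for x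
  define q' where "q' = q(i0 := \<lambda>x. inverse (norm (r x)) *\<^sub>R r x)"
  define p' where "p' = p(i0 := \<lambda>x. inverse (norm (r x)) *\<^sub>R t x)"
  have um: "weakly_measurable M (u i0)" "weakly_measurable M (z i0)" using insert.prems by simp_all
  have coeff: "(\<lambda>x. u i0 x \<bullet> q j x) \<in> borel_measurable M" if "j \<in> I" for j
    using wm that by (intro weakly_measurable_inner fd um) simp
  have diff_wm: "weakly_measurable M (\<lambda>x. f x - g x)" if "weakly_measurable M f" "weakly_measurable M g"
    for f g :: "'a \<Rightarrow> 'b::real_inner"
    using that unfolding weakly_measurable_def inner_diff_left by (intro allI borel_measurable_diff) blast+
  have rm: "weakly_measurable M r"
    unfolding r_def using wm by (intro diff_wm um weakly_measurable_sum weakly_measurable_scaleR coeff) simp_all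
  have tm: "weakly_measurable M t"
    unfolding t_def using wm by (intro diff_wm um weakly_measurable_sum weakly_measurable_scaleR coeff) simp_all
  have im: "(\<lambda>x. inverse (norm (r x))) \<in> borel_measurable M"
    by (intro borel_measurable_inverse weakly_measurable_norm fd rm)
  have "weakly_measurable M (q' i) \<and> weakly_measurable M (p' i)" if "i \<in> insert i0 I" for i
    using that wm weakly_measurable_scaleR[OF im rm] weakly_measurable_scaleR[OF im tm]
    by (cases "i = i0") (simp_all add: q'_def p'_def)
  moreover have "orthonormalises (insert i0 I) (\<lambda>i. u i x) (\<lambda>i. z i x) (\<lambda>i. q' i x) (\<lambda>i. p' i x)" for x
  proof -
    have "(\<lambda>i. q' i x) = (\<lambda>i. q i x)(i0 := inverse (norm (r x)) *\<^sub>R r x)"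
      "(\<lambda>i. p' i x) = (\<lambda>i. p i x)(i0 := inverse (norm (r x)) *\<^sub>R t x)"
      by (auto simp: q'_def p'_def)
    then show ?thesis
      using orthonormalises_insert[OF on[rule_format] insert.hyps, of x] by (simp only: r_def t_def)
  qed
  ultimately show ?case by blast
qed

section \<open>The multiplier\<close>

text \<open>
  The operator \<open>\<lambda>w. \<Sum>j\<in>I. (w \<bullet> q j) *\<^sub>R p j\<close>, written with scalar coefficients in front of fixed
  operators so that it is visibly measurable in \<open>q\<close> and \<open>p\<close>.
\<close>

definition rank_one_sum :: "'i set \<Rightarrow> 'w1::real_inner set \<Rightarrow> 'w2::real_inner set \<Rightarrow> ('i \<Rightarrow> 'w1) \<Rightarrow> ('i \<Rightarrow> 'w2) \<Rightarrow> 'w1 \<Rightarrow>\<^sub>L 'w2" where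
  "rank_one_sum I B1 B2 q p = (\<Sum>(j, e, f)\<in>I \<times> B1 \<times> B2.
    ((q j \<bullet> e) * (p j \<bullet> f)) *\<^sub>R (blinfun_scaleR_left f o\<^sub>L blinfun_inner_right e))"

lemma rank_one_sum_apply:
  assumes B1: "parseval_frame B1" and B2: "parseval_frame B2"
  shows "blinfun_apply (rank_one_sum I B1 B2 q p) w = (\<Sum>j\<in>I. (w \<bullet> q j) *\<^sub>R p j)"
proof -
  have "blinfun_apply (rank_one_sum I B1 B2 q p) w
      = (\<Sum>(j, e, f)\<in>I \<times> B1 \<times> B2. ((q j \<bullet> e) * (p j \<bullet> f) * (e \<bullet> w)) *\<^sub>R f)"
    by (simp add: rank_one_sum_def blinfun.sum_left blinfun.scaleR_left case_prod_unfold)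
  also have "\<dots> = (\<Sum>j\<in>I. \<Sum>e\<in>B1. \<Sum>f\<in>B2. ((q j \<bullet> e) * (p j \<bullet> f) * (e \<bullet> w)) *\<^sub>R f)"
    by (simp add: sum.cartesian_product)
  also have "\<dots> = (\<Sum>j\<in>I. (w \<bullet> q j) *\<^sub>R p j)"
  proof (rule sum.cong[OF refl])
    fix j
    have "(\<Sum>e\<in>B1. (q j \<bullet> e) *\<^sub>R e) \<bullet> w = (\<Sum>e\<in>B1. (q j \<bullet> e) * (e \<bullet> w))"
      by (simp add: inner_sum_left)
    then have s: "(\<Sum>e\<in>B1. (q j \<bullet> e) * (e \<bullet> w)) = w \<bullet> q j"
      unfolding parseval_frame_expand[OF B1] by (simp add: inner_commute)
    have "(\<Sum>e\<in>B1. \<Sum>f\<in>B2. ((q j \<bullet> e) * (p j \<bullet> f) * (e \<bullet> w)) *\<^sub>R f)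
        = (\<Sum>e\<in>B1. ((q j \<bullet> e) * (e \<bullet> w)) *\<^sub>R (\<Sum>f\<in>B2. (p j \<bullet> f) *\<^sub>R f))"
      by (simp add: scaleR_sum_right mult_ac)
    also have "\<dots> = (\<Sum>e\<in>B1. (q j \<bullet> e) * (e \<bullet> w)) *\<^sub>R p j"
      unfolding parseval_frame_expand[OF B2] by (rule scaleR_sum_left[symmetric])
    finally show "(\<Sum>e\<in>B1. \<Sum>f\<in>B2. ((q j \<bullet> e) * (p j \<bullet> f) * (e \<bullet> w)) *\<^sub>R f) = (w \<bullet> q j) *\<^sub>R p j"
      unfolding s .
  qed
  finally show ?thesis .
qed

lemma rank_one_sum_measurable:
  assumes "finite I" "finite B1" "finite B2"
    and q: "\<And>j. j \<in> I \<Longrightarrow> weakly_measurable M (q j)" and p: "\<And>j. j \<in> I \<Longrightarrow> weakly_measurable M (p j)"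
  shows "(\<lambda>x. rank_one_sum I B1 B2 (\<lambda>j. q j x) (\<lambda>j. p j x)) \<in> borel_measurable M"
proof -
  have "(\<lambda>x. \<Sum>i\<in>I \<times> B1 \<times> B2. ((q (fst i) x \<bullet> fst (snd i)) * (p (fst i) x \<bullet> snd (snd i))) *\<^sub>R
      (blinfun_scaleR_left (snd (snd i)) o\<^sub>L blinfun_inner_right (fst (snd i)))) \<in> borel_measurable M"
    using assms(1-3)
    by (intro borel_measurable_sum_scaleR borel_measurable_times weakly_measurableD q p) auto
  then show ?thesis by (simp add: rank_one_sum_def case_prod_unfold)
qed

text \<open>
  If the pairs \<open>(u i, z i)\<close> span the graph of a map of norm at most \<open>c\<close>, then the operator built from
  \<open>q\<close> and \<open>p\<close> is this map composed with the orthogonal projection \<open>P\<close> onto the span of the \<open>u i\<close>.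
\<close>

lemma factor_through_orthonormalised:
  assumes on: "orthonormalises I u z q p" and fin: "finite I" and c: "c \<ge> 0"
    and le: "\<And>v y. (v, y) \<in> span ((\<lambda>i. (u i, z i)) ` I) \<Longrightarrow> norm y \<le> c * norm v"
  shows "norm (\<Sum>j\<in>I. (w \<bullet> q j) *\<^sub>R p j) \<le> c * norm w"
    and "(v, y) \<in> span ((\<lambda>i. (u i, z i)) ` I) \<Longrightarrow> (\<Sum>j\<in>I. (v \<bullet> q j) *\<^sub>R p j) = y"
proof -
  let ?S = "span ((\<lambda>i. (u i, z i)) ` I)"
  define P where "P w = (\<Sum>j\<in>I. (w \<bullet> q j) *\<^sub>R q j)" for w
  define T where "T w = (\<Sum>j\<in>I. (w \<bullet> q j) *\<^sub>R p j)" for w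
  have PT: "(P w, T w) \<in> ?S" for w
  proof -
    have "(P w, T w) = (\<Sum>j\<in>I. (w \<bullet> q j) *\<^sub>R (q j, p j))"
      by (simp add: P_def T_def prod_eq_iff fst_sum snd_sum)
    also have "\<dots> \<in> ?S"
      by (rule span_sum, rule span_scale, rule orthonormalisesD(1)[OF on])
    finally show ?thesis .
  qed
  have norm_P: "norm (P w) \<le> norm w" for w
  proof -
    have "P w \<bullet> P w = (\<Sum>j\<in>I. (w \<bullet> q j) * (P w \<bullet> q j))"
      by (subst (2) P_def) (simp add: inner_sum_right)
    also have "\<dots> = (\<Sum>j\<in>I. (w \<bullet> q j) * (w \<bullet> q j))"
      by (rule sum.cong[OF refl]) (simp add: P_def inner_orthonormalised_sum[OF on fin])
    also have "\<dots> = w \<bullet> P w" by (simp add: P_def inner_sum_right)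
    also have "\<dots> \<le> norm w * norm (P w)" by (rule norm_cauchy_schwarz)
    finally have "norm (P w) * norm (P w) \<le> norm w * norm (P w)"
      by (simp add: dot_square_norm power2_eq_square)
    then show ?thesis by (cases "P w = 0") auto
  qed
  have "norm (T w) \<le> c * norm (P w)" by (rule le[OF PT])
  also have "\<dots> \<le> c * norm w" using c norm_P by (intro mult_left_mono)
  finally show "norm (\<Sum>j\<in>I. (w \<bullet> q j) *\<^sub>R p j) \<le> c * norm w" by (simp only: T_def)
  assume vy: "(v, y) \<in> ?S"
  have "fst x = P (fst x)" if "x \<in> ?S" for x
    using that
  proof (rule span_induct)
    show "fst x = P (fst x)" if "x \<in> (\<lambda>i. (u i, z i)) ` I" for x
      using that orthonormalisesD(3)[OF on] by (auto simp: P_def)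
    have lin: "P (a + b) = P a + P b" "P (r *\<^sub>R a) = r *\<^sub>R P a" "P 0 = 0" for a b r
      by (simp_all add: P_def inner_add_left scaleR_add_left sum.distrib scaleR_sum_right)
    show "subspace {x. fst x = P (fst x)}"
      unfolding subspace_def by (simp add: lin)
  qed
  from this[OF vy] have "P v = v" by simp
  then have "(P v, T v) - (v, y) = (0, T v - y)" by simp
  moreover have "(P v, T v) - (v, y) \<in> ?S" by (intro span_diff PT vy)
  ultimately have "norm (T v - y) \<le> c * norm (0 :: 'b)" using le by metis
  then show "(\<Sum>j\<in>I. (v \<bullet> q j) *\<^sub>R p j) = y" by (simp add: T_def)
qed

text \<open>
  The process is applied at each \<open>x\<close> to the images of a spanning set of jets under the two operators,
  whose joint span consists of the pairs \<open>(A\<^sub>1 x \<xi>, A\<^sub>2 x \<xi>)\<close>.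
\<close>

lemma exists_multiplier:
  fixes a1 :: "('n::finite \<Rightarrow> nat) \<Rightarrow> real ^ 'n \<Rightarrow> 'v::real_inner \<Rightarrow>\<^sub>L 'w1::real_inner"
    and a2 :: "('n \<Rightarrow> nat) \<Rightarrow> real ^ 'n \<Rightarrow> 'v \<Rightarrow>\<^sub>L 'w2::real_inner"
  assumes c1: "coefficients k a1" and c2: "coefficients k a2" and c: "c \<ge> 0"
    and le: "AE x in lebesgue. \<forall>\<xi>. norm (symbol_op k a2 x \<xi>) \<le> c * norm (symbol_op k a1 x \<xi>)"
  shows "\<exists>C :: real ^ 'n \<Rightarrow> 'w1 \<Rightarrow>\<^sub>L 'w2. C \<in> borel_measurable lebesgue \<and> (AE x in lebesgue. norm (C x) \<le> c) \<and>
    (AE x in lebesgue. \<forall>\<alpha>\<in>multi_indices k. a2 \<alpha> x = C x o\<^sub>L a1 \<alpha> x)"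
proof -
  interpret C1: coefficients k a1 by (rule c1)
  interpret C2: coefficients k a2 by (rule c2)
  obtain B :: "'v set" where B: "parseval_frame B" using exists_parseval_frame[OF C1.fdv] ..
  obtain B1 :: "'w1 set" where B1: "parseval_frame B1" using exists_parseval_frame[OF C1.fdw] ..
  obtain B2 :: "'w2 set" where B2: "parseval_frame B2" using exists_parseval_frame[OF C2.fdw] ..
  define I where "I = (multi_indices k :: ('n \<Rightarrow> nat) set) \<times> B"
  have finI: "finite I" by (simp add: I_def finite_multi_indices parseval_frame_finite[OF B])
  define u where "u i x = blinfun_apply (a1 (fst i) x) (snd i)" for i x
  define z where "z i x = blinfun_apply (a2 (fst i) x) (snd i)" for i x
  have idm: "(\<lambda>x. x) \<in> measurable lebesgue (lebesgue :: (real ^ 'n) measure)" by simp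
  have um: "weakly_measurable lebesgue (u i)" if "i \<in> I" for i
    unfolding u_def using that
    by (intro weakly_measurable_blinfun_apply[OF C1.fdv C1.coeff_measurable idm] weakly_measurable_const) (auto simp: I_def)
  have zm: "weakly_measurable lebesgue (z i)" if "i \<in> I" for i
    unfolding z_def using that
    by (intro weakly_measurable_blinfun_apply[OF C2.fdv C2.coeff_measurable idm] weakly_measurable_const) (auto simp: I_def)
  have "\<exists>q p. (\<forall>i\<in>I. weakly_measurable lebesgue (q i) \<and> weakly_measurable lebesgue (p i)) \<and>
    (\<forall>x. orthonormalises I (\<lambda>i. u i x) (\<lambda>i. z i x) (\<lambda>i. q i x) (\<lambda>i. p i x))"
    by (rule measurable_gram_schmidt[OF C1.fdw finI um zm])
  then obtain q p where wm: "\<forall>i\<in>I. weakly_measurable lebesgue (q i) \<and> weakly_measurable lebesgue (p i)"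
    and on: "\<forall>x. orthonormalises I (\<lambda>i. u i x) (\<lambda>i. z i x) (\<lambda>i. q i x) (\<lambda>i. p i x)"
    by (elim exE conjE)
  define C where "C x = rank_one_sum I B1 B2 (\<lambda>j. q j x) (\<lambda>j. p j x)" for x
  have C_apply: "blinfun_apply (C x) w = (\<Sum>j\<in>I. (w \<bullet> q j x) *\<^sub>R p j x)" for x w
    unfolding C_def by (rule rank_one_sum_apply[OF B1 B2])
  have Cm: "C \<in> borel_measurable lebesgue"
    unfolding C_def using wm
    by (intro rank_one_sum_measurable finI parseval_frame_finite[OF B1] parseval_frame_finite[OF B2]) simp_all
  have range: "norm y \<le> c * norm v"
    if le: "\<forall>\<xi>. norm (symbol_op k a2 x \<xi>) \<le> c * norm (symbol_op k a1 x \<xi>)"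
      and vy: "(v, y) \<in> span ((\<lambda>i. (u i x, z i x)) ` I)" for x v y
  proof -
    define R where "R = range (\<lambda>\<xi>. (symbol_op k a1 x \<xi>, symbol_op k a2 x \<xi>))"
    have "span ((\<lambda>i. (u i x, z i x)) ` I) \<subseteq> R"
    proof (rule span_minimal)
      show "(\<lambda>i. (u i x, z i x)) ` I \<subseteq> R"
      proof
        fix t assume "t \<in> (\<lambda>i. (u i x, z i x)) ` I"
        then obtain \<alpha> b where \<alpha>: "\<alpha> \<in> multi_indices k" and t: "t = (u (\<alpha>, b) x, z (\<alpha>, b) x)"
          by (auto simp: I_def)
        define \<xi> where "\<xi> \<beta> = (if \<beta> = \<alpha> then b else 0)" for \<beta>
        have "symbol_op k a1 x \<xi> = (\<Sum>\<beta>\<in>multi_indices k. if \<beta> = \<alpha> then blinfun_apply (a1 \<alpha> x) b else 0)"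
          "symbol_op k a2 x \<xi> = (\<Sum>\<beta>\<in>multi_indices k. if \<beta> = \<alpha> then blinfun_apply (a2 \<alpha> x) b else 0)"
          unfolding symbol_op_def \<xi>_def by (intro sum.cong refl; simp)+
        then have "t = (symbol_op k a1 x \<xi>, symbol_op k a2 x \<xi>)"
          using \<alpha> by (simp add: t u_def z_def finite_multi_indices)
        then show "t \<in> R" by (simp add: R_def)
      qed
      show "subspace R"
      proof (rule subspaceI)
        have "0 = (symbol_op k a1 x (\<lambda>_. 0), symbol_op k a2 x (\<lambda>_. 0))"
          by (simp add: symbol_op_def zero_prod_def)
        then show "0 \<in> R" unfolding R_def by (intro range_eqI[where x = "\<lambda>_. 0"])
        fix s t assume "s \<in> R" "t \<in> R"
        then obtain \<xi> \<eta> where st: "s = (symbol_op k a1 x \<xi>, symbol_op k a2 x \<xi>)"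
          "t = (symbol_op k a1 x \<eta>, symbol_op k a2 x \<eta>)" by (auto simp: R_def)
        have "s + t = (symbol_op k a1 x (\<lambda>\<alpha>. \<xi> \<alpha> + \<eta> \<alpha>), symbol_op k a2 x (\<lambda>\<alpha>. \<xi> \<alpha> + \<eta> \<alpha>))"
          by (simp add: st symbol_op_def blinfun.add_right sum.distrib)
        then show "s + t \<in> R" unfolding R_def by (intro range_eqI[where x = "\<lambda>\<alpha>. \<xi> \<alpha> + \<eta> \<alpha>"])
        fix r :: real
        have "r *\<^sub>R s = (symbol_op k a1 x (\<lambda>\<alpha>. r *\<^sub>R \<xi> \<alpha>), symbol_op k a2 x (\<lambda>\<alpha>. r *\<^sub>R \<xi> \<alpha>))"
          by (simp add: st symbol_op_scaleR)
        then show "r *\<^sub>R s \<in> R" unfolding R_def by (intro range_eqI[where x = "\<lambda>\<alpha>. r *\<^sub>R \<xi> \<alpha>"])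
      qed
    qed
    then have "(v, y) \<in> R" using vy by blast
    then show ?thesis using le by (auto simp: R_def)
  qed
  have in_span: "(blinfun_apply (a1 \<alpha> x) v, blinfun_apply (a2 \<alpha> x) v) \<in> span ((\<lambda>i. (u i x, z i x)) ` I)"
    if \<alpha>: "\<alpha> \<in> multi_indices k" for \<alpha> x v
  proof -
    have "(blinfun_apply (a1 \<alpha> x) (\<Sum>b\<in>B. (v \<bullet> b) *\<^sub>R b), blinfun_apply (a2 \<alpha> x) (\<Sum>b\<in>B. (v \<bullet> b) *\<^sub>R b))
        = (\<Sum>b\<in>B. (v \<bullet> b) *\<^sub>R (u (\<alpha>, b) x, z (\<alpha>, b) x))"
      by (simp add: prod_eq_iff fst_sum snd_sum blinfun.sum_right blinfun.scaleR_right u_def z_def)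
    also have "\<dots> \<in> span ((\<lambda>i. (u i x, z i x)) ` I)"
      using \<alpha> by (intro span_sum span_scale span_base) (auto simp: I_def)
    finally show ?thesis unfolding parseval_frame_expand[OF B] .
  qed
  have "AE x in lebesgue. norm (C x) \<le> c"
    using le
  proof eventually_elim
    case (elim x)
    show ?case
      by (rule norm_blinfun_bound[OF c])
        (unfold C_apply, rule factor_through_orthonormalised(1)[OF on[rule_format] finI c range[OF elim]])
  qed
  moreover have "AE x in lebesgue. \<forall>\<alpha>\<in>multi_indices k. a2 \<alpha> x = C x o\<^sub>L a1 \<alpha> x"
    using le
  proof eventually_elim
    case (elim x)
    show ?case
    proof
      fix \<alpha> :: "'n \<Rightarrow> nat" assume \<alpha>: "\<alpha> \<in> multi_indices k"
      show "a2 \<alpha> x = C x o\<^sub>L a1 \<alpha> x"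
      proof (rule blinfun_eqI)
        fix v
        have "blinfun_apply (C x) (blinfun_apply (a1 \<alpha> x) v) = blinfun_apply (a2 \<alpha> x) v"
          unfolding C_apply
          by (rule factor_through_orthonormalised(2)[OF on[rule_format] finI c range[OF elim] in_span[OF \<alpha>]])
        then show "blinfun_apply (a2 \<alpha> x) v = blinfun_apply (C x o\<^sub>L a1 \<alpha> x) v" by simp
      qed
    qed
  qed
  ultimately show ?thesis using Cm by blast
qed

lemma L1_norm_le_of_multiplier:
  fixes a1 :: "('n::finite \<Rightarrow> nat) \<Rightarrow> real ^ 'n \<Rightarrow> 'v::real_inner \<Rightarrow>\<^sub>L 'w1::real_inner"
    and a2 :: "('n \<Rightarrow> nat) \<Rightarrow> real ^ 'n \<Rightarrow> 'v \<Rightarrow>\<^sub>L 'w2::real_inner"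
    and C :: "real ^ 'n \<Rightarrow> 'w1 \<Rightarrow>\<^sub>L 'w2"
  assumes c1: "coefficients k a1" and c: "c \<ge> 0" and Cc: "Linf_norm C \<le> ennreal c"
    and fac: "AE x in lebesgue. \<forall>\<alpha>\<in>multi_indices k. a2 \<alpha> x = C x o\<^sub>L a1 \<alpha> x"
    and \<phi>: "\<phi> \<in> test_functions"
  shows "L1_norm (diff_op k a2 \<phi>) \<le> ennreal c * L1_norm (diff_op k a1 \<phi>)"
proof -
  interpret C1: coefficients k a1 by (rule c1)
  have sm: "smooth \<phi>" using \<phi> by (simp add: test_functions_def)
  have wm: "weakly_measurable lebesgue (\<lambda>x. multi_deriv \<alpha> \<phi> x)" for \<alpha>
    by (intro weakly_measurable_continuous[OF continuous_on_multi_deriv[OF sm]] C1.id_lebesgue_borel)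
  have m: "(\<lambda>x. ennreal (norm (diff_op k a1 \<phi> x))) \<in> borel_measurable lebesgue"
    using C1.symbol_op_measurable[OF _ wm, of "\<lambda>x. x"] unfolding diff_op_eq
    by (intro measurable_compose[OF _ measurable_ennreal]) simp
  have "AE x in lebesgue. ennreal (norm (C x)) \<le> Linf_norm C"
    unfolding Linf_norm_def by (rule esssup_AE)
  then have "AE x in lebesgue. ennreal (norm (diff_op k a2 \<phi> x)) \<le> ennreal c * ennreal (norm (diff_op k a1 \<phi> x))"
    using fac
  proof eventually_elim
    case (elim x)
    have "norm (C x) \<le> c" using order_trans[OF elim(1) Cc] c by (simp add: ennreal_le_iff)
    have "diff_op k a2 \<phi> x = blinfun_apply (C x) (diff_op k a1 \<phi> x)"
      using elim(2) by (simp add: diff_op_def blinfun.sum_right)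
    then have "norm (diff_op k a2 \<phi> x) \<le> norm (C x) * norm (diff_op k a1 \<phi> x)"
      by (simp add: norm_blinfun)
    also have "\<dots> \<le> c * norm (diff_op k a1 \<phi> x)"
      by (rule mult_right_mono) (use \<open>norm (C x) \<le> c\<close> in auto)
    finally show ?case using c by (simp add: ennreal_mult[symmetric] ennreal_leI)
  qed
  then have "L1_norm (diff_op k a2 \<phi>) \<le> (\<integral>\<^sup>+x. ennreal c * ennreal (norm (diff_op k a1 \<phi> x)) \<partial>lebesgue)"
    unfolding L1_norm_def by (rule nn_integral_mono_AE)
  also have "\<dots> = ennreal c * L1_norm (diff_op k a1 \<phi>)"
    unfolding L1_norm_def by (rule nn_integral_cmult[OF m])
  finally show ?thesis .
qed

theorem theorem1p3:
  fixes k :: nat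
    and a1 :: "('n::finite \<Rightarrow> nat) \<Rightarrow> real ^ 'n \<Rightarrow> 'v::real_inner \<Rightarrow>\<^sub>L 'w1::real_inner"
    and a2 :: "('n \<Rightarrow> nat) \<Rightarrow> real ^ 'n \<Rightarrow> 'v \<Rightarrow>\<^sub>L 'w2::real_inner"
    and c :: real
  assumes "finite_dimensional TYPE('v)"
    and "finite_dimensional TYPE('w1)"
    and "finite_dimensional TYPE('w2)"
    and "k \<ge> 1"
    and "\<And>\<alpha>. \<alpha> \<in> multi_indices k \<Longrightarrow> a1 \<alpha> \<in> L1_loc"
    and "\<And>\<alpha>. \<alpha> \<in> multi_indices k \<Longrightarrow> a2 \<alpha> \<in> L1_loc"
    and "c \<ge> 0"
  shows "(\<forall>\<phi>\<in>test_functions. L1_norm (diff_op k a2 \<phi>) \<le> ennreal c * L1_norm (diff_op k a1 \<phi>))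
    \<longleftrightarrow> (\<exists>C :: real ^ 'n \<Rightarrow> 'w1 \<Rightarrow>\<^sub>L 'w2. C \<in> Linf \<and> Linf_norm C \<le> ennreal c \<and>
          (AE x in lebesgue. \<forall>\<alpha>\<in>multi_indices k. a2 \<alpha> x = C x o\<^sub>L a1 \<alpha> x))"
proof
  have c1: "coefficients k a1" using assms by (intro coefficients.intro)
  have c2: "coefficients k a2" using assms by (intro coefficients.intro)
  show "\<exists>C :: real ^ 'n \<Rightarrow> 'w1 \<Rightarrow>\<^sub>L 'w2. C \<in> Linf \<and> Linf_norm C \<le> ennreal c \<and>
      (AE x in lebesgue. \<forall>\<alpha>\<in>multi_indices k. a2 \<alpha> x = C x o\<^sub>L a1 \<alpha> x)"
    if "\<forall>\<phi>\<in>test_functions. L1_norm (diff_op k a2 \<phi>) \<le> ennreal c * L1_norm (diff_op k a1 \<phi>)"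
  proof -
    have "AE x in lebesgue. \<forall>\<xi>. norm (symbol_op k a2 x \<xi>) \<le> c * norm (symbol_op k a1 x \<xi>)"
      using that by (intro AE_all_symbol_le[OF c1 c2 \<open>c \<ge> 0\<close>]) blast
    from exists_multiplier[OF c1 c2 \<open>c \<ge> 0\<close> this]
    obtain C :: "real ^ 'n \<Rightarrow> 'w1 \<Rightarrow>\<^sub>L 'w2" where C: "C \<in> borel_measurable lebesgue" "AE x in lebesgue. norm (C x) \<le> c"
      "AE x in lebesgue. \<forall>\<alpha>\<in>multi_indices k. a2 \<alpha> x = C x o\<^sub>L a1 \<alpha> x" by blast
    have "(\<lambda>x. ennreal (norm (C x))) \<in> borel_measurable lebesgue"
      by (rule measurable_compose[OF measurable_compose[OF C(1) borel_measurable_norm] measurable_ennreal])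
    then have "Linf_norm C \<le> ennreal c"
      unfolding Linf_norm_def using C(2) by (intro esssup_I) (auto elim!: eventually_mono intro: ennreal_leI)
    moreover from this have "C \<in> Linf"
      using C(1) by (auto simp: Linf_def intro: le_less_trans)
    ultimately show ?thesis using C(3) by blast
  qed
  show "\<forall>\<phi>\<in>test_functions. L1_norm (diff_op k a2 \<phi>) \<le> ennreal c * L1_norm (diff_op k a1 \<phi>)"
    if "\<exists>C :: real ^ 'n \<Rightarrow> 'w1 \<Rightarrow>\<^sub>L 'w2. C \<in> Linf \<and> Linf_norm C \<le> ennreal c \<and>
      (AE x in lebesgue. \<forall>\<alpha>\<in>multi_indices k. a2 \<alpha> x = C x o\<^sub>L a1 \<alpha> x)"
    using that L1_norm_le_of_multiplier[OF c1 \<open>c \<ge> 0\<close>] by blast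
qed

end
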